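(* Let $\Sigma$ be a $\sigma$-algebra, let $X$ be a separable Banach space and let $\nu\in {\rm ca}(\Sigma,X)$. If the dual $L_1(\nu)^*$ is order continuous, then $L_1(\nu)$ is separable.
   Context: All Banach spaces are real. For a $\sigma$-algebra $\Sigma$ of subsets of a set $\Omega$ and a Banach space $X$, ${\rm ca}(\Sigma,X)$ is the set of all countably additive $X$-valued measures on $\Sigma$. Let $\nu\in{\rm ca}(\Sigma,X)$. For $x^*\in X^*$, $|x^*\circ\nu|$ denotes the variation of the signed measure $x^*\circ\nu$. A set $A\in\Sigma$ is $\nu$-null if $\nu(B)=0$ for every $B\in\Sigma$ with $B\subseteq A$. A $\Sigma$-measurable function $f:\Omega\to\mathbb{R}$ is $\nu$-integrable if $f\in L_1(|x^*\circ\nu|)$ for all $x^*\in X^*$ and, for each $A\in\Sigma$, there is $\int_A f\,d\nu\in X$ such that $x^*\left(\int_A f\,d\nu\right)=\int_A f\,d(x^*\circ\nu)$ for all $x^*\in X^*$. Identifying functions which coincide $\nu$-a.e., $L_1(\nu)$ is the Banach space of all (classes of) $\nu$-integrable functions with the norm $\|f\|_{L_1(\nu)}=\sup_{x^*\in B_{X^*}}\int_\Omega |f|\,d|x^*\circ\nu|$; it is a Banach lattice with the $\nu$-a.e. order, and $L_1(\nu)^*$ is its dual Banach lattice. A Banach lattice is order continuous if its norm is order continuous. *)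

theory Defs
  imports "HOL-Analysis.Analysis"
begin

section \<open>Normed ordered vector spaces with an explicit carrier\<close>

text \<open>
  The space \<open>L\<^sub>1(\<nu>)\<close> and its dual depend on \<open>\<nu>\<close>, so they are not types. They are represented by
  records. The lattice operations of a Banach lattice are determined by its order and are not
  recorded.
\<close>

record 'e normed_ordered =
  vcarrier :: "'e set"
  vzero :: 'e
  vadd :: "'e \<Rightarrow> 'e \<Rightarrow> 'e"
  vscale :: "real \<Rightarrow> 'e \<Rightarrow> 'e"
  vle :: "'e \<Rightarrow> 'e \<Rightarrow> bool"
  vnorm :: "'e \<Rightarrow> real"

definition norm_separable :: "'e normed_ordered \<Rightarrow> bool" where
  "norm_separable E \<longleftrightarrow>
     (\<exists>D. countable D \<and> D \<subseteq> vcarrier E \<and>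
        (\<forall>x\<in>vcarrier E. \<forall>e>0. \<exists>y\<in>D. vnorm E (vadd E x (vscale E (-1) y)) < e))"

text \<open>Functionals are extensional, so that two of them are equal iff they agree on the carrier.\<close>

definition bounded_functionals :: "'e normed_ordered \<Rightarrow> ('e \<Rightarrow> real) set" where
  "bounded_functionals E =
     {\<phi> \<in> extensional (vcarrier E).
        (\<forall>x\<in>vcarrier E. \<forall>y\<in>vcarrier E. \<phi> (vadd E x y) = \<phi> x + \<phi> y) \<and>
        (\<forall>a. \<forall>x\<in>vcarrier E. \<phi> (vscale E a x) = a * \<phi> x) \<and>
        (\<exists>K. \<forall>x\<in>vcarrier E. \<bar>\<phi> x\<bar> \<le> K * vnorm E x)}"

definition dual_lattice :: "'e normed_ordered \<Rightarrow> ('e \<Rightarrow> real) normed_ordered" where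
  "dual_lattice E =
     \<lparr> vcarrier = bounded_functionals E,
       vzero = restrict (\<lambda>x. 0) (vcarrier E),
       vadd = (\<lambda>\<phi> \<psi>. restrict (\<lambda>x. \<phi> x + \<psi> x) (vcarrier E)),
       vscale = (\<lambda>a \<phi>. restrict (\<lambda>x. a * \<phi> x) (vcarrier E)),
       vle = (\<lambda>\<phi> \<psi>. \<forall>x\<in>vcarrier E. vle E (vzero E) x \<longrightarrow> \<phi> x \<le> \<psi> x),
       vnorm = (\<lambda>\<phi>. SUP x\<in>{x\<in>vcarrier E. vnorm E x \<le> 1}. \<bar>\<phi> x\<bar>) \<rparr>"

definition downward_directed :: "'e normed_ordered \<Rightarrow> 'e set \<Rightarrow> bool" where
  "downward_directed E D \<longleftrightarrow>
     D \<noteq> {} \<and> D \<subseteq> vcarrier E \<and> (\<forall>x\<in>D. \<forall>y\<in>D. \<exists>z\<in>D. vle E z x \<and> vle E z y)"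

definition infimum_zero :: "'e normed_ordered \<Rightarrow> 'e set \<Rightarrow> bool" where
  "infimum_zero E D \<longleftrightarrow>
     (\<forall>x\<in>D. vle E (vzero E) x) \<and>
     (\<forall>z\<in>vcarrier E. (\<forall>x\<in>D. vle E z x) \<longrightarrow> vle E z (vzero E))"

text \<open>
  The norm is order continuous if every downward directed set with infimum \<open>0\<close>, regarded as a
  decreasing net, converges to \<open>0\<close> in norm.
\<close>

definition order_continuous :: "'e normed_ordered \<Rightarrow> bool" where
  "order_continuous E \<longleftrightarrow>
     (\<forall>D. downward_directed E D \<and> infimum_zero E D \<longrightarrow>
        (\<forall>e>0. \<exists>x\<in>D. \<forall>y\<in>D. vle E y x \<longrightarrow> vnorm E y < e))"

section \<open>Signed measures\<close>

definition variation :: "'a set set \<Rightarrow> ('a set \<Rightarrow> real) \<Rightarrow> 'a set \<Rightarrow> ennreal" where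
  "variation \<Sigma> \<mu> A =
     (SUP P\<in>{P. finite P \<and> partition_on A P \<and> P \<subseteq> \<Sigma>}. \<Sum>B\<in>P. ennreal \<bar>\<mu> B\<bar>)"

definition variation_measure :: "'a set \<Rightarrow> 'a set set \<Rightarrow> ('a set \<Rightarrow> real) \<Rightarrow> 'a measure" where
  "variation_measure \<Omega> \<Sigma> \<mu> = measure_of \<Omega> \<Sigma> (variation \<Sigma> \<mu>)"

text \<open>
  The positive part of the Jordan decomposition; the negative part of \<open>\<mu>\<close> is the positive part of
  \<open>-\<mu>\<close>. Sets \<open>B\<close> with \<open>\<mu> B < 0\<close> do not contribute, since \<open>ennreal\<close> maps negative numbers to \<open>0\<close>.
\<close>

definition positive_part :: "'a set \<Rightarrow> 'a set set \<Rightarrow> ('a set \<Rightarrow> real) \<Rightarrow> 'a measure" where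
  "positive_part \<Omega> \<Sigma> \<mu> =
     measure_of \<Omega> \<Sigma> (\<lambda>A. SUP B\<in>{B\<in>\<Sigma>. B \<subseteq> A}. ennreal (\<mu> B))"

definition signed_integral ::
    "'a set \<Rightarrow> 'a set set \<Rightarrow> ('a set \<Rightarrow> real) \<Rightarrow> 'a set \<Rightarrow> ('a \<Rightarrow> real) \<Rightarrow> real" where
  "signed_integral \<Omega> \<Sigma> \<mu> A f =
     (LINT \<omega>:A|positive_part \<Omega> \<Sigma> \<mu>. f \<omega>) - (LINT \<omega>:A|positive_part \<Omega> \<Sigma> (\<lambda>B. - \<mu> B). f \<omega>)"

section \<open>Vector measures\<close>

definition ca :: "'a set set \<Rightarrow> ('a set \<Rightarrow> 'x::banach) set" where
  "ca \<Sigma> = {\<nu>. \<forall>A::nat \<Rightarrow> 'a set. range A \<subseteq> \<Sigma> \<and> disjoint_family A \<longrightarrow>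
               (\<lambda>n. \<nu> (A n)) sums \<nu> (\<Union>n. A n)}"

definition null_set :: "'a set set \<Rightarrow> ('a set \<Rightarrow> 'x::banach) \<Rightarrow> 'a set \<Rightarrow> bool" where
  "null_set \<Sigma> \<nu> A \<longleftrightarrow> A \<in> \<Sigma> \<and> (\<forall>B\<in>\<Sigma>. B \<subseteq> A \<longrightarrow> \<nu> B = 0)"

definition dual_comp :: "('x::banach \<Rightarrow>\<^sub>L real) \<Rightarrow> ('a set \<Rightarrow> 'x) \<Rightarrow> 'a set \<Rightarrow> real" where
  "dual_comp x' \<nu> = (\<lambda>A. blinfun_apply x' (\<nu> A))"

definition vm_integrable ::
    "'a set \<Rightarrow> 'a set set \<Rightarrow> ('a set \<Rightarrow> 'x::banach) \<Rightarrow> ('a \<Rightarrow> real) \<Rightarrow> bool" where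
  "vm_integrable \<Omega> \<Sigma> \<nu> f \<longleftrightarrow>
     f \<in> borel_measurable (sigma \<Omega> \<Sigma>) \<and>
     (\<forall>x'. integrable (variation_measure \<Omega> \<Sigma> (dual_comp x' \<nu>)) f) \<and>
     (\<forall>A\<in>\<Sigma>. \<exists>v. \<forall>x'. blinfun_apply x' v = signed_integral \<Omega> \<Sigma> (dual_comp x' \<nu>) A f)"

definition L1_norm ::
    "'a set \<Rightarrow> 'a set set \<Rightarrow> ('a set \<Rightarrow> 'x::banach) \<Rightarrow> ('a \<Rightarrow> real) \<Rightarrow> real" where
  "L1_norm \<Omega> \<Sigma> \<nu> f =
     (SUP x'\<in>{x' :: 'x \<Rightarrow>\<^sub>L real. norm x' \<le> 1}.
        LINT \<omega>|variation_measure \<Omega> \<Sigma> (dual_comp x' \<nu>). \<bar>f \<omega>\<bar>)"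

definition L1_class ::
    "'a set \<Rightarrow> 'a set set \<Rightarrow> ('a set \<Rightarrow> 'x::banach) \<Rightarrow> ('a \<Rightarrow> real) \<Rightarrow> ('a \<Rightarrow> real) set" where
  "L1_class \<Omega> \<Sigma> \<nu> f =
     {g. vm_integrable \<Omega> \<Sigma> \<nu> g \<and> null_set \<Sigma> \<nu> {\<omega>\<in>\<Omega>. f \<omega> \<noteq> g \<omega>}}"

text \<open>
  The elements of \<open>L\<^sub>1(\<nu>)\<close> are equivalence classes of integrable functions. Functions are total on
  the type, and their values outside \<open>\<Omega>\<close> are disregarded by the equivalence.
\<close>

definition L1 ::
    "'a set \<Rightarrow> 'a set set \<Rightarrow> ('a set \<Rightarrow> 'x::banach) \<Rightarrow> ('a \<Rightarrow> real) set normed_ordered" where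
  "L1 \<Omega> \<Sigma> \<nu> =
     \<lparr> vcarrier = L1_class \<Omega> \<Sigma> \<nu> ` {f. vm_integrable \<Omega> \<Sigma> \<nu> f},
       vzero = L1_class \<Omega> \<Sigma> \<nu> (\<lambda>\<omega>. 0),
       vadd = (\<lambda>F G. \<Union>f\<in>F. \<Union>g\<in>G. L1_class \<Omega> \<Sigma> \<nu> (\<lambda>\<omega>. f \<omega> + g \<omega>)),
       vscale = (\<lambda>a F. \<Union>f\<in>F. L1_class \<Omega> \<Sigma> \<nu> (\<lambda>\<omega>. a * f \<omega>)),
       vle = (\<lambda>F G. \<exists>f\<in>F. \<exists>g\<in>G. null_set \<Sigma> \<nu> {\<omega>\<in>\<Omega>. \<not> f \<omega> \<le> g \<omega>}),
       vnorm = (\<lambda>F. the_elem (L1_norm \<Omega> \<Sigma> \<nu> ` F)) \<rparr>"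

end

theory Submission
  imports Defs "HOL-Probability.Conditional_Expectation"
begin

text \<open>
  Write \<open>|x'\<nu>|\<close> for the variation of \<open>x' \<circ> \<nu>\<close>. As \<open>X\<close> is separable, its dual unit ball contains a sequence
  \<open>x\<^sub>n\<close> that is dense for pointwise convergence on \<open>X\<close>, and \<open>\<mu> = \<Sum>\<^sub>n 2\<^sup>-\<^sup>n\<^sup>-\<^sup>1 |x\<^sub>n\<nu>|\<close> is a control measure for \<open>\<nu>\<close>.
  For each integrable \<open>f\<close> the map \<open>x' \<mapsto> \<integral> |f| d|x'\<nu>|\<close> is a supremum of maps \<open>x' \<mapsto> |x'(u)|\<close> with \<open>u \<in> X\<close>,
  hence lower semicontinuous for pointwise convergence, so the norm of \<open>L\<^sub>1(\<nu>)\<close> is already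
  \<open>\<parallel>f\<parallel> = sup\<^sub>n \<integral> |f| d|x\<^sub>n\<nu>|\<close>. Let \<open>F\<close> be a countably generated \<open>\<sigma>\<close>-algebra that makes all the densities
  \<open>d|x\<^sub>n\<nu>|/d\<mu>\<close> measurable. Then \<open>\<parallel>f\<parallel>\<close> depends only on the conditional expectation of \<open>|f|\<close> given \<open>F\<close>.
  
  The order continuity of the dual is used once. For sets \<open>A\<^sub>k\<close> decreasing to a null set, the functionals
  \<open>f \<mapsto> \<integral> f 1\<^bsub>A\<^sub>k\<^esub> d\<mu>\<close> decrease to \<open>0\<close> in the dual, so their norms tend to \<open>0\<close>: the unit ball of \<open>L\<^sub>1(\<nu>)\<close>
  is uniformly integrable in \<open>L\<^sub>1(\<mu>)\<close> (lemma \<open>uniformly_integrable_unit_ball\<close>). Given \<open>A\<close>, put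
  \<open>p = E(1\<^sub>A | F)\<close> and call \<open>{p \<noteq> 0}\<close> the envelope of \<open>A\<close>; it is the smallest set of \<open>F\<close> that contains \<open>A\<close>
  up to null sets. The function \<open>1\<^sub>A / p\<close> (a limit of simple functions) has norm at most \<open>\<parallel>1\<parallel>\<close>, lives on \<open>A\<close>,
  and its \<open>\<mu>\<close>-integral is the measure of the envelope. By uniform integrability, therefore, sets of small measure have
  envelopes of small measure (lemma \<open>small_envelope\<close>).
  
  This last property forces the whole \<open>\<sigma>\<close>-algebra to be countably generated up to null sets. The sets
  \<open>C \<subseteq> B\<close> with the same envelope as \<open>B\<close> are now closed under decreasing intersections, so one of them
  has minimal measure, and minimality says that every measurable subset of \<open>C\<close> is the trace on \<open>C\<close> of
  a set of \<open>F\<close> (lemma \<open>ex_conditional_atom\<close>). By exhaustion, countably many such conditional atoms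
  cover \<open>\<Omega>\<close>, and together with the generators of \<open>F\<close> they generate everything modulo null sets.
  
  It remains to see that rational step functions over a countable dense family of sets are dense in
  \<open>L\<^sub>1(\<nu>)\<close>. This needs the norm of \<open>L\<^sub>1(\<nu>)\<close> to be order continuous (lemma \<open>uniform_integral_decseq\<close>), which is an
  Orlicz-Pettis argument: a sequence in the dual ball has a pointwise convergent subsequence, and a
  gliding hump shows that setwise convergence of summable sequences makes the diagonal vanish.
\<close>

section \<open>Pointwise convergence of functionals and the Orlicz-Pettis theorem\<close>

text \<open>
  The diagonal form of Schur's theorem: if the rows of a matrix are summable and converge to \<open>0\<close> on
  every set of indices, then the diagonal tends to \<open>0\<close>. Otherwise indices \<open>r j\<close> can be chosen so
  sparsely that in row \<open>r (Suc j)\<close> the sum over \<open>range r\<close> is dominated by its diagonal entry.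
\<close>

lemma Schur_diagonal:
  fixes b :: "nat \<Rightarrow> nat \<Rightarrow> real"
  assumes summ: "\<And>k. summable (\<lambda>m. \<bar>b k m\<bar>)"
    and lim: "\<And>M. (\<lambda>k. \<Sum>m. indicator M m * b k m) \<longlonglongrightarrow> 0"
  shows "(\<lambda>k. b k k) \<longlonglongrightarrow> 0"
proof (rule ccontr)
  assume "\<not> (\<lambda>k. b k k) \<longlonglongrightarrow> 0"
  then obtain e where e: "e > 0" and inf: "\<And>N. \<exists>k\<ge>N. \<bar>b k k\<bar> \<ge> e"
    unfolding lim_sequentially by (force simp: not_less)
  have col: "(\<lambda>k. b k m) \<longlonglongrightarrow> 0" for m
  proof -
    have "(\<Sum>i. indicator {m} i * b k i) = b k m" for k
      by (subst suminf_finite[of "{m}"]) auto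
    with lim[of "{m}"] show ?thesis by simp
  qed
  have ex: "\<exists>q>p. \<bar>b q q\<bar> \<ge> e \<and> (\<Sum>m\<le>p. \<bar>b q m\<bar>) < e / 4 \<and> (\<Sum>m. \<bar>b p (m + q)\<bar>) < e / 4" for p
  proof -
    have "(\<lambda>q. \<Sum>m\<le>p. \<bar>b q m\<bar>) \<longlonglongrightarrow> (\<Sum>m\<le>p. \<bar>0\<bar>)"
      by (intro tendsto_intros col)
    then have "\<forall>\<^sub>F q in sequentially. (\<Sum>m\<le>p. \<bar>b q m\<bar>) < e / 4"
      using e by (intro order_tendstoD) auto
    moreover have "\<forall>\<^sub>F q in sequentially. (\<Sum>m. \<bar>b p (m + q)\<bar>) < e / 4"
      using suminf_exist_split2[OF summ[of p]] e by (intro order_tendstoD) auto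
    ultimately have "\<forall>\<^sub>F q in sequentially. (\<Sum>m\<le>p. \<bar>b q m\<bar>) < e / 4 \<and> (\<Sum>m. \<bar>b p (m + q)\<bar>) < e / 4"
      by (rule eventually_conj)
    then obtain N where N: "\<And>q. q \<ge> N \<Longrightarrow>
        (\<Sum>m\<le>p. \<bar>b q m\<bar>) < e / 4 \<and> (\<Sum>m. \<bar>b p (m + q)\<bar>) < e / 4"
      unfolding eventually_sequentially by blast
    obtain q where "q \<ge> max N (Suc p)" "\<bar>b q q\<bar> \<ge> e" using inf by blast
    with N[of q] show ?thesis by (intro exI[of _ q]) auto
  qed
  then obtain next_ix where nx: "\<And>p. next_ix p > p \<and> \<bar>b (next_ix p) (next_ix p)\<bar> \<ge> e \<and>
      (\<Sum>m\<le>p. \<bar>b (next_ix p) m\<bar>) < e / 4 \<and> (\<Sum>m. \<bar>b p (m + next_ix p)\<bar>) < e / 4"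
    by metis
  define r where "r = (\<lambda>j. (next_ix ^^ j) 0)"
  have r_Suc: "r (Suc j) = next_ix (r j)" for j by (simp add: r_def)
  have mono: "strict_mono r" by (simp add: strict_mono_Suc_iff r_Suc nx)
  have big: "\<bar>\<Sum>m. indicator (range r) m * b (r (Suc j)) m\<bar> \<ge> e / 2" for j
  proof -
    let ?k = "r (Suc j)" and ?p = "r j" and ?q = "r (Suc (Suc j))"
    define c where "c = (\<lambda>m. indicator (range r) m * b ?k m - (if m = ?k then b ?k ?k else 0))"
    define d where "d = (\<lambda>m. (if m \<le> ?p then \<bar>b ?k m\<bar> else 0) + (if m \<ge> ?q then \<bar>b ?k m\<bar> else 0))"
    \<comment> \<open>Restricted to \<open>range r\<close> and without its diagonal entry, row \<open>?k\<close> lives on \<open>{..?p}\<close> and \<open>{?q..}\<close>.\<close>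
    have c0: "c m = 0" if "?p < m" "m < ?q" for m
    proof (cases "m \<in> range r")
      case True
      then obtain i where "m = r i" by auto
      with that mono have "i = Suc j" by (metis less_Suc_eq less_trans_Suc not_less_eq strict_mono_less)
      then show ?thesis by (simp add: c_def \<open>m = r i\<close>)
    next
      case False
      then show ?thesis by (auto simp: c_def)
    qed
    have pk: "?p < ?k" "?k < ?q" using mono by (simp_all add: strict_mono_less)
    have cd: "\<bar>c m\<bar> \<le> d m" for m
      using c0[of m] pk by (auto simp: c_def d_def indicator_def split: if_splits)
    have s1: "summable (\<lambda>m. if m \<le> ?p then \<bar>b ?k m\<bar> else 0)"
      by (rule summable_finite[of "{..?p}"]) auto
    have s2: "summable (\<lambda>m. if m \<ge> ?q then \<bar>b ?k m\<bar> else 0)"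
      by (rule summable_comparison_test'[OF summ[of ?k], of 0]) auto
    have sd: "summable d" unfolding d_def by (intro summable_add s1 s2)
    have sc: "summable (\<lambda>m. \<bar>c m\<bar>)"
      by (rule summable_comparison_test'[OF sd, of 0]) (use cd in auto)
    have "suminf d = (\<Sum>m\<le>?p. \<bar>b ?k m\<bar>) + (\<Sum>m. \<bar>b ?k (m + ?q)\<bar>)"
    proof -
      have "(\<Sum>m. if m \<le> ?p then \<bar>b ?k m\<bar> else 0) = (\<Sum>m\<le>?p. \<bar>b ?k m\<bar>)"
        by (subst suminf_finite[of "{..?p}"]) auto
      moreover have "(\<Sum>m. if m \<ge> ?q then \<bar>b ?k m\<bar> else 0) = (\<Sum>m. \<bar>b ?k (m + ?q)\<bar>)"
        by (subst suminf_split_initial_segment[OF s2, of ?q]) auto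
      ultimately show ?thesis
        unfolding d_def by (subst suminf_add[symmetric, OF s1 s2]) simp
    qed
    also have "\<dots> < e / 4 + e / 4"
      using nx[of ?p] nx[of ?k] by (intro add_strict_mono) (auto simp: r_Suc)
    finally have "suminf d < e / 2" by simp
    moreover have "\<bar>suminf c\<bar> \<le> suminf d"
      using summable_rabs[OF sc] suminf_le[OF cd sc sd] by linarith
    moreover have "suminf c = (\<Sum>m. indicator (range r) m * b ?k m) - b ?k ?k"
    proof -
      have "summable (\<lambda>m. \<bar>indicator (range r) m * b ?k m\<bar>)"
        by (rule summable_comparison_test'[OF summ[of ?k], of 0]) (auto simp: indicator_def)
      then have 1: "summable (\<lambda>m. indicator (range r) m * b ?k m)"
        by (rule summable_rabs_cancel)
      have 2: "(\<lambda>m. if m = ?k then b ?k ?k else 0) sums b ?k ?k"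
        by (rule sums_single[of ?k "\<lambda>_. b ?k ?k"])
      show ?thesis unfolding c_def
        by (subst suminf_diff[OF 1 sums_summable[OF 2], symmetric]) (simp add: sums_unique[OF 2, symmetric])
    qed
    moreover have "\<bar>b ?k ?k\<bar> \<ge> e" using nx[of ?p] by (simp add: r_Suc)
    ultimately show ?thesis by linarith
  qed
  have lim_r: "(\<lambda>j. \<Sum>m. indicator (range r) m * b (r (Suc j)) m) \<longlonglongrightarrow> 0"
    using LIMSEQ_Suc[OF LIMSEQ_subseq_LIMSEQ[OF lim[of "range r"] mono]] by (simp add: o_def)
  have "\<forall>\<^sub>F j in sequentially. \<bar>\<Sum>m. indicator (range r) m * b (r (Suc j)) m\<bar> < e / 2"
    using tendstoD[OF lim_r half_gt_zero[OF e]] unfolding dist_real_def diff_0_right .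
  then show False using big by (auto simp: eventually_sequentially not_less[symmetric])
qed

lemma separable_dense_sequence:
  assumes "separable_space (euclidean :: 'x::metric_space topology)"
  shows "\<exists>d :: nat \<Rightarrow> 'x. \<forall>u. \<forall>e>0. \<exists>k. dist (d k) u < e"
proof -
  obtain C :: "'x set" where C: "countable C" "closure C = UNIV"
    using assms unfolding separable_space_def by auto
  then have "C \<noteq> {}" by auto
  then have r: "range (from_nat_into C) = C" using C(1) by (simp add: range_from_nat_into)
  show ?thesis
  proof (intro exI[of _ "from_nat_into C"] allI impI)
    fix u :: 'x and e :: real assume "e > 0"
    then obtain y where "y \<in> C" "dist y u < e"
      using C(2) closure_approachable[of u C] by auto
    then show "\<exists>k. dist (from_nat_into C k) u < e" using r by (metis rangeE)
  qed
qed

text \<open>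
  The dual unit ball embeds into \<open>nat \<Rightarrow> real\<close> by evaluation on a dense sequence, and every subset of that
  second countable metric space is separable.
\<close>

lemma dual_ball_pointwise_separable:
  assumes "separable_space (euclidean :: 'x::real_normed_vector topology)"
  shows "\<exists>xs :: nat \<Rightarrow> 'x \<Rightarrow>\<^sub>L real. (\<forall>n. norm (xs n) \<le> 1) \<and>
    (\<forall>x' u e. norm x' \<le> 1 \<longrightarrow> e > 0 \<longrightarrow> (\<exists>n. \<bar>blinfun_apply (xs n) u - blinfun_apply x' u\<bar> < e))"
proof -
  obtain d :: "nat \<Rightarrow> 'x" where d: "\<And>u e. e > 0 \<Longrightarrow> \<exists>k. dist (d k) u < e"
    using separable_dense_sequence[OF assms] by blast
  define \<Phi> where "\<Phi> = (\<lambda>(x' :: 'x \<Rightarrow>\<^sub>L real) k. x' (d k))"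
  let ?B = "{x' :: 'x \<Rightarrow>\<^sub>L real. norm x' \<le> 1}"
  obtain T where T: "countable T" "T \<subseteq> \<Phi> ` ?B" "\<Phi> ` ?B \<subseteq> closure T"
    by (rule separable)
  have "\<Phi> 0 \<in> closure T" using T(3) by auto
  then have ne: "T \<noteq> {}" by auto
  have "\<exists>x'. norm x' \<le> 1 \<and> \<Phi> x' = from_nat_into T n" for n
    using subsetD[OF T(2) from_nat_into[OF ne, of n]] by (auto simp: eq_commute)
  then obtain xs where xs: "\<And>n. norm (xs n) \<le> 1" "\<And>n. \<Phi> (xs n) = from_nat_into T n"
    by metis
  show ?thesis
  proof (intro exI[of _ xs] conjI allI impI xs(1))
    fix x' :: "'x \<Rightarrow>\<^sub>L real" and u :: 'x and e :: real
    assume x': "norm x' \<le> 1" and e: "e > 0"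
    obtain k where k: "dist (d k) u < e / 3" using d[of "e / 3" u] e by auto
    let ?U = "(\<lambda>g. g k) -` {x' (d k) - e / 3 <..< x' (d k) + e / 3}"
    have "open ?U"
      by (intro open_vimage continuous_on_product_coordinates open_greaterThanLessThan)
    moreover have "\<Phi> x' \<in> ?U" using e by (simp add: \<Phi>_def)
    moreover have "\<Phi> x' \<in> closure T" using T(3) x' by auto
    ultimately have "?U \<inter> T \<noteq> {}"
      by (meson disjoint_iff open_Int_closure_eq_empty)
    then obtain n where "from_nat_into T n \<in> ?U"
      using T(1) by (metis IntE all_not_in_conv from_nat_into_surj)
    then have "\<Phi> (xs n) \<in> ?U" by (simp add: xs(2))
    then have "x' (d k) - e / 3 < xs n (d k)" "xs n (d k) < x' (d k) + e / 3" by (auto simp: \<Phi>_def)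
    then have 1: "\<bar>xs n (d k) - x' (d k)\<bar> < e / 3" by linarith
    have small: "\<bar>blinfun_apply z (u - d k)\<bar> < e / 3" if "norm z \<le> 1" for z :: "'x \<Rightarrow>\<^sub>L real"
    proof -
      have "\<bar>z (u - d k)\<bar> \<le> norm z * norm (u - d k)" using norm_blinfun[of z "u - d k"] by simp
      also have "\<dots> \<le> norm (u - d k)" using that by (simp add: mult_left_le_one_le)
      also have "\<dots> < e / 3" using k by (simp add: dist_norm norm_minus_commute)
      finally show ?thesis .
    qed
    have "\<bar>xs n u - x' u\<bar> < e"
      using 1 small[OF xs(1)[of n]] small[OF x'] unfolding blinfun.diff_right by linarith
    then show "\<exists>n. \<bar>xs n u - x' u\<bar> < e" ..
  qed
qed

text \<open>
  Sequential Banach-Alaoglu: on a dense sequence the values stay in a compact product of intervals.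
\<close>

lemma bounded_functionals_pointwise_subsequence:
  fixes z :: "nat \<Rightarrow> 'x::real_normed_vector \<Rightarrow>\<^sub>L real"
  assumes "separable_space (euclidean :: 'x topology)" and z: "\<And>k. norm (z k) \<le> 1"
  shows "\<exists>r z0. strict_mono (r :: nat \<Rightarrow> nat) \<and>
    (\<forall>u. (\<lambda>k. blinfun_apply (z (r k)) u) \<longlonglongrightarrow> blinfun_apply z0 u)"
proof -
  obtain d :: "nat \<Rightarrow> 'x" where d: "\<And>u e. e > 0 \<Longrightarrow> \<exists>k. dist (d k) u < e"
    using separable_dense_sequence[OF assms(1)] by blast
  have bd: "\<bar>z k u\<bar> \<le> norm u" for k u
  proof -
    have "\<bar>z k u\<bar> \<le> norm (z k) * norm u" using norm_blinfun[of "z k" u] by simp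
    also have "\<dots> \<le> norm u" using z[of k] by (simp add: mult_left_le_one_le)
    finally show ?thesis .
  qed
  let ?K = "PiE UNIV (\<lambda>i. {- norm (d i) .. norm (d i)})"
  have "compactin (product_topology (\<lambda>i::nat. euclideanreal) UNIV) ?K"
    by (subst compactin_PiE) auto
  then have "compact ?K" by (simp add: euclidean_product_topology)
  then have "seq_compact ?K" by (rule compact_imp_seq_compact)
  define f where "f = (\<lambda>k i. blinfun_apply (z k) (d i))"
  have f: "\<forall>k. f k \<in> ?K"
  proof
    fix k
    have "- norm (d i) \<le> z k (d i) \<and> z k (d i) \<le> norm (d i)" for i
      using bd[of k "d i"] by linarith
    then show "f k \<in> ?K" by (auto simp: f_def)
  qed
  obtain l r where r: "strict_mono (r :: nat \<Rightarrow> nat)" and l: "(f \<circ> r) \<longlonglongrightarrow> l"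
    using seq_compactE[OF \<open>seq_compact ?K\<close> f] by blast
  have conv_d: "convergent (\<lambda>k. z (r k) (d i))" for i
  proof -
    have "(\<lambda>k. (f \<circ> r) k i) \<longlonglongrightarrow> l i"
      by (rule continuous_on_tendsto_compose[OF continuous_on_product_coordinates[of i] l]) auto
    then show ?thesis by (auto simp: convergent_def o_def f_def)
  qed
  have conv: "convergent (\<lambda>k. z (r k) u)" for u
  proof (rule Cauchy_convergent, rule metric_CauchyI)
    fix e :: real assume e: "e > 0"
    obtain i where i: "dist (d i) u < e / 3" using d[of "e / 3" u] e by auto
    obtain N where N: "\<And>m n. m \<ge> N \<Longrightarrow> n \<ge> N \<Longrightarrow> \<bar>z (r m) (d i) - z (r n) (d i)\<bar> < e / 3"
      using metric_CauchyD[OF convergent_Cauchy[OF conv_d[of i]], of "e / 3"] e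
      unfolding dist_real_def by auto
    have a: "\<bar>z (r m) u - z (r m) (d i)\<bar> < e / 3" for m
      using bd[of "r m" "u - d i"] i by (simp add: blinfun.diff_right dist_norm norm_minus_commute)
    have "dist (z (r m) u) (z (r n) u) < e" if "m \<ge> N" "n \<ge> N" for m n
      using N[OF that] a[of m] a[of n] unfolding dist_real_def by linarith
    then show "\<exists>M. \<forall>m\<ge>M. \<forall>n\<ge>M. dist (z (r m) u) (z (r n) u) < e" by blast
  qed
  define L where "L = (\<lambda>u. lim (\<lambda>k. z (r k) u))"
  have L: "(\<lambda>k. z (r k) u) \<longlonglongrightarrow> L u" for u
    using conv[of u] by (simp add: L_def convergent_LIMSEQ_iff)
  have "bounded_linear L"
  proof (rule bounded_linear_intro[of _ 1])
    fix u v a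
    show "L (u + v) = L u + L v"
      using LIMSEQ_unique[OF L[of "u + v"]] tendsto_add[OF L[of u] L[of v]]
      by (simp add: blinfun.add_right)
    show "L (a *\<^sub>R u) = a *\<^sub>R L u"
      using LIMSEQ_unique[OF L[of "a *\<^sub>R u"]] tendsto_mult_left[OF L[of u], of a]
      by (simp add: blinfun.scaleR_right)
    show "norm (L u) \<le> norm u * 1"
      using LIMSEQ_le_const2[OF tendsto_rabs[OF L[of u]], of "norm u"] bd by auto
  qed
  then have "blinfun_apply (Blinfun L) = L" by (rule bounded_linear_Blinfun_apply)
  then show ?thesis using r L by (intro exI[of _ r] exI[of _ "Blinfun L"]) simp
qed

text \<open>
  The core of the Orlicz-Pettis theorem: if \<open>w\<close> is weakly countably additive on sets of natural numbers,
  then its values on singletons cannot stay bounded away from \<open>0\<close> along functionals of norm at most \<open>1\<close>.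
\<close>

lemma Orlicz_Pettis_separable:
  fixes w :: "nat set \<Rightarrow> 'x::real_normed_vector" and z :: "nat \<Rightarrow> 'x \<Rightarrow>\<^sub>L real"
  assumes sep: "separable_space (euclidean :: 'x topology)"
    and z: "\<And>k. norm (z k) \<le> 1"
    and summ: "\<And>x' :: 'x \<Rightarrow>\<^sub>L real. summable (\<lambda>m. \<bar>blinfun_apply x' (w {m})\<bar>)"
    and w: "\<And>(x' :: 'x \<Rightarrow>\<^sub>L real) M. (\<Sum>m. indicator M m * blinfun_apply x' (w {m})) = blinfun_apply x' (w M)"
    and e: "e > 0"
  shows "\<exists>k. \<bar>blinfun_apply (z k) (w {k})\<bar> < e"
proof -
  obtain r z0 where r: "strict_mono (r :: nat \<Rightarrow> nat)" and z0: "\<And>u. (\<lambda>k. z (r k) u) \<longlonglongrightarrow> blinfun_apply z0 u"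
    using bounded_functionals_pointwise_subsequence[OF sep, of z, OF z] by blast
  define b where "b = (\<lambda>k m. (z (r k) - z0) (w {r m}))"
  have inj: "inj r" using r by (rule strict_mono_imp_inj_on)
  have "(\<lambda>k. b k k) \<longlonglongrightarrow> 0"
  proof (rule Schur_diagonal[of b])
    fix k
    show "summable (\<lambda>m. \<bar>b k m\<bar>)"
      using summable_reindex[OF summ inj, of "z (r k) - z0"] by (auto simp: b_def o_def)
  next
    fix M
    have "(\<Sum>m. indicator M m * b k m) = (z (r k) - z0) (w (r ` M))" for k
    proof -
      let ?g = "\<lambda>m. indicator (r ` M) m * (z (r k) - z0) (w {m})"
      have "(\<lambda>m. ?g (r m)) = (\<lambda>m. indicator M m * b k m)"
        using inj by (auto simp: b_def indicator_def inj_image_mem_iff)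
      moreover have "(\<Sum>m. ?g (r m)) = suminf ?g"
        by (rule suminf_mono_reindex[OF r]) (auto simp: indicator_def)
      ultimately show ?thesis using w[of "r ` M" "z (r k) - z0"] by simp
    qed
    then show "(\<lambda>k. \<Sum>m. indicator M m * b k m) \<longlonglongrightarrow> 0"
      using tendsto_diff[OF z0[of "w (r ` M)"] tendsto_const[of "z0 (w (r ` M))"]]
      by (simp add: blinfun.diff_left)
  qed
  moreover have "(\<lambda>k. z0 (w {r k})) \<longlonglongrightarrow> 0"
    using LIMSEQ_subseq_LIMSEQ[OF summable_LIMSEQ_zero[OF summ[of z0]] r]
    by (simp add: o_def tendsto_rabs_zero_iff)
  ultimately have "(\<lambda>k. b k k + z0 (w {r k})) \<longlonglongrightarrow> 0 + 0" by (rule tendsto_add)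
  then have lim_zr: "(\<lambda>k. z (r k) (w {r k})) \<longlonglongrightarrow> 0" by (simp add: b_def blinfun.diff_left)
  have "\<forall>\<^sub>F k in sequentially. \<bar>z (r k) (w {r k})\<bar> < e"
    using tendstoD[OF lim_zr e] unfolding dist_real_def diff_0_right .
  then obtain k where "\<bar>z (r k) (w {r k})\<bar> < e" by (auto simp: eventually_sequentially)
  then show ?thesis by blast
qed

text \<open>
  Uniform boundedness on the dual space, by the Baire category theorem.
\<close>

lemma weakly_bounded_imp_uniformly_bounded:
  fixes U :: "'x::real_normed_vector set"
  assumes bd: "\<And>x' :: 'x \<Rightarrow>\<^sub>L real. \<exists>K. \<forall>u\<in>U. \<bar>blinfun_apply x' u\<bar> \<le> K"
  shows "\<exists>K. \<forall>x' :: 'x \<Rightarrow>\<^sub>L real. \<forall>u\<in>U. norm x' \<le> 1 \<longrightarrow> \<bar>blinfun_apply x' u\<bar> \<le> K"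
proof -
  define C where "C = (\<lambda>n::nat. {x' :: 'x \<Rightarrow>\<^sub>L real. \<forall>u\<in>U. \<bar>x' u\<bar> \<le> real n})"
  have closed: "closed (C n)" for n
  proof -
    have "C n = (\<Inter>u\<in>U. {x'. \<bar>blinfun_apply x' u\<bar> \<le> real n})" by (auto simp: C_def)
    then show ?thesis
      by (auto intro!: closed_INT closed_Collect_le continuous_intros)
  qed
  have "\<exists>n. interior (C n) \<noteq> {}"
  proof (rule ccontr)
    assume "\<not> ?thesis"
    then have "euclidean interior_of \<Union>(range C) = {}"
      using closed by (intro Baire_category_alt) (auto simp: completely_metrizable_space_euclidean)
    moreover have "\<Union>(range C) = UNIV"
    proof -
      have "x' \<in> \<Union>(range C)" for x'
      proof -
        obtain K where "\<forall>u\<in>U. \<bar>blinfun_apply x' u\<bar> \<le> K" using bd by blast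
        then have "x' \<in> C (nat \<lceil>K\<rceil>)" by (auto simp: C_def) (smt (verit) real_nat_ceiling_ge)
        then show ?thesis by blast
      qed
      then show ?thesis by auto
    qed
    ultimately show False by simp
  qed
  then obtain n y e where e: "e > 0" and b: "cball y e \<subseteq> C n"
    by (metis all_not_in_conv mem_interior_cball)
  show ?thesis
  proof (intro exI[of _ "2 * real n / e"] allI ballI impI)
    fix x' :: "'x \<Rightarrow>\<^sub>L real" and u assume x': "norm x' \<le> 1" and u: "u \<in> U"
    have "y + e *\<^sub>R x' \<in> cball y e" using x' e by (simp add: dist_norm mult_le_cancel_left1)
    moreover have "y \<in> cball y e" using e by simp
    ultimately have "\<bar>(y + e *\<^sub>R x') u\<bar> \<le> n" "\<bar>y u\<bar> \<le> n" using b u unfolding C_def by blast+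
    then have "\<bar>e * x' u\<bar> \<le> 2 * n" by (simp add: blinfun.add_left blinfun.scaleR_left)
    then show "\<bar>x' u\<bar> \<le> 2 * real n / e" using e by (simp add: abs_mult field_simps)
  qed
qed

section \<open>Signed measures: Hahn decomposition and variation\<close>

context sigma_algebra
begin

text \<open>
  In this section \<open>M\<close> is the given \<open>\<sigma>\<close>-algebra on \<open>\<Omega>\<close>.
\<close>

lemma ca_empty: "\<nu> \<in> ca M \<Longrightarrow> \<nu> {} = 0"
proof -
  assume "\<nu> \<in> ca M"
  then have "(\<lambda>n::nat. \<nu> {}) sums \<nu> (\<Union>n::nat. {})"
    unfolding ca_def by (auto simp: disjoint_family_on_def dest!: spec[of _ "\<lambda>n::nat. {}"])
  then have "(\<lambda>n::nat. \<nu> {}) \<longlonglongrightarrow> 0" by (intro summable_LIMSEQ_zero) (rule sums_summable)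
  then show ?thesis by (simp add: LIMSEQ_const_iff)
qed

lemma ca_sums:
  assumes "\<nu> \<in> ca M" "\<And>n::nat. A n \<in> M" "disjoint_family A"
  shows "(\<lambda>n. \<nu> (A n)) sums \<nu> (\<Union>n. A n)"
  using assms unfolding ca_def by auto

lemma ca_Un:
  assumes "\<nu> \<in> ca M" "A \<in> M" "B \<in> M" "A \<inter> B = {}"
  shows "\<nu> (A \<union> B) = \<nu> A + \<nu> B"
proof -
  have e: "\<nu> {} = 0" using assms(1) by (rule ca_empty)
  have "(\<lambda>n. \<nu> (binaryset A B n)) sums \<nu> (\<Union>n. binaryset A B n)"
    using assms by (intro ca_sums) (auto simp: binaryset_def disjoint_family_on_def)
  moreover have "(\<lambda>n. \<nu> (binaryset A B n)) sums (\<nu> A + \<nu> B)"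
    using e by (rule binaryset_sums)
  ultimately show ?thesis by (simp add: UN_binaryset_eq sums_unique2)
qed

lemma ca_Int_Diff:
  assumes "\<nu> \<in> ca M" "A \<in> M" "B \<in> M"
  shows "\<nu> A = \<nu> (A \<inter> B) + \<nu> (A - B)"
  using ca_Un[OF assms(1), of "A \<inter> B" "A - B"] assms by (auto simp: Int_Diff_Un)

lemma ca_finite_Union:
  assumes "\<nu> \<in> ca M" "finite P" "P \<subseteq> M" "disjoint P"
  shows "\<nu> (\<Union>P) = (\<Sum>B\<in>P. \<nu> B)"
  using assms(2-4)
proof (induction P rule: finite_induct)
  case empty
  then show ?case using ca_empty[OF assms(1)] by simp
next
  case (insert B P)
  then have "B \<inter> \<Union>P = {}" by (auto simp: disjoint_def)
  moreover have "\<Union>P \<in> M" using insert by auto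
  ultimately show ?case using insert ca_Un[OF assms(1), of B "\<Union>P"] by (auto simp: disjoint_def)
qed

lemma ca_uminus: "\<mu> \<in> ca M \<Longrightarrow> (\<lambda>A. - \<mu> A :: real) \<in> ca M"
  unfolding ca_def by (auto intro: sums_minus)

text \<open>
  A positive set: a measurable set none of whose measurable subsets has negative measure.
\<close>

definition positive_set :: "('a set \<Rightarrow> real) \<Rightarrow> 'a set \<Rightarrow> bool" where
  "positive_set \<mu> P \<longleftrightarrow> P \<in> M \<and> (\<forall>B\<in>M. B \<subseteq> P \<longrightarrow> 0 \<le> \<mu> B)"

text \<open>
  The subset is obtained by repeatedly removing a set \<open>g R\<close> whose measure is, up to a factor \<open>2\<close>, the most
  negative one available in the remainder \<open>R\<close>. The cut-off at \<open>-1\<close> covers the case, not yet excluded, that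
  the measures of subsets of \<open>R\<close> are unbounded below.
\<close>

lemma ex_positive_subset:
  assumes \<mu>: "\<mu> \<in> ca M" and A: "A \<in> M"
  shows "\<exists>P\<subseteq>A. positive_set \<mu> P \<and> \<mu> A \<le> \<mu> P"
proof -
  have e: "\<mu> {} = 0" using \<mu> by (rule ca_empty)
  have "\<exists>B\<in>M. B \<subseteq> R \<and> (\<forall>B'\<in>M. B' \<subseteq> R \<longrightarrow> \<mu> B \<le> max (\<mu> B' / 2) (-1))" for R
  proof (cases "\<exists>B\<in>M. B \<subseteq> R \<and> \<mu> B \<le> -1")
    case True
    then show ?thesis by (meson max.coboundedI2)
  next
    case False
    let ?S = "\<mu> ` {B \<in> M. B \<subseteq> R}"
    have bdd: "bdd_below ?S" using False by (intro bdd_belowI[of _ "-1"]) auto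
    have S0: "Inf ?S \<le> 0" using e by (intro cInf_lower bdd) (auto intro!: image_eqI[of _ _ "{}"])
    show ?thesis
    proof (cases "Inf ?S = 0")
      case True
      then have "0 \<le> \<mu> B'" if "B' \<in> M" "B' \<subseteq> R" for B'
        using cInf_lower[OF _ bdd, of "\<mu> B'"] that by auto
      then show ?thesis using e by (intro bexI[of _ "{}"]) (auto simp: le_max_iff_disj)
    next
      case False
      then have "Inf ?S < Inf ?S / 2" using S0 by simp
      then obtain B where B: "B \<in> M" "B \<subseteq> R" "\<mu> B < Inf ?S / 2"
        using cInf_lessD[of ?S "Inf ?S / 2"] by auto
      have "\<mu> B \<le> \<mu> B' / 2" if "B' \<in> M" "B' \<subseteq> R" for B'
        using cInf_lower[OF _ bdd, of "\<mu> B'"] that B(3) by auto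
      then show ?thesis using B by (auto simp: le_max_iff_disj)
    qed
  qed
  then obtain g where g: "\<And>R. g R \<in> M" "\<And>R. g R \<subseteq> R"
      "\<And>R B'. B' \<in> M \<Longrightarrow> B' \<subseteq> R \<Longrightarrow> \<mu> (g R) \<le> max (\<mu> B' / 2) (-1)"
    by metis
  define R where "R = (\<lambda>n. ((\<lambda>R. R - g R) ^^ n) A)"
  have R0: "R 0 = A" and RS: "\<And>n. R (Suc n) = R n - g (R n)" by (simp_all add: R_def)
  have RM: "R n \<in> M" for n by (induction n) (use A g(1) in \<open>auto simp: R0 RS\<close>)
  have dec: "decseq R" by (rule decseq_SucI) (auto simp: RS)
  let ?B = "\<lambda>n. g (R n)" and ?P = "\<Inter>n. R n"
  have disj: "?B m \<inter> ?B n = {}" if "m < n" for m n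
  proof -
    have "?B n \<subseteq> R (Suc m)" using g(2)[of "R n"] decseqD[OF dec, of "Suc m" n] that by auto
    then show ?thesis by (auto simp: RS)
  qed
  then have "disjoint_family ?B"
    unfolding disjoint_family_on_def by (metis Int_commute nat_neq_iff)
  then have sums: "(\<lambda>n. \<mu> (?B n)) sums \<mu> (\<Union>n. ?B n)"
    using g(1) \<mu> by (intro ca_sums) auto
  have PM: "?P \<in> M" using RM by auto
  have AP: "A = ?P \<union> (\<Union>n. ?B n)"
  proof (intro equalityI subsetI)
    fix x assume x: "x \<in> A"
    show "x \<in> ?P \<union> (\<Union>n. ?B n)"
    proof (rule ccontr)
      assume n: "x \<notin> ?P \<union> (\<Union>n. ?B n)"
      then have "x \<in> R n" for n by (induction n) (use x in \<open>auto simp: R0 RS\<close>)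
      then show False using n by auto
    qed
  next
    fix x assume "x \<in> ?P \<union> (\<Union>n. ?B n)"
    moreover have "R n \<subseteq> A" for n using decseqD[OF dec, of 0 n] by (simp add: R0)
    ultimately show "x \<in> A" using g(2) R0 by blast
  qed
  have "?P \<inter> (\<Union>n. ?B n) = {}" using RS by blast
  then have "\<mu> A = \<mu> ?P + \<mu> (\<Union>n. ?B n)"
    using ca_Un[OF \<mu> PM, of "\<Union>n. ?B n"] AP g(1) by auto
  moreover have "\<mu> (?B n) \<le> 0" for n using g(3)[of "{}" "R n"] e by auto
  then have "\<mu> (\<Union>n. ?B n) \<le> 0"
    by (intro sums_le[OF _ sums sums_zero]) auto
  moreover have "0 \<le> \<mu> B'" if B': "B' \<in> M" "B' \<subseteq> ?P" for B'
  proof -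
    have "(\<lambda>n. \<mu> (?B n)) \<longlonglongrightarrow> 0" using sums_summable[OF sums] by (rule summable_LIMSEQ_zero)
    moreover have "\<mu> (?B n) \<le> max (\<mu> B' / 2) (-1)" for n using B' by (intro g(3)) auto
    ultimately have "0 \<le> max (\<mu> B' / 2) (-1)" by (intro LIMSEQ_le_const2) auto
    then show ?thesis by (auto simp: le_max_iff_disj)
  qed
  ultimately show ?thesis using PM RS R0 unfolding positive_set_def by (intro exI[of _ ?P]) auto
qed

lemma positive_set_mono:
  assumes \<mu>: "\<mu> \<in> ca M" and "positive_set \<mu> P" "Q \<in> M" "Q \<subseteq> P"
  shows "\<mu> Q \<le> \<mu> P"
  using ca_Int_Diff[OF \<mu>, of P Q] assms unfolding positive_set_def
  by (auto simp: Int_absorb1 dest!: bspec[of _ _ "P - Q"])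

lemma positive_set_UN:
  assumes \<mu>: "\<mu> \<in> ca M" and P: "\<And>n::nat. positive_set \<mu> (P n)"
  shows "positive_set \<mu> (\<Union>n. P n)"
  unfolding positive_set_def
proof (intro conjI ballI impI)
  have PM: "P n \<in> M" for n using P by (auto simp: positive_set_def)
  then show "(\<Union>n. P n) \<in> M" by auto
  fix B assume B: "B \<in> M" "B \<subseteq> (\<Union>n. P n)"
  have dM: "disjointed P n \<in> M" for n using range_disjointed_sets[of P] PM by auto
  have "disjoint_family (\<lambda>n. B \<inter> disjointed P n)"
    using disjoint_family_disjointed[of P] unfolding disjoint_family_on_def by blast
  then have "(\<lambda>n. \<mu> (B \<inter> disjointed P n)) sums \<mu> (\<Union>n. B \<inter> disjointed P n)"
    using B dM by (intro ca_sums[OF \<mu>]) auto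
  moreover have "(\<Union>n. B \<inter> disjointed P n) = B"
    using B UN_disjointed_eq[of P] by blast
  moreover have "0 \<le> \<mu> (B \<inter> disjointed P n)" for n
  proof -
    have "B \<inter> disjointed P n \<subseteq> P n" using disjointed_subset[of P n] by blast
    then show ?thesis using P[of n] B dM[of n] unfolding positive_set_def by blast
  qed
  ultimately show "0 \<le> \<mu> B" using sums_le[OF _ sums_zero] by metis
qed

text \<open>
  The positive half of a Hahn decomposition of \<open>\<Omega>\<close>.
\<close>

definition Hahn_set :: "('a set \<Rightarrow> real) \<Rightarrow> 'a set \<Rightarrow> bool" where
  "Hahn_set \<mu> P \<longleftrightarrow> positive_set \<mu> P \<and> positive_set (\<lambda>A. - \<mu> A) (\<Omega> - P)"

lemma ex_Hahn_set:
  assumes \<mu>: "\<mu> \<in> ca M"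
  shows "\<exists>P. Hahn_set \<mu> P"
proof -
  let ?S = "\<mu> ` {P. positive_set \<mu> P}"
  have e: "positive_set \<mu> {}" using ca_empty[OF \<mu>] by (simp add: positive_set_def)
  have U: "\<exists>Q. positive_set \<mu> Q \<and> (\<forall>n. \<mu> (P n) \<le> \<mu> Q)" if P: "\<And>n::nat. positive_set \<mu> (P n)" for P
  proof (intro exI[of _ "\<Union>n. P n"] conjI allI)
    show "positive_set \<mu> (\<Union>n. P n)" by (rule positive_set_UN[OF \<mu> P])
    then show "\<mu> (P n) \<le> \<mu> (\<Union>n. P n)" for n
      using P[of n] by (intro positive_set_mono[OF \<mu>]) (auto simp: positive_set_def)
  qed
  have bdd: "bdd_above ?S"
  proof (rule ccontr)
    assume n: "\<not> bdd_above ?S"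
    have "\<exists>P. positive_set \<mu> P \<and> real n \<le> \<mu> P" for n :: nat
      using n unfolding bdd_above_def by (auto simp: not_le dest!: spec[of _ "real n"] intro: less_imp_le)
    then obtain P where P: "\<And>n::nat. positive_set \<mu> (P n)" "\<And>n. real n \<le> \<mu> (P n)" by metis
    obtain Q where "\<And>n. \<mu> (P n) \<le> \<mu> Q" using U[of P, OF P(1)] by blast
    then have "real n \<le> \<mu> Q" for n using P(2)[of n] by (meson order_trans)
    then show False by (meson not_less reals_Archimedean2)
  qed
  have "\<exists>P. positive_set \<mu> P \<and> Sup ?S - inverse (Suc n) < \<mu> P" for n
  proof -
    have "Sup ?S - inverse (Suc n) < Sup ?S" by simp
    moreover have "?S \<noteq> {}" using e by auto
    ultimately show ?thesis using less_cSupD[of ?S "Sup ?S - inverse (Suc n)"] by auto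
  qed
  then obtain P where P: "\<And>n::nat. positive_set \<mu> (P n)" "\<And>n. Sup ?S - inverse (Suc n) < \<mu> (P n)"
    by metis
  obtain Q where Q: "positive_set \<mu> Q" "\<And>n. \<mu> (P n) \<le> \<mu> Q" using U[of P, OF P(1)] by blast
  have "Sup ?S \<le> \<mu> Q"
  proof (rule LIMSEQ_le_const2)
    show "(\<lambda>n. Sup ?S - inverse (real (Suc n))) \<longlonglongrightarrow> Sup ?S"
      using tendsto_diff[OF tendsto_const LIMSEQ_inverse_real_of_nat] by simp
    have "Sup ?S - inverse (real (Suc n)) \<le> \<mu> Q" for n using P(2)[of n] Q(2)[of n] by linarith
    then show "\<exists>N. \<forall>n\<ge>N. Sup ?S - inverse (real (Suc n)) \<le> \<mu> Q" by blast
  qed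
  then have max: "\<mu> P' \<le> \<mu> Q" if "positive_set \<mu> P'" for P'
    using cSup_upper[OF _ bdd, of "\<mu> P'"] that by auto
  have "\<mu> B \<le> 0" if B: "B \<in> M" "B \<subseteq> \<Omega> - Q" for B
  proof (rule ccontr)
    assume neg: "\<not> \<mu> B \<le> 0"
    obtain P' where P': "P' \<subseteq> B" "positive_set \<mu> P'" "\<mu> B \<le> \<mu> P'"
      using ex_positive_subset[OF \<mu> B(1)] by blast
    have "positive_set \<mu> (\<Union>n. binaryset Q P' n)"
      using Q(1) P'(2) e by (intro positive_set_UN[OF \<mu>]) (auto simp: binaryset_def)
    then have "\<mu> (Q \<union> P') \<le> \<mu> Q" using max by (simp add: UN_binaryset_eq)
    moreover have "\<mu> (Q \<union> P') = \<mu> Q + \<mu> P'"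
      using P' Q(1) B by (intro ca_Un[OF \<mu>]) (auto simp: positive_set_def)
    ultimately show False using P'(3) neg by simp
  qed
  then show ?thesis using Q(1) by (auto simp: Hahn_set_def positive_set_def)
qed

lemma Hahn_set_uminus: "Hahn_set \<mu> P \<Longrightarrow> Hahn_set (\<lambda>A. - \<mu> A) (\<Omega> - P)"
  unfolding Hahn_set_def
  by (auto simp: positive_set_def double_diff sets_into_space)

lemma Hahn_set_nonneg: "Hahn_set \<mu> P \<Longrightarrow> A \<in> M \<Longrightarrow> 0 \<le> \<mu> (A \<inter> P)"
  unfolding Hahn_set_def positive_set_def by auto

lemma Hahn_set_nonpos: "Hahn_set \<mu> P \<Longrightarrow> A \<in> M \<Longrightarrow> \<mu> (A - P) \<le> 0"
  unfolding Hahn_set_def positive_set_def using sets_into_space by (auto dest!: bspec[of _ _ "A - P"])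

lemma Hahn_set_sets: "Hahn_set \<mu> P \<Longrightarrow> P \<in> M"
  unfolding Hahn_set_def positive_set_def by auto

lemma variation_Hahn_set:
  assumes \<mu>: "\<mu> \<in> ca M" and P: "Hahn_set \<mu> P" and A: "A \<in> M"
  shows "variation M \<mu> A = ennreal (\<mu> (A \<inter> P) - \<mu> (A - P))"
  unfolding variation_def
proof (rule antisym)
  have PM: "P \<in> M" using P by (rule Hahn_set_sets)
  have e: "\<mu> {} = 0" using \<mu> by (rule ca_empty)
  let ?m = "\<lambda>A. \<mu> (A \<inter> P) - \<mu> (A - P)"
  show "(SUP \<P>\<in>{\<P>. finite \<P> \<and> partition_on A \<P> \<and> \<P> \<subseteq> M}. \<Sum>B\<in>\<P>. ennreal \<bar>\<mu> B\<bar>) \<le> ennreal (?m A)"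
  proof (rule SUP_least, clarify)
    fix \<P> assume \<P>: "finite \<P>" "partition_on A \<P>" "\<P> \<subseteq> M"
    have "\<bar>\<mu> B\<bar> \<le> ?m B" if "B \<in> \<P>" for B
      using ca_Int_Diff[OF \<mu>, of B P] Hahn_set_nonneg[OF P, of B] Hahn_set_nonpos[OF P, of B] PM \<P>(3) that
      by auto
    then have "(\<Sum>B\<in>\<P>. \<bar>\<mu> B\<bar>) \<le> (\<Sum>B\<in>\<P>. ?m B)" by (rule sum_mono)
    also have "\<dots> = (\<Sum>B\<in>\<P>. \<mu> (B \<inter> P)) - (\<Sum>B\<in>\<P>. \<mu> (B - P))" by (rule sum_subtractf)
    also have "(\<Sum>B\<in>\<P>. \<mu> (B \<inter> P)) = \<mu> (A \<inter> P)"
    proof -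
      have "(\<Sum>B\<in>\<P>. \<mu> (B \<inter> P)) = (\<Sum>C\<in>(\<lambda>B. B \<inter> P) ` \<P>. \<mu> C)"
      proof (subst sum.reindex_nontrivial[OF \<P>(1)])
        fix x y assume *: "x \<in> \<P>" "y \<in> \<P>" "x \<noteq> y" "x \<inter> P = y \<inter> P"
        then have "x \<inter> y = {}" using \<P>(2) by (auto simp: partition_on_def disjoint_def)
        then have "x \<inter> P = {}" using *(4) by blast
        then show "\<mu> (x \<inter> P) = 0" using e by simp
      qed simp
      also have "\<dots> = \<mu> (\<Union>((\<lambda>B. B \<inter> P) ` \<P>))"
        using \<P> PM by (intro ca_finite_Union[OF \<mu>, symmetric]) (auto simp: partition_on_def disjoint_def)
      also have "\<Union>((\<lambda>B. B \<inter> P) ` \<P>) = A \<inter> P" using \<P>(2) by (auto simp: partition_on_def)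
      finally show ?thesis .
    qed
    also have "(\<Sum>B\<in>\<P>. \<mu> (B - P)) = \<mu> (A - P)"
    proof -
      have "(\<Sum>B\<in>\<P>. \<mu> (B - P)) = (\<Sum>C\<in>(\<lambda>B. B - P) ` \<P>. \<mu> C)"
      proof (subst sum.reindex_nontrivial[OF \<P>(1)])
        fix x y assume *: "x \<in> \<P>" "y \<in> \<P>" "x \<noteq> y" "x - P = y - P"
        then have "x \<inter> y = {}" using \<P>(2) by (auto simp: partition_on_def disjoint_def)
        then have "x - P = {}" using *(4) by blast
        then show "\<mu> (x - P) = 0" using e by metis
      qed simp
      also have "\<dots> = \<mu> (\<Union>((\<lambda>B. B - P) ` \<P>))"
        using \<P> PM by (intro ca_finite_Union[OF \<mu>, symmetric]) (auto simp: partition_on_def disjoint_def)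
      also have "\<Union>((\<lambda>B. B - P) ` \<P>) = A - P" using \<P>(2) by (auto simp: partition_on_def)
      finally show ?thesis .
    qed
    finally show "(\<Sum>B\<in>\<P>. ennreal \<bar>\<mu> B\<bar>) \<le> ennreal (?m A)"
      by (simp add: sum_ennreal ennreal_leI)
  qed
  let ?Q = "{A \<inter> P, A - P} - {{}}"
  have "ennreal (?m A) = (\<Sum>B\<in>{A \<inter> P, A - P}. ennreal \<bar>\<mu> B\<bar>)"
  proof (cases "A \<inter> P = A - P")
    case True
    then have "A = {}" by blast
    then show ?thesis using e by simp
  next
    case False
    then show ?thesis
      using Hahn_set_nonneg[OF P A] Hahn_set_nonpos[OF P A] by (simp flip: ennreal_plus)
  qed
  also have "\<dots> = (\<Sum>B\<in>?Q. ennreal \<bar>\<mu> B\<bar>)" using e by (intro sum.mono_neutral_right) auto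
  also have "\<dots> \<le> (SUP \<P>\<in>{\<P>. finite \<P> \<and> partition_on A \<P> \<and> \<P> \<subseteq> M}. \<Sum>B\<in>\<P>. ennreal \<bar>\<mu> B\<bar>)"
    using A PM by (intro SUP_upper) (auto simp: partition_on_def disjoint_def)
  finally show "ennreal (?m A) \<le> (SUP \<P>\<in>{\<P>. finite \<P> \<and> partition_on A \<P> \<and> \<P> \<subseteq> M}. \<Sum>B\<in>\<P>. ennreal \<bar>\<mu> B\<bar>)" .
qed

lemma space_variation_measure [simp]: "space (variation_measure \<Omega> M \<mu>) = \<Omega>"
  and sets_variation_measure [simp]: "sets (variation_measure \<Omega> M \<mu>) = M"
  and space_positive_part [simp]: "space (positive_part \<Omega> M \<mu>) = \<Omega>"
  and sets_positive_part [simp]: "sets (positive_part \<Omega> M \<mu>) = M"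
  by (simp_all add: variation_measure_def positive_part_def space_closed)

lemma emeasure_measure_of_ca:
  assumes ca: "(\<lambda>A. r A :: real) \<in> ca M" and nn: "\<And>A. A \<in> M \<Longrightarrow> 0 \<le> r A"
    and f: "\<And>A. A \<in> M \<Longrightarrow> f A = ennreal (r A)" and A: "A \<in> M"
  shows "emeasure (measure_of \<Omega> M f) A = ennreal (r A)"
proof -
  have "countably_additive M f"
    unfolding countably_additive_def
  proof (intro allI impI)
    fix B :: "nat \<Rightarrow> 'a set" assume B: "range B \<subseteq> M" "disjoint_family B" "\<Union>(range B) \<in> M"
    have s: "(\<lambda>i. r (B i)) sums r (\<Union>(range B))" using B by (intro ca_sums[OF ca]) auto
    have "(\<Sum>i. f (B i)) = (\<Sum>i. ennreal (r (B i)))" using B f by (intro suminf_cong) auto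
    also have "\<dots> = ennreal (\<Sum>i. r (B i))"
      using B nn s by (intro suminf_ennreal2) (auto simp: sums_iff)
    also have "\<dots> = f (\<Union>(range B))" using s B f by (simp add: sums_iff)
    finally show "(\<Sum>i. f (B i)) = f (\<Union>(range B))" .
  qed
  then show ?thesis
    using A f ca_empty[OF ca] sigma_algebra_axioms
    by (subst emeasure_measure_of_sigma) (auto simp: positive_def)
qed

lemma ca_Hahn_parts:
  assumes \<mu>: "(\<mu> :: 'a set \<Rightarrow> real) \<in> ca M" and P: "P \<in> M"
  shows "(\<lambda>A. \<mu> (A \<inter> P)) \<in> ca M" "(\<lambda>A. \<mu> (A \<inter> P) - \<mu> (A - P)) \<in> ca M"
proof -
  have 1: "(\<lambda>n. \<mu> (A n \<inter> P)) sums \<mu> ((\<Union>n. A n) \<inter> P)" "(\<lambda>n. \<mu> (A n - P)) sums \<mu> ((\<Union>n. A n) - P)"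
    if "range A \<subseteq> M" "disjoint_family A" for A :: "nat \<Rightarrow> 'a set"
  proof -
    have "(\<Union>n. A n \<inter> P) = (\<Union>n. A n) \<inter> P" "(\<Union>n. A n - P) = (\<Union>n. A n) - P" by auto
    then show "(\<lambda>n. \<mu> (A n \<inter> P)) sums \<mu> ((\<Union>n. A n) \<inter> P)" "(\<lambda>n. \<mu> (A n - P)) sums \<mu> ((\<Union>n. A n) - P)"
      using that P ca_sums[OF \<mu>, of "\<lambda>n. A n \<inter> P"] ca_sums[OF \<mu>, of "\<lambda>n. A n - P"]
      by (auto simp: disjoint_family_on_def disjoint_iff)
  qed
  then show "(\<lambda>A. \<mu> (A \<inter> P)) \<in> ca M" by (simp add: ca_def)
  show "(\<lambda>A. \<mu> (A \<inter> P) - \<mu> (A - P)) \<in> ca M"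
    unfolding ca_def by (auto intro!: sums_diff 1)
qed

lemma emeasure_variation_measure:
  assumes \<mu>: "\<mu> \<in> ca M" and P: "Hahn_set \<mu> P" and A: "A \<in> M"
  shows "emeasure (variation_measure \<Omega> M \<mu>) A = ennreal (\<mu> (A \<inter> P) - \<mu> (A - P))"
  unfolding variation_measure_def
  using ca_Hahn_parts[OF \<mu> Hahn_set_sets[OF P]] Hahn_set_nonneg[OF P] Hahn_set_nonpos[OF P] A
  by (intro emeasure_measure_of_ca) (auto simp: variation_Hahn_set[OF \<mu> P] intro: order_trans)

lemma finite_variation_measure:
  assumes "\<mu> \<in> ca M"
  shows "finite_measure (variation_measure \<Omega> M \<mu>)"
proof -
  obtain P where "Hahn_set \<mu> P" using ex_Hahn_set[OF assms] by blast
  from emeasure_variation_measure[OF assms this, of \<Omega>] show ?thesis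
    by (intro finite_measureI) auto
qed

lemma measure_variation_measure:
  assumes \<mu>: "\<mu> \<in> ca M" and P: "Hahn_set \<mu> P" and A: "A \<in> M"
  shows "measure (variation_measure \<Omega> M \<mu>) A = \<mu> (A \<inter> P) - \<mu> (A - P)"
  using emeasure_variation_measure[OF assms] Hahn_set_nonneg[OF P A] Hahn_set_nonpos[OF P A]
  by (simp add: measure_def)

lemma emeasure_positive_part:
  assumes \<mu>: "\<mu> \<in> ca M" and P: "Hahn_set \<mu> P" and A: "A \<in> M"
  shows "emeasure (positive_part \<Omega> M \<mu>) A = ennreal (\<mu> (A \<inter> P))"
  unfolding positive_part_def
proof (intro emeasure_measure_of_ca ca_Hahn_parts(1)[OF \<mu> Hahn_set_sets[OF P]] Hahn_set_nonneg[OF P] A)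
  fix A assume A: "A \<in> M"
  have PM: "P \<in> M" using P by (rule Hahn_set_sets)
  show "(SUP B\<in>{B \<in> M. B \<subseteq> A}. ennreal (\<mu> B)) = ennreal (\<mu> (A \<inter> P))"
  proof (rule antisym)
    show "(SUP B\<in>{B \<in> M. B \<subseteq> A}. ennreal (\<mu> B)) \<le> ennreal (\<mu> (A \<inter> P))"
    proof (rule SUP_least, clarify, rule ennreal_leI)
      fix B assume B: "B \<in> M" "B \<subseteq> A"
      have "\<mu> B \<le> \<mu> (B \<inter> P)" using ca_Int_Diff[OF \<mu> B(1) PM] Hahn_set_nonpos[OF P B(1)] by simp
      also have "\<dots> \<le> \<mu> (A \<inter> P)"
      proof (rule positive_set_mono[OF \<mu>])
        show "positive_set \<mu> (A \<inter> P)" using P A PM by (auto simp: Hahn_set_def positive_set_def)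
      qed (use B PM in auto)
      finally show "\<mu> B \<le> \<mu> (A \<inter> P)" .
    qed
    show "ennreal (\<mu> (A \<inter> P)) \<le> (SUP B\<in>{B \<in> M. B \<subseteq> A}. ennreal (\<mu> B))"
      using A PM by (intro SUP_upper) auto
  qed
qed

lemma positive_part_eq_density:
  assumes \<mu>: "\<mu> \<in> ca M" and P: "Hahn_set \<mu> P"
  shows "positive_part \<Omega> M \<mu> = density (variation_measure \<Omega> M \<mu>) (indicator P)"
proof (rule measure_eqI)
  fix A assume "A \<in> sets (positive_part \<Omega> M \<mu>)"
  then have A: "A \<in> M" by simp
  have PM: "P \<in> M" using P by (rule Hahn_set_sets)
  have "emeasure (density (variation_measure \<Omega> M \<mu>) (indicator P)) A
      = emeasure (variation_measure \<Omega> M \<mu>) (P \<inter> A)"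
    using A PM by (subst emeasure_density) (auto simp: indicator_inter_arith[symmetric] intro!: borel_measurable_indicator nn_integral_indicator)
  also have "\<dots> = ennreal (\<mu> (A \<inter> P))"
  proof -
    have "P \<inter> A \<inter> P = A \<inter> P" "P \<inter> A - P = {}" "\<And>a::real. a - 0 = a" by auto
    moreover have "P \<inter> A \<in> M" using A PM by auto
    ultimately show ?thesis
      using emeasure_variation_measure[OF \<mu> P, of "P \<inter> A"] ca_empty[OF \<mu>] by metis
  qed
  finally show "emeasure (positive_part \<Omega> M \<mu>) A
      = emeasure (density (variation_measure \<Omega> M \<mu>) (indicator P)) A"
    using emeasure_positive_part[OF \<mu> P A] by simp
qed simp

lemma variation_measure_uminus: "variation_measure \<Omega> M (\<lambda>A. - \<mu> A) = variation_measure \<Omega> M \<mu>"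
  by (simp add: variation_measure_def variation_def[abs_def])

lemma signed_integral_Hahn_set:
  assumes \<mu>: "\<mu> \<in> ca M" and P: "Hahn_set \<mu> P" and A: "A \<in> M"
    and f: "integrable (variation_measure \<Omega> M \<mu>) f"
  shows "signed_integral \<Omega> M \<mu> A f =
    (LINT x|variation_measure \<Omega> M \<mu>. indicator A x * ((if x \<in> P then 1 else -1) * f x))"
proof -
  let ?V = "variation_measure \<Omega> M \<mu>"
  have PM: "P \<in> M" using P by (rule Hahn_set_sets)
  have fm: "f \<in> borel_measurable ?V" using f by (rule borel_measurable_integrable)
  have *: "(LINT x:A|density ?V (indicator Q). f x) = (LINT x|?V. indicator A x * (indicator Q x * f x))"
    if Q: "Q \<in> M" for Q
  proof -
    have "density ?V (indicator Q) = density ?V (\<lambda>x. ennreal (indicator Q x))"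
      by (simp add: ennreal_indicator)
    then have "(LINT x:A|density ?V (indicator Q). f x) = (LINT x|?V. indicator Q x *\<^sub>R (indicator A x *\<^sub>R f x))"
      unfolding set_lebesgue_integral_def using A Q fm
      by (simp only:) (intro integral_density; auto intro!: borel_measurable_times borel_measurable_indicator)
    also have "\<dots> = (LINT x|?V. indicator A x * (indicator Q x * f x))"
      by (simp add: ac_simps)
    finally show ?thesis .
  qed
  have int: "integrable ?V (\<lambda>x. indicator A x * (indicator Q x * f x))" if Q: "Q \<in> M" for Q
    using integrable_mult_indicator[of "A \<inter> Q" ?V f] f A Q
    by (auto simp: indicator_inter_arith mult.assoc)
  have "signed_integral \<Omega> M \<mu> A f = (LINT x|?V. indicator A x * (indicator P x * f x))
      - (LINT x|?V. indicator A x * (indicator (\<Omega> - P) x * f x))"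
    unfolding signed_integral_def positive_part_eq_density[OF \<mu> P]
      positive_part_eq_density[OF ca_uminus[OF \<mu>] Hahn_set_uminus[OF P]] variation_measure_uminus
    using PM by (subst (1 2) *) auto
  also have "\<dots> = (LINT x|?V. indicator A x * (indicator P x * f x) - indicator A x * (indicator (\<Omega> - P) x * f x))"
    using PM by (intro Bochner_Integration.integral_diff[symmetric] int) auto
  also have "\<dots> = (LINT x|?V. indicator A x * ((if x \<in> P then 1 else -1) * f x))"
    by (intro Bochner_Integration.integral_cong) (auto simp: indicator_def)
  finally show ?thesis .
qed

end

section \<open>Functions integrable with respect to a vector measure\<close>

lemma integral_decseq_tendsto_0:
  fixes f :: "'a \<Rightarrow> real"
  assumes f: "integrable M f" and A: "decseq A" "range A \<subseteq> sets M"
    and null: "(\<Inter>n. A n) \<in> null_sets M"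
  shows "(\<lambda>n. LINT x|M. indicator (A n) x * f x) \<longlonglongrightarrow> 0"
proof -
  have ae: "AE x in M. x \<notin> (\<Inter>n. A n)" using null by (rule AE_not_in)
  have [measurable]: "f \<in> borel_measurable M" "\<And>n. A n \<in> sets M"
    using f A by auto
  have "(\<lambda>n. LINT x|M. indicator (A n) x * f x) \<longlonglongrightarrow> (LINT x|M. 0)"
  proof (rule integral_dominated_convergence[where w = "\<lambda>x. \<bar>f x\<bar>"])
    show "AE x in M. (\<lambda>n. indicator (A n) x * f x) \<longlonglongrightarrow> 0"
      using ae
    proof eventually_elim
      case (elim x)
      have "(\<lambda>n. indicator (A n) x :: real) \<longlonglongrightarrow> indicator (\<Inter>n. A n) x"
        by (rule LIMSEQ_indicator_decseq[OF A(1)])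
      then show ?case using elim by (auto intro: tendsto_mult_left_zero)
    qed
    show "AE x in M. norm (indicator (A n) x * f x) \<le> \<bar>f x\<bar>" for n
      by (auto simp: indicator_def)
    show "integrable M (\<lambda>x. \<bar>f x\<bar>)" using f by (rule integrable_abs)
  qed measurable
  then show ?thesis by simp
qed

text \<open>
  A countably additive measure on a \<open>\<sigma>\<close>-algebra with values in a separable Banach space.
\<close>

locale separable_vector_measure = sigma_algebra \<Omega> \<Sigma>
  for \<Omega> :: "'a set" and \<Sigma> :: "'a set set" +
  fixes \<nu> :: "'a set \<Rightarrow> 'x::banach"
  assumes ca: "\<nu> \<in> ca \<Sigma>"
    and separable: "separable_space (euclidean :: 'x topology)"
begin

text \<open>
  The variation of \<open>x' \<circ> \<nu>\<close>, integrability with respect to \<open>\<nu>\<close>, and the norm of \<open>L\<^sub>1(\<nu>)\<close> on functions.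
\<close>

abbreviation V :: "('x \<Rightarrow>\<^sub>L real) \<Rightarrow> 'a measure" where
  "V x' \<equiv> variation_measure \<Omega> \<Sigma> (dual_comp x' \<nu>)"

abbreviation intg :: "('a \<Rightarrow> real) \<Rightarrow> bool" where
  "intg \<equiv> vm_integrable \<Omega> \<Sigma> \<nu>"

abbreviation L1norm :: "('a \<Rightarrow> real) \<Rightarrow> real" where
  "L1norm \<equiv> L1_norm \<Omega> \<Sigma> \<nu>"

lemma dual_comp_ca: "dual_comp x' \<nu> \<in> ca \<Sigma>"
  using ca unfolding ca_def dual_comp_def
  by (auto intro: bounded_linear.sums[OF blinfun.bounded_linear_right])

lemma finite_V: "finite_measure (V x')"
  by (rule finite_variation_measure[OF dual_comp_ca])

lemma ex_Hahn: "\<exists>P. Hahn_set (dual_comp x' \<nu>) P"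
  by (rule ex_Hahn_set[OF dual_comp_ca])

lemma measurable_V [simp]: "borel_measurable (V x') = borel_measurable (sigma \<Omega> \<Sigma>)"
  by (rule measurable_cong_sets) (auto simp: space_closed)

lemma integrable_V: "intg f \<Longrightarrow> integrable (V x') f"
  by (simp add: vm_integrable_def)

lemma intg_measurable: "intg f \<Longrightarrow> f \<in> borel_measurable (sigma \<Omega> \<Sigma>)"
  by (simp add: vm_integrable_def)

lemma sets_sigma_eq [simp]: "sets (sigma \<Omega> \<Sigma>) = \<Sigma>"
  by (simp add: space_closed)

lemma integrable_V_indicator:
  "integrable (V x') f \<Longrightarrow> A \<in> \<Sigma> \<Longrightarrow> integrable (V x') (\<lambda>x. indicator A x * f x :: real)"
  using integrable_mult_indicator[of A "V x'" f] by simp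

lemma signed_integral_eq:
  fixes f :: "'a \<Rightarrow> real"
  assumes "Hahn_set (dual_comp x' \<nu>) P" "A \<in> \<Sigma>" "integrable (V x') f"
  shows "signed_integral \<Omega> \<Sigma> (dual_comp x' \<nu>) A f
    = (LINT x|V x'. indicator A x * ((if x \<in> P then 1 else -1) * f x))"
  by (rule signed_integral_Hahn_set[OF dual_comp_ca assms])

lemma integrable_Hahn_sign:
  fixes f :: "'a \<Rightarrow> real"
  assumes P: "Hahn_set (dual_comp x' \<nu>) P" and A: "A \<in> \<Sigma>" and f: "integrable (V x') f"
  shows "integrable (V x') (\<lambda>x. indicator A x * ((if x \<in> P then 1 else -1) * f x))"
proof -
  have PM: "P \<in> \<Sigma>" using P by (rule Hahn_set_sets)
  have "integrable (V x') (\<lambda>x. indicator (A \<inter> P) x * f x - indicator (A - P) x * f x)"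
    using A PM f by (intro Bochner_Integration.integrable_diff) (auto intro!: integrable_V_indicator)
  then show ?thesis
    by (rule back_subst[of "integrable _"]) (auto simp: indicator_def)
qed

lemma signed_integral_add:
  assumes "integrable (V x') f" "integrable (V x') g" "A \<in> \<Sigma>"
  shows "signed_integral \<Omega> \<Sigma> (dual_comp x' \<nu>) A (\<lambda>x. f x + g x)
    = signed_integral \<Omega> \<Sigma> (dual_comp x' \<nu>) A f + signed_integral \<Omega> \<Sigma> (dual_comp x' \<nu>) A g"
proof -
  obtain P where P: "Hahn_set (dual_comp x' \<nu>) P" using ex_Hahn by blast
  show ?thesis
    using assms signed_integral_eq[OF P]
      Bochner_Integration.integral_add[OF integrable_Hahn_sign[OF P] integrable_Hahn_sign[OF P], of A f A g]
    by (simp add: distrib_left)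
qed

lemma signed_integral_scale:
  assumes "integrable (V x') f" "A \<in> \<Sigma>"
  shows "signed_integral \<Omega> \<Sigma> (dual_comp x' \<nu>) A (\<lambda>x. c * f x)
    = c * signed_integral \<Omega> \<Sigma> (dual_comp x' \<nu>) A f"
proof -
  obtain P where P: "Hahn_set (dual_comp x' \<nu>) P" using ex_Hahn by blast
  have "(\<lambda>x. indicator A x * ((if x \<in> P then 1 else -1) * (c * f x)))
    = (\<lambda>x. c * (indicator A x * ((if x \<in> P then 1 else -1) * f x)))" by (auto simp: ac_simps)
  then show ?thesis using assms signed_integral_eq[OF P] by simp
qed

lemma intg_add:
  assumes f: "intg f" and g: "intg g"
  shows "intg (\<lambda>x. f x + g x)"
  unfolding vm_integrable_def
proof (intro conjI allI ballI)
  show "(\<lambda>x. f x + g x) \<in> borel_measurable (sigma \<Omega> \<Sigma>)"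
    using intg_measurable[OF f] intg_measurable[OF g] by (rule borel_measurable_add)
  show "integrable (V x') (\<lambda>x. f x + g x)" for x'
    using integrable_V[OF f] integrable_V[OF g] by simp
  fix A assume A: "A \<in> \<Sigma>"
  obtain u v where "\<And>x'. blinfun_apply x' u = signed_integral \<Omega> \<Sigma> (dual_comp x' \<nu>) A f"
    "\<And>x'. blinfun_apply x' v = signed_integral \<Omega> \<Sigma> (dual_comp x' \<nu>) A g"
    using f g A unfolding vm_integrable_def by meson
  then have "blinfun_apply x' (u + v) = signed_integral \<Omega> \<Sigma> (dual_comp x' \<nu>) A (\<lambda>x. f x + g x)" for x'
    using signed_integral_add[OF integrable_V[OF f] integrable_V[OF g] A] by (simp add: blinfun.add_right)
  then show "\<exists>v. \<forall>x'. blinfun_apply x' v = signed_integral \<Omega> \<Sigma> (dual_comp x' \<nu>) A (\<lambda>x. f x + g x)"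
    by blast
qed

lemma intg_scale:
  assumes f: "intg f"
  shows "intg (\<lambda>x. c * f x)"
  unfolding vm_integrable_def
proof (intro conjI allI ballI)
  show "(\<lambda>x. c * f x) \<in> borel_measurable (sigma \<Omega> \<Sigma>)"
    using intg_measurable[OF f] by simp
  show "integrable (V x') (\<lambda>x. c * f x)" for x'
    using integrable_V[OF f] by simp
  fix A assume A: "A \<in> \<Sigma>"
  obtain u where "\<And>x'. blinfun_apply x' u = signed_integral \<Omega> \<Sigma> (dual_comp x' \<nu>) A f"
    using f A unfolding vm_integrable_def by meson
  then have "blinfun_apply x' (c *\<^sub>R u) = signed_integral \<Omega> \<Sigma> (dual_comp x' \<nu>) A (\<lambda>x. c * f x)" for x'
    using signed_integral_scale[OF integrable_V[OF f] A] by (simp add: blinfun.scaleR_right)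
  then show "\<exists>v. \<forall>x'. blinfun_apply x' v = signed_integral \<Omega> \<Sigma> (dual_comp x' \<nu>) A (\<lambda>x. c * f x)"
    by blast
qed

lemma intg_diff: "intg f \<Longrightarrow> intg g \<Longrightarrow> intg (\<lambda>x. f x - g x)"
  using intg_add[of f "\<lambda>x. -1 * g x"] intg_scale[of g "-1"] by simp

lemma intg_indicator:
  assumes B: "B \<in> \<Sigma>"
  shows "intg (indicator B)"
  unfolding vm_integrable_def
proof (intro conjI allI ballI)
  show "indicator B \<in> borel_measurable (sigma \<Omega> \<Sigma>)"
    using B by (intro borel_measurable_indicator) simp
  show int: "integrable (V x') (indicator B :: 'a \<Rightarrow> real)" for x'
    using B finite_measure.emeasure_finite[OF finite_V[of x'], of B]
    by (auto simp: less_top)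
  fix A assume A: "A \<in> \<Sigma>"
  have "blinfun_apply x' (\<nu> (A \<inter> B)) = signed_integral \<Omega> \<Sigma> (dual_comp x' \<nu>) A (indicator B)" for x'
  proof -
    let ?\<mu> = "dual_comp x' \<nu>"
    interpret finite_measure "V x'" by (rule finite_V)
    obtain P where P: "Hahn_set ?\<mu> P" using ex_Hahn by blast
    have PM: "P \<in> \<Sigma>" using P by (rule Hahn_set_sets)
    have "signed_integral \<Omega> \<Sigma> ?\<mu> A (indicator B)
        = (LINT x|V x'. indicator (A \<inter> B \<inter> P) x - indicator (A \<inter> B - P) x)"
      unfolding signed_integral_eq[OF P A int]
      by (intro Bochner_Integration.integral_cong) (auto simp: indicator_def)
    also have "\<dots> = measure (V x') (A \<inter> B \<inter> P) - measure (V x') (A \<inter> B - P)"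
    proof -
      have s: "A \<inter> B \<inter> P \<in> sets (V x')" "A \<inter> B - P \<in> sets (V x')" using A B PM by auto
      then have i: "integrable (V x') (indicat_real (A \<inter> B \<inter> P))" "integrable (V x') (indicat_real (A \<inter> B - P))"
        by (simp_all only: integrable_indicator_iff emeasure_finite less_top[symmetric])
           (simp_all add: emeasure_eq_measure)
      show ?thesis
        unfolding Bochner_Integration.integral_diff[OF i] integral_indicator
        using s by (simp add: Int_absorb2 sets_into_space)
    qed
    also have "\<dots> = ?\<mu> (A \<inter> B \<inter> P) + ?\<mu> (A \<inter> B - P)"
    proof -
      have e: "?\<mu> {} = 0" by (rule ca_empty[OF dual_comp_ca])
      have s: "A \<inter> B \<inter> P \<in> \<Sigma>" "A \<inter> B - P \<in> \<Sigma>" using A B PM by auto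
      have "A \<inter> B \<inter> P \<inter> P = A \<inter> B \<inter> P" "A \<inter> B \<inter> P - P = {}"
        "(A \<inter> B - P) \<inter> P = {}" "A \<inter> B - P - P = A \<inter> B - P" by auto
      then show ?thesis
        unfolding measure_variation_measure[OF dual_comp_ca P s(1)] measure_variation_measure[OF dual_comp_ca P s(2)]
        by (simp only: e diff_zero diff_0 minus_minus)
    qed
    also have "\<dots> = ?\<mu> (A \<inter> B)"
      using A B PM by (intro ca_Int_Diff[OF dual_comp_ca, symmetric]) auto
    finally show ?thesis by (simp add: dual_comp_def)
  qed
  then show "\<exists>v. \<forall>x'. blinfun_apply x' v = signed_integral \<Omega> \<Sigma> (dual_comp x' \<nu>) A (indicator B)"
    by blast
qed

lemma intg_sum:
  assumes "finite I" "\<And>i. i \<in> I \<Longrightarrow> intg (f i)"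
  shows "intg (\<lambda>x. \<Sum>i\<in>I. f i x)"
  using assms
proof (induction I rule: finite_induct)
  case empty
  have "indicator {} = (\<lambda>x::'a. 0::real)" by auto
  with intg_indicator[of "{}"] show ?case by simp
next
  case (insert i I)
  then show ?case by (simp add: intg_add)
qed

text \<open>
  The vector \<open>\<integral>\<^sub>A f d\<nu>\<close>: any vector with the prescribed values under all functionals. Its uniqueness, a
  consequence of the Hahn-Banach theorem, is not needed.
\<close>

definition vm_integral :: "('a \<Rightarrow> real) \<Rightarrow> 'a set \<Rightarrow> 'x" where
  "vm_integral f A = (SOME v. \<forall>x'. blinfun_apply x' v = signed_integral \<Omega> \<Sigma> (dual_comp x' \<nu>) A f)"

lemma apply_vm_integral:
  assumes "intg f" "A \<in> \<Sigma>"
  shows "blinfun_apply x' (vm_integral f A) = signed_integral \<Omega> \<Sigma> (dual_comp x' \<nu>) A f"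
  using someI_ex[of "\<lambda>v. \<forall>x'. blinfun_apply x' v = signed_integral \<Omega> \<Sigma> (dual_comp x' \<nu>) A f"] assms
  unfolding vm_integral_def vm_integrable_def by blast

lemma apply_vm_integral_le:
  assumes f: "intg f" and A: "A \<in> \<Sigma>"
  shows "\<bar>blinfun_apply x' (vm_integral f A)\<bar> \<le> (LINT x|V x'. indicator A x * \<bar>f x\<bar>)"
proof -
  obtain P where P: "Hahn_set (dual_comp x' \<nu>) P" using ex_Hahn by blast
  have "\<bar>blinfun_apply x' (vm_integral f A)\<bar> \<le> (LINT x|V x'. \<bar>indicator A x * ((if x \<in> P then 1 else -1) * f x)\<bar>)"
    unfolding apply_vm_integral[OF f A] signed_integral_eq[OF P A integrable_V[OF f]]
    by (rule integral_abs_bound)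
  also have "\<dots> = (LINT x|V x'. indicator A x * \<bar>f x\<bar>)"
    by (intro Bochner_Integration.integral_cong) (auto simp: indicator_def)
  finally show ?thesis .
qed

lemma apply_vm_integral_diff_le:
  assumes f: "intg f" and A: "A \<in> \<Sigma>" and Q: "Q \<in> \<Sigma>" "Q \<subseteq> A"
  shows "\<bar>blinfun_apply x' (vm_integral f Q - vm_integral f (A - Q))\<bar> \<le> (LINT x|V x'. indicator A x * \<bar>f x\<bar>)"
proof -
  have AQ: "A - Q \<in> \<Sigma>" using A Q by auto
  have "\<bar>blinfun_apply x' (vm_integral f Q - vm_integral f (A - Q))\<bar>
      \<le> (LINT x|V x'. indicator Q x * \<bar>f x\<bar>) + (LINT x|V x'. indicator (A - Q) x * \<bar>f x\<bar>)"
    using apply_vm_integral_le[OF f Q(1), of x'] apply_vm_integral_le[OF f AQ, of x']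
    unfolding blinfun.diff_right by linarith
  also have "\<dots> = (LINT x|V x'. indicator Q x * \<bar>f x\<bar> + indicator (A - Q) x * \<bar>f x\<bar>)"
    using integrable_V[OF f] Q AQ
    by (intro Bochner_Integration.integral_add[symmetric] integrable_V_indicator integrable_abs) auto
  also have "\<dots> = (LINT x|V x'. indicator A x * \<bar>f x\<bar>)"
    using Q by (intro Bochner_Integration.integral_cong) (auto simp: indicator_def)
  finally show ?thesis .
qed

text \<open>
  Together with \<open>apply_vm_integral_diff_le\<close> this exhibits \<open>x' \<mapsto> \<integral>\<^sub>A |f| d|x'\<nu>|\<close> as a supremum of maps
  \<open>x' \<mapsto> |x'(u)|\<close> with \<open>u \<in> X\<close>. The set \<open>Q\<close> is where the sign of \<open>f\<close> agrees with the Hahn sign of \<open>x' \<circ> \<nu>\<close>.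
\<close>

lemma ex_vm_integral_diff_eq:
  assumes f: "intg f" and A: "A \<in> \<Sigma>"
  shows "\<exists>Q\<in>\<Sigma>. Q \<subseteq> A \<and>
    blinfun_apply x' (vm_integral f Q - vm_integral f (A - Q)) = (LINT x|V x'. indicator A x * \<bar>f x\<bar>)"
proof -
  obtain P where P: "Hahn_set (dual_comp x' \<nu>) P" using ex_Hahn by blast
  have PM: "P \<in> \<Sigma>" using P by (rule Hahn_set_sets)
  have "{x \<in> space (sigma \<Omega> \<Sigma>). 0 \<le> f x} \<in> sets (sigma \<Omega> \<Sigma>)"
    using intg_measurable[OF f] by measurable
  then have F: "{x \<in> \<Omega>. 0 \<le> f x} \<in> \<Sigma>" by (simp add: space_closed)
  let ?F = "{x \<in> \<Omega>. 0 \<le> f x}"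
  let ?Q = "A \<inter> (P \<inter> ?F \<union> ((\<Omega> - P) - ?F))"
  have Q: "?Q \<in> \<Sigma>" "?Q \<subseteq> A" using A PM F by auto
  have AQ: "A - ?Q \<in> \<Sigma>" using A Q by auto
  have "blinfun_apply x' (vm_integral f ?Q - vm_integral f (A - ?Q))
    = (LINT x|V x'. indicator ?Q x * ((if x \<in> P then 1 else -1) * f x)
        - indicator (A - ?Q) x * ((if x \<in> P then 1 else -1) * f x))"
    unfolding blinfun.diff_right apply_vm_integral[OF f Q(1)] apply_vm_integral[OF f AQ]
      signed_integral_eq[OF P Q(1) integrable_V[OF f]] signed_integral_eq[OF P AQ integrable_V[OF f]]
    by (intro Bochner_Integration.integral_diff[symmetric] integrable_Hahn_sign[OF P] Q(1) AQ integrable_V[OF f])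
  also have "\<dots> = (LINT x|V x'. indicator A x * \<bar>f x\<bar>)"
    by (intro Bochner_Integration.integral_cong) (auto simp: indicator_def)
  finally show ?thesis using Q by blast
qed

text \<open>
  The norm of \<open>L\<^sub>1(\<nu>)\<close> is order continuous along \<open>f 1\<^bsub>A\<^sub>k\<^esub>\<close>. If it were not, disjoint sets \<open>B j\<close> and functionals
  \<open>y (r j)\<close> of norm at most \<open>1\<close> would exist with \<open>|y (r j) (\<integral>\<^bsub>B j\<^esub> f d\<nu>)| \<ge> e / 4\<close>, against Orlicz-Pettis.
\<close>

lemma uniform_integral_decseq:
  assumes f: "intg f" and A: "decseq A" "range A \<subseteq> \<Sigma>"
    and null: "\<And>x'. norm x' \<le> 1 \<Longrightarrow> measure (V x') (\<Inter>n. A n) = 0" and e: "e > 0"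
  shows "\<exists>k. \<forall>x'. norm x' \<le> 1 \<longrightarrow> (LINT x|V x'. indicator (A k) x * \<bar>f x\<bar>) < e"
proof (rule ccontr)
  assume "\<not> ?thesis"
  then obtain y where y: "\<And>k. norm (y k) \<le> 1"
    "\<And>k. e \<le> (LINT x|V (y k). indicator (A k) x * \<bar>f x\<bar>)"
    by (metis not_less)
  have absf: "integrable (V x') (\<lambda>x. \<bar>f x\<bar>)" for x'
    using integrable_V[OF f] by (rule integrable_abs)
  have AM: "A n \<in> \<Sigma>" for n using A by auto
  have "\<exists>m>k. (LINT x|V (y k). indicator (A m) x * \<bar>f x\<bar>) < e / 2" for k
  proof -
    interpret finite_measure "V (y k)" by (rule finite_V)
    have "(\<Inter>n. A n) \<in> null_sets (V (y k))"
      using null[OF y(1)[of k]] AM by (auto simp: null_sets_def emeasure_eq_measure)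
    then have "\<forall>\<^sub>F m in sequentially. (LINT x|V (y k). indicator (A m) x * \<bar>f x\<bar>) < e / 2"
      using integral_decseq_tendsto_0[OF absf A(1)] A(2) e
      by (intro order_tendstoD) auto
    then obtain N where "\<And>m. m \<ge> N \<Longrightarrow> (LINT x|V (y k). indicator (A m) x * \<bar>f x\<bar>) < e / 2"
      unfolding eventually_sequentially by blast
    then show ?thesis by (intro exI[of _ "max N (Suc k)"]) auto
  qed
  then obtain g where g: "\<And>k. g k > k"
    "\<And>k. (LINT x|V (y k). indicator (A (g k)) x * \<bar>f x\<bar>) < e / 2" by metis
  define r where "r = (\<lambda>j. (g ^^ j) 0)"
  have r_Suc: "r (Suc j) = g (r j)" for j by (simp add: r_def)
  have mono: "strict_mono r" by (simp add: strict_mono_Suc_iff r_Suc g(1))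
  define C where "C = (\<lambda>j. A (r j) - A (r (Suc j)))"
  have CM: "C j \<in> \<Sigma>" for j using AM by (auto simp: C_def)
  have Cint: "(LINT x|V (y (r j)). indicator (C j) x * \<bar>f x\<bar>) > e / 2" for j
  proof -
    let ?x = "y (r j)"
    have sub: "A (r (Suc j)) \<subseteq> A (r j)"
      using decseqD[OF A(1)] mono by (simp add: strict_mono_less_eq)
    have "(LINT x|V ?x. indicator (C j) x * \<bar>f x\<bar>)
        = (LINT x|V ?x. indicator (A (r j)) x * \<bar>f x\<bar> - indicator (A (r (Suc j))) x * \<bar>f x\<bar>)"
      using sub by (intro Bochner_Integration.integral_cong) (auto simp: indicator_def C_def)
    also have "\<dots> = (LINT x|V ?x. indicator (A (r j)) x * \<bar>f x\<bar>) - (LINT x|V ?x. indicator (A (r (Suc j))) x * \<bar>f x\<bar>)"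
      by (intro Bochner_Integration.integral_diff integrable_V_indicator absf AM)
    finally show ?thesis using y(2)[of "r j"] g(2)[of "r j"] by (simp add: r_Suc)
  qed
  have disjC: "C i \<inter> C j = {}" if "i < j" for i j
  proof -
    have "A (r j) \<subseteq> A (r (Suc i))"
      using decseqD[OF A(1)] mono that by (simp add: strict_mono_less_eq)
    then show ?thesis by (auto simp: C_def)
  qed
  have "\<exists>B\<in>\<Sigma>. B \<subseteq> C j \<and> e / 4 \<le> \<bar>blinfun_apply (y (r j)) (vm_integral f B)\<bar>" for j
  proof -
    obtain Q where Q: "Q \<in> \<Sigma>" "Q \<subseteq> C j"
      "blinfun_apply (y (r j)) (vm_integral f Q - vm_integral f (C j - Q))
        = (LINT x|V (y (r j)). indicator (C j) x * \<bar>f x\<bar>)"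
      using ex_vm_integral_diff_eq[OF f CM[of j], of "y (r j)"] by blast
    have CQ: "C j - Q \<in> \<Sigma>" "C j - Q \<subseteq> C j" using CM[of j] Q by auto
    have "e / 4 \<le> \<bar>blinfun_apply (y (r j)) (vm_integral f Q)\<bar>
      \<or> e / 4 \<le> \<bar>blinfun_apply (y (r j)) (vm_integral f (C j - Q))\<bar>"
      using Q(3) Cint[of j] unfolding blinfun.diff_right by linarith
    then show ?thesis using Q(1,2) CQ by blast
  qed
  then obtain B where B: "\<And>j. B j \<in> \<Sigma>" "\<And>j. B j \<subseteq> C j"
    "\<And>j. e / 4 \<le> \<bar>blinfun_apply (y (r j)) (vm_integral f (B j))\<bar>" by metis
  have disjB: "disjoint_family B"
    unfolding disjoint_family_on_def using B(2) disjC by (metis (no_types, lifting) disjoint_iff linorder_neqE_nat subsetD)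
  define w where "w = (\<lambda>M. vm_integral f (\<Union>m\<in>M. B m))"
  have UM: "(\<Union>m\<in>M. B m) \<in> \<Sigma>" for M :: "nat set" using B(1) by (intro countable_UN') auto
  have "\<exists>k. \<bar>blinfun_apply (y (r k)) (w {k})\<bar> < e / 4"
  proof (rule Orlicz_Pettis_separable[OF separable])
    show "norm (y (r k)) \<le> 1" for k by (rule y(1))
    show "e / 4 > 0" using e by simp
    fix x' :: "'x \<Rightarrow>\<^sub>L real"
    show "summable (\<lambda>m. \<bar>blinfun_apply x' (w {m})\<bar>)"
    proof (rule summableI_nonneg_bounded)
      fix n
      have "(\<Sum>m<n. \<bar>blinfun_apply x' (w {m})\<bar>) \<le> (\<Sum>m<n. LINT x|V x'. indicator (B m) x * \<bar>f x\<bar>)"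
        using apply_vm_integral_le[OF f B(1)] by (intro sum_mono) (simp add: w_def)
      also have "\<dots> = (LINT x|V x'. (\<Sum>m<n. indicator (B m) x * \<bar>f x\<bar>))"
        by (intro Bochner_Integration.integral_sum[symmetric] integrable_V_indicator absf B(1))
      also have "\<dots> \<le> (LINT x|V x'. \<bar>f x\<bar>)"
      proof (intro integral_mono Bochner_Integration.integrable_sum integrable_V_indicator absf B(1))
        fix x
        have "(\<Sum>m<n. indicator (B m) x * \<bar>f x\<bar>) = indicator (\<Union>m<n. B m) x * \<bar>f x\<bar>"
          using disjB by (subst indicator_UN_disjoint)
            (auto simp: sum_distrib_right disjoint_family_on_def)
        also have "\<dots> \<le> \<bar>f x\<bar>" by (auto simp: indicator_def)
        finally show "(\<Sum>m<n. indicator (B m) x * \<bar>f x\<bar>) \<le> \<bar>f x\<bar>" .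
      qed
      finally show "(\<Sum>m<n. \<bar>blinfun_apply x' (w {m})\<bar>) \<le> (LINT x|V x'. \<bar>f x\<bar>)" .
    qed simp
    fix M :: "nat set"
    obtain P where P: "Hahn_set (dual_comp x' \<nu>) P" using ex_Hahn by blast
    let ?h = "\<lambda>x. (if x \<in> P then 1 else -1) * f x"
    have val: "blinfun_apply x' (vm_integral f D) = (LINT x:D|V x'. ?h x)" if "D \<in> \<Sigma>" for D
      using apply_vm_integral[OF f that, of x'] signed_integral_eq[OF P that integrable_V[OF f]]
      by (simp add: set_lebesgue_integral_def)
    let ?D = "\<lambda>m. if m \<in> M then B m else {}"
    have "(LINT x:(\<Union>m. ?D m)|V x'. ?h x) = (\<Sum>m. LINT x:?D m|V x'. ?h x)"
    proof (rule lebesgue_integral_countable_add)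
      show "?D m \<in> sets (V x')" for m using B(1) by simp
      show "?D i \<inter> ?D j = {}" if "i \<noteq> j" for i j
        using disjB that by (auto simp: disjoint_family_on_def)
      have "(\<Union>m. ?D m) \<in> \<Sigma>" using B(1) by (intro countable_UN) auto
      then show "set_integrable (V x') (\<Union>m. ?D m) ?h"
        using integrable_Hahn_sign[OF P _ integrable_V[OF f]] by (simp add: set_integrable_def)
    qed
    moreover have "(\<Union>m. ?D m) = (\<Union>m\<in>M. B m)" by auto
    moreover have "(LINT x:?D m|V x'. ?h x) = indicator M m * blinfun_apply x' (w {m})" for m
      using val[OF B(1)[of m]] by (auto simp: w_def set_lebesgue_integral_def)
    ultimately show "(\<Sum>m. indicator M m * blinfun_apply x' (w {m})) = blinfun_apply x' (w M)"
      using val[OF UM[of M]] by (simp add: w_def)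
  qed
  then obtain k where "\<bar>blinfun_apply (y (r k)) (vm_integral f (B k))\<bar> < e / 4"
    by (auto simp: w_def)
  with B(3)[of k] show False by simp
qed

text \<open>
  The supremum that defines the norm is finite: it is the supremum over a weakly bounded set of vectors of
  the form \<open>\<integral>\<^sub>Q f d\<nu> - \<integral>\<^bsub>\<Omega> - Q\<^esub> f d\<nu>\<close>.
\<close>

lemma integral_V_bounded:
  assumes f: "intg f"
  shows "\<exists>K. \<forall>x'::'x \<Rightarrow>\<^sub>L real. norm x' \<le> 1 \<longrightarrow> (LINT x|V x'. \<bar>f x\<bar>) \<le> K"
proof -
  let ?U = "{vm_integral f Q - vm_integral f (\<Omega> - Q) | Q. Q \<in> \<Sigma>}"
  have I: "(LINT x|V x'. indicator \<Omega> x * \<bar>f x\<bar>) = (LINT x|V x'. \<bar>f x\<bar>)" for x'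
    by (intro Bochner_Integration.integral_cong) auto
  have "\<exists>K. \<forall>u\<in>?U. \<bar>blinfun_apply x' u\<bar> \<le> K" for x' :: "'x \<Rightarrow>\<^sub>L real"
    using apply_vm_integral_diff_le[OF f top, of _ x'] sets_into_space
    by (intro exI[of _ "LINT x|V x'. \<bar>f x\<bar>"]) (auto simp: I)
  from weakly_bounded_imp_uniformly_bounded[OF this]
  obtain K where K: "\<forall>x'::'x \<Rightarrow>\<^sub>L real. \<forall>u\<in>?U. norm x' \<le> 1 \<longrightarrow> \<bar>blinfun_apply x' u\<bar> \<le> K" ..
  have "(LINT x|V x'. \<bar>f x\<bar>) \<le> K" if x': "norm x' \<le> 1" for x' :: "'x \<Rightarrow>\<^sub>L real"
  proof -
    obtain Q where Q: "Q \<in> \<Sigma>"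
      "blinfun_apply x' (vm_integral f Q - vm_integral f (\<Omega> - Q)) = (LINT x|V x'. \<bar>f x\<bar>)"
      using ex_vm_integral_diff_eq[OF f top, of x'] by (auto simp: I)
    have "\<bar>blinfun_apply x' (vm_integral f Q - vm_integral f (\<Omega> - Q))\<bar> \<le> K"
      using Q(1) x' by (intro K[rule_format]) auto
    then show ?thesis using Q(2) by simp
  qed
  then show ?thesis by blast
qed

lemma integral_V_le_L1norm:
  assumes f: "intg f" and x': "norm x' \<le> 1"
  shows "(LINT x|V x'. \<bar>f x\<bar>) \<le> L1norm f"
  unfolding L1_norm_def
proof (rule cSUP_upper)
  show "bdd_above ((\<lambda>x'. LINT x|V x'. \<bar>f x\<bar>) ` {x'. norm x' \<le> 1})"
    using integral_V_bounded[OF f] by (auto simp: bdd_above_def)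
qed (use x' in simp)

lemma L1norm_le:
  assumes "\<And>x'. norm x' \<le> 1 \<Longrightarrow> (LINT x|V x'. \<bar>f x\<bar>) \<le> c"
  shows "L1norm f \<le> c"
  unfolding L1_norm_def by (rule cSUP_least) (use assms in \<open>auto intro: exI[of _ 0]\<close>)

lemma L1norm_nonneg:
  assumes "intg f"
  shows "0 \<le> L1norm f"
proof -
  have "0 \<le> (LINT x|V 0. \<bar>f x\<bar>)" by (rule Bochner_Integration.integral_nonneg) simp
  also have "\<dots> \<le> L1norm f" using assms by (rule integral_V_le_L1norm) simp
  finally show ?thesis .
qed

end

section \<open>The space of classes and its dual\<close>

context separable_vector_measure
begin

text \<open>
  The class of a function in \<open>L\<^sub>1(\<nu>)\<close>, and the space \<open>L\<^sub>1(\<nu>)\<close> itself.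
\<close>

abbreviation cls :: "('a \<Rightarrow> real) \<Rightarrow> ('a \<Rightarrow> real) set" where
  "cls \<equiv> L1_class \<Omega> \<Sigma> \<nu>"

abbreviation E1 :: "('a \<Rightarrow> real) set normed_ordered" where
  "E1 \<equiv> L1 \<Omega> \<Sigma> \<nu>"

lemma null_set_subset: "null_set \<Sigma> \<nu> A \<Longrightarrow> B \<in> \<Sigma> \<Longrightarrow> B \<subseteq> A \<Longrightarrow> null_set \<Sigma> \<nu> B"
  unfolding null_set_def by blast

lemma null_set_empty: "null_set \<Sigma> \<nu> {}"
  using ca_empty[OF ca] by (auto simp: null_set_def)

lemma null_set_Un:
  assumes "null_set \<Sigma> \<nu> A" "null_set \<Sigma> \<nu> B"
  shows "null_set \<Sigma> \<nu> (A \<union> B)"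
  unfolding null_set_def
proof (intro conjI ballI impI)
  show "A \<union> B \<in> \<Sigma>" using assms by (auto simp: null_set_def)
  fix C assume C: "C \<in> \<Sigma>" "C \<subseteq> A \<union> B"
  then have "C \<inter> A \<in> \<Sigma>" "C - A \<in> \<Sigma>" "C \<inter> A \<subseteq> A" "C - A \<subseteq> B"
    using assms by (auto simp: null_set_def)
  then have "\<nu> (C \<inter> A) = 0" "\<nu> (C - A) = 0" using assms by (auto simp: null_set_def)
  then show "\<nu> C = 0" using ca_Int_Diff[OF ca C(1), of A] assms by (simp add: null_set_def)
qed

lemma null_set_V:
  assumes "null_set \<Sigma> \<nu> N"
  shows "N \<in> null_sets (V x')"
proof -
  obtain P where P: "Hahn_set (dual_comp x' \<nu>) P" using ex_Hahn by blast
  have N: "N \<in> \<Sigma>" using assms by (simp add: null_set_def)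
  have "\<nu> (N \<inter> P) = 0" "\<nu> (N - P) = 0"
    using assms Hahn_set_sets[OF P] unfolding null_set_def by auto
  then have "emeasure (V x') N = 0"
    unfolding emeasure_variation_measure[OF dual_comp_ca P N] by (simp add: dual_comp_def)
  then show ?thesis using N by auto
qed

lemma null_set_AE:
  assumes "null_set \<Sigma> \<nu> {x \<in> \<Omega>. \<not> R x}"
  shows "AE x in V x'. R x"
  using null_set_V[OF assms] by (rule AE_I') auto

lemma neq_sets:
  assumes "intg f" "intg g"
  shows "{x \<in> \<Omega>. f x \<noteq> g x} \<in> \<Sigma>"
proof -
  have "{x \<in> space (sigma \<Omega> \<Sigma>). f x \<noteq> g x} \<in> sets (sigma \<Omega> \<Sigma>)"
    using assms[THEN intg_measurable] by measurable
  then show ?thesis by (simp add: space_closed)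
qed

lemma cls_self: "intg f \<Longrightarrow> f \<in> cls f"
  using null_set_empty by (simp add: L1_class_def)

lemma cls_subset:
  assumes f: "intg f" and g: "g \<in> cls f"
  shows "cls f \<subseteq> cls g"
proof
  fix h assume h: "h \<in> cls f"
  have gi: "intg g" "intg h" "null_set \<Sigma> \<nu> {x \<in> \<Omega>. f x \<noteq> g x}" "null_set \<Sigma> \<nu> {x \<in> \<Omega>. f x \<noteq> h x}"
    using g h by (auto simp: L1_class_def)
  have "null_set \<Sigma> \<nu> {x \<in> \<Omega>. g x \<noteq> h x}"
    by (rule null_set_subset[OF null_set_Un[OF gi(3,4)] neq_sets[OF gi(1,2)]]) auto
  then show "h \<in> cls g" using gi by (simp add: L1_class_def)
qed

lemma cls_sym: "intg f \<Longrightarrow> g \<in> cls f \<Longrightarrow> f \<in> cls g"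
  using cls_subset[of f g] cls_self[of f] by blast

lemma cls_eq:
  assumes "intg f" "g \<in> cls f"
  shows "cls g = cls f"
proof (rule antisym)
  show "cls f \<subseteq> cls g" by (rule cls_subset[OF assms])
  have "intg g" using assms(2) by (simp add: L1_class_def)
  then show "cls g \<subseteq> cls f" by (rule cls_subset[OF _ cls_sym[OF assms]])
qed

lemma carrier_E1: "vcarrier E1 = cls ` {f. intg f}"
  by (simp add: L1_def)

lemma L1norm_cls:
  assumes f: "intg f" and g: "g \<in> cls f"
  shows "L1norm g = L1norm f"
proof -
  have "(LINT x|V x'. \<bar>g x\<bar>) = (LINT x|V x'. \<bar>f x\<bar>)" for x'
  proof (rule integral_cong_AE)
    have "null_set \<Sigma> \<nu> {x \<in> \<Omega>. \<not> f x = g x}" using g by (simp add: L1_class_def)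
    from null_set_AE[OF this] show "AE x in V x'. \<bar>g x\<bar> = \<bar>f x\<bar>" by eventually_elim simp
  qed (use f g intg_measurable in \<open>auto simp: L1_class_def\<close>)
  then show ?thesis by (simp add: L1_norm_def)
qed

lemma vnorm_cls:
  assumes f: "intg f"
  shows "vnorm E1 (cls f) = L1norm f"
proof -
  have "L1norm ` cls f = {L1norm f}"
  proof (intro equalityI subsetI)
    fix r assume "r \<in> L1norm ` cls f"
    then obtain g where "g \<in> cls f" "r = L1norm g" by blast
    then show "r \<in> {L1norm f}" using L1norm_cls[OF f, of g] by simp
  next
    fix r assume "r \<in> {L1norm f}"
    then show "r \<in> L1norm ` cls f" using cls_self[OF f] by simp
  qed
  then show ?thesis by (simp add: L1_def)
qed

lemma vadd_cls:
  assumes f: "intg f" and g: "intg g"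
  shows "vadd E1 (cls f) (cls g) = cls (\<lambda>x. f x + g x)"
proof -
  have eq: "cls (\<lambda>x. f' x + g' x) = cls (\<lambda>x. f x + g x)" if f': "f' \<in> cls f" and g': "g' \<in> cls g" for f' g'
  proof (rule cls_eq[OF intg_add[OF f g]])
    have i: "intg (\<lambda>x. f' x + g' x)" "null_set \<Sigma> \<nu> {x \<in> \<Omega>. f x \<noteq> f' x}" "null_set \<Sigma> \<nu> {x \<in> \<Omega>. g x \<noteq> g' x}"
      using f' g' by (auto simp: L1_class_def intro: intg_add)
    have "null_set \<Sigma> \<nu> {x \<in> \<Omega>. f x + g x \<noteq> f' x + g' x}"
      by (rule null_set_subset[OF null_set_Un[OF i(2,3)] neq_sets[OF intg_add[OF f g] i(1)]]) auto
    then show "(\<lambda>x. f' x + g' x) \<in> cls (\<lambda>x. f x + g x)" using i(1) by (simp add: L1_class_def)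
  qed
  have "(\<Union>f'\<in>cls f. \<Union>g'\<in>cls g. cls (\<lambda>x. f' x + g' x)) = (\<Union>f'\<in>cls f. \<Union>g'\<in>cls g. cls (\<lambda>x. f x + g x))"
    by (intro SUP_cong refl eq)
  also have "\<dots> = cls (\<lambda>x. f x + g x)" using cls_self[OF f] cls_self[OF g] by blast
  finally show ?thesis by (simp add: L1_def)
qed

lemma vscale_cls:
  assumes f: "intg f"
  shows "vscale E1 a (cls f) = cls (\<lambda>x. a * f x)"
proof -
  have eq: "cls (\<lambda>x. a * f' x) = cls (\<lambda>x. a * f x)" if f': "f' \<in> cls f" for f'
  proof (rule cls_eq[OF intg_scale[OF f]])
    have i: "intg (\<lambda>x. a * f' x)" "null_set \<Sigma> \<nu> {x \<in> \<Omega>. f x \<noteq> f' x}"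
      using f' by (auto simp: L1_class_def intro: intg_scale)
    have "null_set \<Sigma> \<nu> {x \<in> \<Omega>. a * f x \<noteq> a * f' x}"
      by (rule null_set_subset[OF i(2) neq_sets[OF intg_scale[OF f] i(1)]]) auto
    then show "(\<lambda>x. a * f' x) \<in> cls (\<lambda>x. a * f x)" using i(1) by (simp add: L1_class_def)
  qed
  have "(\<Union>f'\<in>cls f. cls (\<lambda>x. a * f' x)) = (\<Union>f'\<in>cls f. cls (\<lambda>x. a * f x))"
    by (intro SUP_cong refl eq)
  also have "\<dots> = cls (\<lambda>x. a * f x)" using cls_self[OF f] by blast
  finally show ?thesis by (simp add: L1_def)
qed

lemma vle_zero_cls:
  assumes f: "intg f" and "vle E1 (vzero E1) (cls f)"
  shows "AE x in V x'. 0 \<le> f x"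
proof -
  obtain h g where h: "null_set \<Sigma> \<nu> {x \<in> \<Omega>. 0 \<noteq> h x}" and g: "g \<in> cls f"
    and hg: "null_set \<Sigma> \<nu> {x \<in> \<Omega>. \<not> h x \<le> g x}"
    using assms(2) by (auto simp: L1_def L1_class_def)
  have "null_set \<Sigma> \<nu> {x \<in> \<Omega>. \<not> 0 = h x}" "null_set \<Sigma> \<nu> {x \<in> \<Omega>. \<not> f x = g x}"
    using h g by (simp_all add: L1_class_def)
  from null_set_AE[OF this(1)] null_set_AE[OF this(2)] null_set_AE[OF hg]
  show ?thesis by eventually_elim simp
qed

text \<open>
  Bounded linear functionals given on integrable functions instead of on classes. Boundedness with
  respect to the norm makes them constant on each class, so they lift to \<open>L\<^sub>1(\<nu>)\<close>.
\<close>

definition L1_functional :: "(('a \<Rightarrow> real) \<Rightarrow> real) \<Rightarrow> bool" where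
  "L1_functional T \<longleftrightarrow>
    (\<forall>f g. intg f \<longrightarrow> intg g \<longrightarrow> T (\<lambda>x. f x + g x) = T f + T g) \<and>
    (\<forall>a f. intg f \<longrightarrow> T (\<lambda>x. a * f x) = a * T f) \<and>
    (\<exists>K. \<forall>f. intg f \<longrightarrow> \<bar>T f\<bar> \<le> K * L1norm f)"

text \<open>
  The functional on classes; it evaluates \<open>T\<close> at an arbitrary representative.
\<close>

definition lift_functional :: "(('a \<Rightarrow> real) \<Rightarrow> real) \<Rightarrow> ('a \<Rightarrow> real) set \<Rightarrow> real" where
  "lift_functional T = restrict (\<lambda>F. T (SOME f. f \<in> F)) (vcarrier E1)"

lemma lift_functional_cls:
  assumes T: "L1_functional T" and f: "intg f"
  shows "lift_functional T (cls f) = T f"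
proof -
  have eq: "T g = T f" if g: "g \<in> cls f" for g
  proof -
    have gi: "intg g" using g by (simp add: L1_class_def)
    have d: "intg (\<lambda>x. g x + -1 * f x)" by (rule intg_add[OF gi intg_scale[OF f]])
    have z: "intg (\<lambda>x. 0 * f x)" by (rule intg_scale[OF f])
    have "{x \<in> \<Omega>. 0 * f x \<noteq> g x + -1 * f x} = {x \<in> \<Omega>. f x \<noteq> g x}" by auto
    then have "(\<lambda>x. g x + -1 * f x) \<in> cls (\<lambda>x. 0 * f x)"
      using d g unfolding L1_class_def by simp
    then have "L1norm (\<lambda>x. g x + -1 * f x) = L1norm (\<lambda>x. 0 * f x)" by (rule L1norm_cls[OF z])
    also have "\<dots> \<le> 0" by (rule L1norm_le) simp
    finally have n: "L1norm (\<lambda>x. g x + -1 * f x) = 0" using L1norm_nonneg[OF d] by simp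
    obtain K where "\<bar>T (\<lambda>x. g x + -1 * f x)\<bar> \<le> K * L1norm (\<lambda>x. g x + -1 * f x)"
      using T d unfolding L1_functional_def by blast
    then have "T (\<lambda>x. g x + -1 * f x) = 0" using n by simp
    moreover have "T (\<lambda>x. g x + -1 * f x) = T g + T (\<lambda>x. -1 * f x)"
      using T gi intg_scale[OF f, of "-1"] unfolding L1_functional_def by blast
    moreover have "T (\<lambda>x. -1 * f x) = -1 * T f"
      using T f unfolding L1_functional_def by blast
    ultimately show ?thesis by simp
  qed
  have "(SOME g. g \<in> cls f) \<in> cls f" by (rule someI[of "\<lambda>g. g \<in> cls f", OF cls_self[OF f]])
  then show ?thesis using f eq by (simp add: lift_functional_def carrier_E1)
qed

lemma lift_functional_bounded:
  assumes T: "L1_functional T"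
  shows "lift_functional T \<in> bounded_functionals E1"
  unfolding bounded_functionals_def
proof (intro CollectI conjI)
  show "lift_functional T \<in> extensional (vcarrier E1)"
    by (simp add: lift_functional_def)
  show "\<forall>x\<in>vcarrier E1. \<forall>y\<in>vcarrier E1.
      lift_functional T (vadd E1 x y) = lift_functional T x + lift_functional T y"
  proof -
    have "T (\<lambda>x. f x + g x) = T f + T g" if "intg f" "intg g" for f g
      using T that unfolding L1_functional_def by blast
    then show ?thesis by (auto simp: carrier_E1 vadd_cls lift_functional_cls[OF T] intg_add)
  qed
  show "\<forall>a. \<forall>x\<in>vcarrier E1. lift_functional T (vscale E1 a x) = a * lift_functional T x"
  proof -
    have "T (\<lambda>x. a * f x) = a * T f" if "intg f" for a f
      using T that unfolding L1_functional_def by blast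
    then show ?thesis by (auto simp: carrier_E1 vscale_cls lift_functional_cls[OF T] intg_scale)
  qed
  show "\<exists>K. \<forall>x\<in>vcarrier E1. \<bar>lift_functional T x\<bar> \<le> K * vnorm E1 x"
  proof -
    obtain K where "\<And>f. intg f \<Longrightarrow> \<bar>T f\<bar> \<le> K * L1norm f"
      using T unfolding L1_functional_def by blast
    then show ?thesis
      by (intro exI[of _ K]) (auto simp: carrier_E1 vnorm_cls lift_functional_cls[OF T])
  qed
qed

text \<open>
  Order continuity of the dual, for a sequence of positive functionals that decreases pointwise to \<open>0\<close>
  on the positive cone.
\<close>

lemma order_continuous_dual_sequence:
  assumes oc: "order_continuous (dual_lattice E1)"
    and T: "\<And>n. L1_functional (T n)"
    and nonneg: "\<And>n f. intg f \<Longrightarrow> (\<And>x'. AE x in V x'. 0 \<le> f x) \<Longrightarrow> 0 \<le> T n f"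
    and dec: "\<And>m n f. m \<le> n \<Longrightarrow> intg f \<Longrightarrow> (\<And>x'. AE x in V x'. 0 \<le> f x) \<Longrightarrow> T n f \<le> T m f"
    and lim: "\<And>f. intg f \<Longrightarrow> (\<And>x'. AE x in V x'. 0 \<le> f x) \<Longrightarrow> (\<lambda>n. T n f) \<longlonglongrightarrow> 0"
    and e: "e > 0"
  shows "\<exists>n. \<forall>f. intg f \<longrightarrow> L1norm f \<le> 1 \<longrightarrow> \<bar>T n f\<bar> < e"
proof -
  let ?\<phi> = "\<lambda>n. lift_functional (T n)"
  let ?D = "range ?\<phi>"
  have bf: "?\<phi> n \<in> bounded_functionals E1" for n by (rule lift_functional_bounded[OF T])
  have le: "vle (dual_lattice E1) (?\<phi> n) (?\<phi> m)" if "m \<le> n" for m n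
    using dec[OF that] vle_zero_cls by (auto simp: dual_lattice_def carrier_E1 lift_functional_cls[OF T])
  have "downward_directed (dual_lattice E1) ?D"
    unfolding downward_directed_def
  proof (intro conjI ballI)
    show "?D \<subseteq> vcarrier (dual_lattice E1)" using bf by (auto simp: dual_lattice_def)
    fix x y assume "x \<in> ?D" "y \<in> ?D"
    then obtain m n where "x = ?\<phi> m" "y = ?\<phi> n" by auto
    then show "\<exists>z\<in>?D. vle (dual_lattice E1) z x \<and> vle (dual_lattice E1) z y"
      using le[of m "max m n"] le[of n "max m n"] by auto
  qed simp
  moreover have "infimum_zero (dual_lattice E1) ?D"
    unfolding infimum_zero_def
  proof (intro conjI ballI impI)
    fix x assume "x \<in> ?D"
    then show "vle (dual_lattice E1) (vzero (dual_lattice E1)) x"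
      using nonneg vle_zero_cls by (auto simp: dual_lattice_def carrier_E1 lift_functional_cls[OF T])
  next
    fix z assume z: "\<forall>x\<in>?D. vle (dual_lattice E1) z x"
    have "z (cls f) \<le> 0" if f: "intg f" and pos: "vle E1 (vzero E1) (cls f)" for f
    proof (rule LIMSEQ_le_const)
      show "(\<lambda>n. T n f) \<longlonglongrightarrow> 0" by (rule lim[OF f vle_zero_cls[OF f pos]])
      have "z (cls f) \<le> T n f" for n
        using z f pos by (auto simp: dual_lattice_def carrier_E1 lift_functional_cls[OF T])
      then show "\<exists>N. \<forall>n\<ge>N. z (cls f) \<le> T n f" by blast
    qed
    then show "vle (dual_lattice E1) z (vzero (dual_lattice E1))"
      by (auto simp: dual_lattice_def carrier_E1)
  qed
  ultimately obtain n where n: "\<And>y. y \<in> ?D \<Longrightarrow> vle (dual_lattice E1) y (?\<phi> n) \<Longrightarrow> vnorm (dual_lattice E1) y < e"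
    using oc e unfolding order_continuous_def by blast
  have norm: "vnorm (dual_lattice E1) (?\<phi> n) < e" using n[of "?\<phi> n"] le[of n n] by simp
  have "\<bar>T n f\<bar> < e" if f: "intg f" "L1norm f \<le> 1" for f
  proof -
    obtain K where K: "\<And>f. intg f \<Longrightarrow> \<bar>T n f\<bar> \<le> K * L1norm f"
      using T unfolding L1_functional_def by blast
    have K1: "\<bar>T n f\<bar> \<le> \<bar>K\<bar>" if "intg f" "L1norm f \<le> 1" for f
    proof -
      have "\<bar>T n f\<bar> \<le> K * L1norm f" by (rule K[OF that(1)])
      also have "\<dots> \<le> \<bar>K\<bar> * 1"
        using that L1norm_nonneg[OF that(1)] by (intro mult_mono) auto
      finally show ?thesis by simp
    qed
    let ?S = "{x \<in> vcarrier E1. vnorm E1 x \<le> 1}"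
    have "bdd_above ((\<lambda>x. \<bar>?\<phi> n x\<bar>) ` ?S)"
      using K1 by (intro bdd_aboveI[of _ "\<bar>K\<bar>"]) (auto simp: carrier_E1 vnorm_cls lift_functional_cls[OF T])
    moreover have "cls f \<in> ?S" using f by (auto simp: carrier_E1 vnorm_cls)
    ultimately have "\<bar>?\<phi> n (cls f)\<bar> \<le> (SUP x\<in>?S. \<bar>?\<phi> n x\<bar>)" by (rule cSUP_upper[rotated])
    then show ?thesis using norm f by (simp add: dual_lattice_def lift_functional_cls[OF T])
  qed
  then show ?thesis by blast
qed

end

section \<open>Envelopes and conditional atoms of a subalgebra\<close>

context finite_measure
begin

text \<open>
  Inclusion up to a null set.
\<close>

definition ae_subset :: "'a set \<Rightarrow> 'a set \<Rightarrow> bool" where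
  "ae_subset A B \<longleftrightarrow> A - B \<in> null_sets M"

lemma ae_subset_trans:
  assumes "ae_subset A B" "ae_subset B C" "A \<in> sets M" "C \<in> sets M"
  shows "ae_subset A C"
proof -
  have "(A - B) \<union> (B - C) \<in> null_sets M" 
    by (rule null_sets.Un[OF assms(1,2)[unfolded ae_subset_def]])
  then show ?thesis
    unfolding ae_subset_def by (rule null_sets_subset) (use assms in auto)
qed

lemma ae_subset_Un:
  assumes "ae_subset A C" "ae_subset B C"
  shows "ae_subset (A \<union> B) C"
  using null_sets.Un[OF assms[unfolded ae_subset_def]] by (simp add: ae_subset_def Un_Diff)

lemma subset_imp_ae_subset: "A \<subseteq> B \<Longrightarrow> ae_subset A B"
  by (simp add: ae_subset_def Diff_eq_empty_iff[THEN iffD2])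

lemma measure_mono_ae_subset:
  assumes "ae_subset A B" "A \<in> sets M" "B \<in> sets M"
  shows "measure M A \<le> measure M B"
proof -
  have "measure M A \<le> measure M (B \<union> (A - B))" using assms by (intro finite_measure_mono) auto
  also have "\<dots> \<le> measure M B + measure M (A - B)" using assms by (intro measure_Un_le) auto
  also have "measure M (A - B) = 0" using assms by (simp add: ae_subset_def measure_eq_0_null_sets)
  finally show ?thesis by simp
qed

lemma ex_minimal_set:
  assumes sub: "\<C> \<subseteq> sets M" and ne: "\<C> \<noteq> {}"
    and Inter: "\<And>C. decseq C \<Longrightarrow> (\<And>n::nat. C n \<in> \<C>) \<Longrightarrow> (\<Inter>n. C n) \<in> \<C>"
  shows "\<exists>C\<in>\<C>. \<forall>D\<in>\<C>. D \<subseteq> C \<longrightarrow> measure M D = measure M C"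
proof -
  have "\<exists>C'\<in>\<C>. C' \<subseteq> C \<and> (\<forall>D\<in>\<C>. D \<subseteq> C \<longrightarrow> measure M C' \<le> measure M D + inverse (Suc n))"
    if C: "C \<in> \<C>" for C and n :: nat
  proof -
    let ?S = "measure M ` {D \<in> \<C>. D \<subseteq> C}"
    have bdd: "bdd_below ?S" by (intro bdd_belowI[of _ 0]) auto
    have "Inf ?S < Inf ?S + inverse (Suc n)" by simp
    then obtain C' where C': "C' \<in> \<C>" "C' \<subseteq> C" "measure M C' < Inf ?S + inverse (Suc n)"
      using cInf_lessD[of ?S "Inf ?S + inverse (Suc n)"] C by auto
    have "measure M C' \<le> measure M D + inverse (Suc n)" if "D \<in> \<C>" "D \<subseteq> C" for D
      using cInf_lower[OF _ bdd, of "measure M D"] that C'(3) by auto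
    then show ?thesis using C' by blast
  qed
  then have "\<forall>n C. \<exists>C'. C \<in> \<C> \<longrightarrow> C' \<in> \<C> \<and> C' \<subseteq> C \<and>
      (\<forall>D\<in>\<C>. D \<subseteq> C \<longrightarrow> measure M C' \<le> measure M D + inverse (Suc n))" by blast
  then obtain step where "\<forall>n C. C \<in> \<C> \<longrightarrow> step n C \<in> \<C> \<and> step n C \<subseteq> C \<and>
      (\<forall>D\<in>\<C>. D \<subseteq> C \<longrightarrow> measure M (step n C) \<le> measure M D + inverse (Suc n))" by metis
  then have step: "\<And>C n. C \<in> \<C> \<Longrightarrow> step n C \<in> \<C>" "\<And>C n. C \<in> \<C> \<Longrightarrow> step n C \<subseteq> C"
    "\<And>C n D. C \<in> \<C> \<Longrightarrow> D \<in> \<C> \<Longrightarrow> D \<subseteq> C \<Longrightarrow> measure M (step n C) \<le> measure M D + inverse (Suc (n::nat))"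
    by blast+
  obtain C0 where C0: "C0 \<in> \<C>" using ne by auto
  define S where "S = rec_nat C0 step"
  have S_Suc: "S (Suc n) = step n (S n)" and S0: "S 0 = C0" for n by (simp_all add: S_def)
  have SC: "S n \<in> \<C>" for n by (induction n) (use C0 step(1) in \<open>auto simp: S_Suc S0\<close>)
  have dec: "decseq S" by (rule decseq_SucI) (use SC step(2) in \<open>simp add: S_Suc\<close>)
  have IC: "(\<Inter>n. S n) \<in> \<C>" by (rule Inter[OF dec SC])
  have "measure M D = measure M (\<Inter>n. S n)" if D: "D \<in> \<C>" "D \<subseteq> (\<Inter>n. S n)" for D
  proof (rule antisym)
    show "measure M D \<le> measure M (\<Inter>n. S n)" using D IC sub by (intro finite_measure_mono) auto
    have "measure M (\<Inter>n. S n) \<le> measure M D + inverse (Suc n)" for n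
    proof -
      have "measure M (\<Inter>n. S n) \<le> measure M (S (Suc n))" using SC sub by (intro finite_measure_mono) auto
      also have "\<dots> \<le> measure M D + inverse (Suc n)" unfolding S_Suc using SC D by (intro step(3)) auto
      finally show ?thesis .
    qed
    moreover have "(\<lambda>n. measure M D + inverse (real (Suc n))) \<longlonglongrightarrow> measure M D"
      using tendsto_add[OF tendsto_const LIMSEQ_inverse_real_of_nat] by simp
    ultimately show "measure M (\<Inter>n. S n) \<le> measure M D" by (intro LIMSEQ_le_const) auto
  qed
  then show ?thesis using IC by blast
qed

end

context finite_measure_subalgebra
begin

text \<open>
  The envelope of \<open>A\<close>: the smallest set of \<open>F\<close> that contains \<open>A\<close> up to a null set, represented as the
  support of the conditional expectation of its indicator.
\<close>

definition envelope :: "'a set \<Rightarrow> 'a set" where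
  "envelope A = {x \<in> space M. nn_cond_exp M F (indicator A) x \<noteq> 0}"

lemma F_sets: "S \<in> sets F \<Longrightarrow> S \<in> sets M"
  using subalg by (auto simp: subalgebra_def)

lemma space_F: "space F = space M"
  using subalg by (auto simp: subalgebra_def)

lemma envelope_sets_F: "envelope A \<in> sets F"
proof -
  have "{x \<in> space F. nn_cond_exp M F (indicator A) x \<noteq> 0} \<in> sets F" by measurable
  then show ?thesis by (simp add: envelope_def space_F)
qed

lemma envelope_sets: "envelope A \<in> sets M"
  by (rule F_sets[OF envelope_sets_F])

lemma nn_integral_nn_cond_exp_indicator:
  assumes "A \<in> sets M" "S \<in> sets F"
  shows "(\<integral>\<^sup>+x. indicator S x * nn_cond_exp M F (indicator A) x \<partial>M) = emeasure M (A \<inter> S)"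
proof -
  have "(\<integral>\<^sup>+x. indicator S x * nn_cond_exp M F (indicator A) x \<partial>M) = (\<integral>\<^sup>+x. indicator S x * indicator A x \<partial>M)"
    using assms by (intro nn_cond_exp_intg) auto
  also have "\<dots> = (\<integral>\<^sup>+x. indicator (A \<inter> S) x \<partial>M)"
    by (intro nn_integral_cong) (auto simp: indicator_def)
  finally show ?thesis using assms F_sets by simp
qed

lemma ae_subset_envelope:
  assumes A: "A \<in> sets M"
  shows "ae_subset A (envelope A)"
proof -
  let ?S = "space M - envelope A"
  have S: "?S \<in> sets F" using envelope_sets_F[of A] sets.compl_sets[of "envelope A" F] by (simp add: space_F)
  have "emeasure M (A \<inter> ?S) = (\<integral>\<^sup>+x. indicator ?S x * nn_cond_exp M F (indicator A) x \<partial>M)"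
    using nn_integral_nn_cond_exp_indicator[OF A S] by simp
  also have "\<dots> = (\<integral>\<^sup>+x. 0 \<partial>M)"
    by (intro nn_integral_cong) (auto simp: indicator_def envelope_def)
  finally have "emeasure M (A \<inter> ?S) = 0" by simp
  moreover have "A \<inter> ?S = A - envelope A" using sets.sets_into_space[OF A] by auto
  ultimately show ?thesis using A envelope_sets[of A] by (auto simp: ae_subset_def null_sets_def)
qed

lemma envelope_least:
  assumes A: "A \<in> sets M" and S: "S \<in> sets F" and AS: "ae_subset A S"
  shows "ae_subset (envelope A) S"
proof -
  let ?S = "space M - S"
  have S': "?S \<in> sets F" using sets.compl_sets[OF S] by (simp add: space_F)
  have "A \<inter> ?S = A - S" using sets.sets_into_space[OF A] by auto
  then have "(\<integral>\<^sup>+x. indicator ?S x * nn_cond_exp M F (indicator A) x \<partial>M) = 0"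
    using nn_integral_nn_cond_exp_indicator[OF A S'] AS by (simp add: ae_subset_def null_sets_def)
  then have "AE x in M. indicator ?S x * nn_cond_exp M F (indicator A) x = 0"
    using F_sets[OF S'] by (subst (asm) nn_integral_0_iff_AE) auto
  then have "AE x in M. x \<notin> envelope A - S"
    by eventually_elim (auto simp: envelope_def indicator_def split: if_splits)
  then show ?thesis
    unfolding ae_subset_def using envelope_sets F_sets[OF S] by (auto simp: AE_iff_null_sets)
qed

lemma envelope_mono_ae:
  assumes "A \<in> sets M" "B \<in> sets M" "ae_subset A (envelope B)"
  shows "ae_subset (envelope A) (envelope B)"
  using envelope_least[OF assms(1) envelope_sets_F assms(3)] .

text \<open>
  With \<open>p = E(1\<^sub>A | F)\<close>, simple functions increasing to \<open>1 / p\<close> are admissible weights: the integrals of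
  \<open>w p\<close> increase to the integral of \<open>p / p\<close>, which is the measure of the envelope. In \<open>ennreal\<close>,
  \<open>inverse 0 * 0 = 0\<close> and \<open>top * inverse top = 0\<close>, so the bound \<open>w p \<le> 1\<close> holds everywhere.
\<close>

lemma ex_simple_weight:
  assumes A: "A \<in> sets M" and c: "c < emeasure M (envelope A)"
  shows "\<exists>w. simple_function F w \<and> (\<forall>x. w x < top) \<and>
    (\<forall>x. w x * nn_cond_exp M F (indicator A) x \<le> 1) \<and> c < (\<integral>\<^sup>+x. w x * indicator A x \<partial>M)"
proof -
  let ?p = "nn_cond_exp M F (indicator A)"
  have p[measurable]: "?p \<in> borel_measurable F" "?p \<in> borel_measurable M" by auto
  have "(\<lambda>x. inverse (?p x)) \<in> borel_measurable F" by measurable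
  then obtain w where w: "\<And>i. simple_function F (w i)" "incseq w" "\<And>i x. w i x < top"
    "\<And>x. (SUP i. w i x) = inverse (?p x)"
    using borel_measurable_implies_simple_function_sequence' by metis
  have wF[measurable]: "w i \<in> borel_measurable F" for i using w(1) by (rule borel_measurable_simple_function)
  have wM[measurable]: "w i \<in> borel_measurable M" for i by (rule measurable_from_subalg[OF subalg wF])
  have le1: "w i x * ?p x \<le> 1" for i x
  proof -
    have "w i x \<le> inverse (?p x)" using w(4)[of x] by (metis SUP_upper UNIV_I)
    then have "w i x * ?p x \<le> inverse (?p x) * ?p x" by (rule mult_right_mono) simp
    also have "\<dots> \<le> 1"
    proof (cases "?p x = 0 \<or> ?p x = top")
      case False
      then show ?thesis using ennreal_divide_self[of "?p x"]
        by (simp add: divide_ennreal_def mult.commute less_top)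
    qed auto
    finally show ?thesis .
  qed
  have "(\<integral>\<^sup>+x. indicator (space M) x * ?p x \<partial>M) = emeasure M (A \<inter> space M)"
    using nn_integral_nn_cond_exp_indicator[OF A, of "space M"] sets.top[of F] by (simp add: space_F)
  then have "(\<integral>\<^sup>+x. ?p x \<partial>M) = emeasure M (A \<inter> space M)"
    by (simp cong: nn_integral_cong_simp)
  then have "(\<integral>\<^sup>+x. ?p x \<partial>M) \<noteq> \<infinity>" using emeasure_finite by simp
  then have fin: "AE x in M. ?p x \<noteq> \<infinity>" by (intro nn_integral_PInf_AE) auto
  have "emeasure M (envelope A) = (\<integral>\<^sup>+x. indicator (envelope A) x \<partial>M)" using envelope_sets by simp
  also have "\<dots> = (\<integral>\<^sup>+x. inverse (?p x) * ?p x \<partial>M)"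
  proof (rule nn_integral_cong_AE)
    show "AE x in M. indicator (envelope A) x = inverse (?p x) * ?p x"
      using fin AE_space
    proof eventually_elim
      case (elim x)
      then show ?case
        using ennreal_divide_self[of "?p x"]
        by (cases "?p x = 0") (auto simp: envelope_def indicator_def divide_ennreal_def mult.commute less_top)
    qed
  qed
  also have "\<dots> = (\<integral>\<^sup>+x. (SUP i. w i x * ?p x) \<partial>M)"
    by (simp add: w(4)[symmetric] SUP_mult_right_ennreal)
  also have "\<dots> = (SUP i. \<integral>\<^sup>+x. w i x * ?p x \<partial>M)"
    using w(2) by (intro nn_integral_monotone_convergence_SUP)
      (auto simp: incseq_def le_fun_def intro!: mult_right_mono)
  finally obtain i where "c < (\<integral>\<^sup>+x. w i x * ?p x \<partial>M)" using c by (auto simp: less_SUP_iff)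
  also have "\<dots> = (\<integral>\<^sup>+x. w i x * indicator A x \<partial>M)" using A by (intro nn_cond_exp_intg) auto
  finally show ?thesis using w(1,3) le1 by blast
qed

text \<open>
  A set on which the measurable sets are, up to null sets, the traces of sets of \<open>F\<close>.
\<close>

definition conditional_atom :: "'a set \<Rightarrow> bool" where
  "conditional_atom C \<longleftrightarrow> C \<in> sets M \<and>
    (\<forall>D\<in>sets M. D \<subseteq> C \<longrightarrow> (\<exists>S\<in>sets F. ae_subset D (C \<inter> S) \<and> ae_subset (C \<inter> S) D))"

text \<open>
  Continuity of envelopes at small sets makes the family \<open>?\<C>\<close> of subsets of \<open>B\<close> with full envelope stable
  under decreasing intersections. A member \<open>C\<close> of minimal measure is a conditional atom: for \<open>D \<subseteq> C\<close> the set
  \<open>C - (C \<inter> envelope D - D)\<close> still has full envelope, so \<open>C \<inter> envelope D - D\<close> is null.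
\<close>

lemma ex_conditional_atom:
  assumes small: "\<And>e. e > 0 \<Longrightarrow> \<exists>\<delta>>0. \<forall>A\<in>sets M. measure M A < \<delta> \<longrightarrow> measure M (envelope A) < e"
    and B: "B \<in> sets M"
  shows "\<exists>C\<subseteq>B. conditional_atom C \<and> ae_subset B (envelope C)"
proof -
  let ?\<C> = "{C \<in> sets M. C \<subseteq> B \<and> ae_subset B (envelope C)}"
  have "\<exists>C\<in>?\<C>. \<forall>D\<in>?\<C>. D \<subseteq> C \<longrightarrow> measure M D = measure M C"
  proof (rule ex_minimal_set)
    show "?\<C> \<noteq> {}" using ae_subset_envelope[OF B] B by auto
    fix C assume dec: "decseq C" and C: "\<And>n::nat. C n \<in> ?\<C>"
    let ?I = "\<Inter>n. C n"
    have Cn: "C n \<in> sets M" "C n \<subseteq> B" "ae_subset B (envelope (C n))" for n using C by auto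
    have I: "?I \<in> sets M" using Cn by auto
    have "measure M (B - envelope ?I) \<le> e" if e: "e > 0" for e
    proof -
      obtain \<delta> where \<delta>: "\<delta> > 0" "\<And>A. A \<in> sets M \<Longrightarrow> measure M A < \<delta> \<Longrightarrow> measure M (envelope A) < e"
        using small[OF e] by blast
      have "(\<lambda>n. measure M (C n)) \<longlonglongrightarrow> measure M ?I"
        using Cn dec by (intro finite_Lim_measure_decseq) auto
      then have "(\<lambda>n. measure M (C n) - measure M ?I) \<longlonglongrightarrow> 0" by (simp add: LIM_zero_iff)
      then have "\<forall>\<^sub>F n in sequentially. measure M (C n) - measure M ?I < \<delta>"
        using \<delta>(1) by (rule order_tendstoD)
      then obtain n where "measure M (C n) - measure M ?I < \<delta>" by (auto simp: eventually_sequentially)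
      then have "measure M (C n - ?I) < \<delta>"
        using Cn I by (subst finite_measure_Diff) auto
      then have small_n: "measure M (envelope (C n - ?I)) < e" using Cn I by (intro \<delta>(2)) auto
      let ?R = "envelope ?I \<union> envelope (C n - ?I)"
      have "ae_subset (?I \<union> (C n - ?I)) ?R"
      proof (rule ae_subset_Un)
        show "ae_subset ?I ?R"
          by (rule ae_subset_trans[OF ae_subset_envelope[OF I] subset_imp_ae_subset]) (use I envelope_sets in auto)
        show "ae_subset (C n - ?I) ?R"
          by (rule ae_subset_trans[OF ae_subset_envelope subset_imp_ae_subset]) (use I Cn envelope_sets in auto)
      qed
      moreover have "?I \<union> (C n - ?I) = C n" by auto
      ultimately have "ae_subset (C n) ?R" by simp
      then have "ae_subset (envelope (C n)) ?R"
        using envelope_sets_F by (intro envelope_least Cn) auto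
      then have "ae_subset B ?R"
        by (rule ae_subset_trans[OF Cn(3)[of n]]) (use B envelope_sets in auto)
      then have "ae_subset (B - envelope ?I) (envelope (C n - ?I))"
        by (simp add: ae_subset_def Diff_Un Diff_Diff_Int Int_Diff Diff_eq Int_ac)
      then have "measure M (B - envelope ?I) \<le> measure M (envelope (C n - ?I))"
        using B envelope_sets by (intro measure_mono_ae_subset) auto
      then show ?thesis using small_n by simp
    qed
    then have "measure M (B - envelope ?I) \<le> 0" by (rule field_le_epsilon[of _ 0, simplified])
    then have "ae_subset B (envelope ?I)"
      using B envelope_sets[of ?I] by (auto simp: ae_subset_def null_sets_def emeasure_eq_measure measure_le_0_iff)
    moreover have "?I \<subseteq> B" using Cn(2)[of 0] by blast
    ultimately show "?I \<in> ?\<C>" using I by blast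
  qed auto
  then obtain C where "C \<in> ?\<C>" and minC: "\<forall>D\<in>?\<C>. D \<subseteq> C \<longrightarrow> measure M D = measure M C" ..
  then have C: "C \<in> sets M" "C \<subseteq> B" "ae_subset B (envelope C)" by blast+
  have min: "measure M D = measure M C" if "D \<in> sets M" "D \<subseteq> C" "ae_subset B (envelope D)" for D
  proof -
    have "D \<in> ?\<C>" using that C(2) by blast
    then show ?thesis using minC that(2) by blast
  qed
  have "conditional_atom C"
    unfolding conditional_atom_def
  proof (intro conjI ballI impI)
    fix D assume D: "D \<in> sets M" "D \<subseteq> C"
    let ?S = "envelope D"
    let ?C' = "C - (C \<inter> ?S - D)"
    have C': "?C' \<in> sets M" using C D envelope_sets[of D] by auto
    have DC': "ae_subset D (envelope ?C')"
      by (rule ae_subset_trans[OF subset_imp_ae_subset ae_subset_envelope[OF C']]) (use D C' envelope_sets in auto)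
    have SC': "ae_subset ?S (envelope ?C')" by (rule envelope_mono_ae[OF D(1) C' DC'])
    have "ae_subset (?C' \<union> ?S) (envelope ?C')"
      by (rule ae_subset_Un[OF ae_subset_envelope[OF C'] SC'])
    then have "ae_subset C (envelope ?C')"
      by (rule ae_subset_trans[rotated]) (use C envelope_sets in \<open>auto intro!: subset_imp_ae_subset\<close>)
    then have "ae_subset (envelope C) (envelope ?C')" by (rule envelope_mono_ae[OF C(1) C'])
    then have "ae_subset B (envelope ?C')"
      by (rule ae_subset_trans[OF C(3)]) (use B envelope_sets in auto)
    then have "measure M ?C' = measure M C" using C' by (intro min) auto
    moreover have "measure M ?C' = measure M C - measure M (C \<inter> ?S - D)"
      using C D envelope_sets[of D] by (intro finite_measure_Diff) auto
    ultimately have "measure M (C \<inter> ?S - D) = 0" by simp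
    then have 1: "ae_subset (C \<inter> ?S) D"
      using C D envelope_sets[of D] by (auto simp: ae_subset_def null_sets_def emeasure_eq_measure)
    have "D - C \<inter> ?S = D - ?S" using D by auto
    then have "ae_subset D (C \<inter> ?S)" using ae_subset_envelope[OF D(1)] by (simp add: ae_subset_def)
    then show "\<exists>S\<in>sets F. ae_subset D (C \<inter> S) \<and> ae_subset (C \<inter> S) D"
      using 1 envelope_sets_F by blast
  qed (rule C(1))
  then show ?thesis using C by blast
qed

lemma ex_conditional_atom_cover:
  assumes small: "\<And>e. e > 0 \<Longrightarrow> \<exists>\<delta>>0. \<forall>A\<in>sets M. measure M A < \<delta> \<longrightarrow> measure M (envelope A) < e"
  shows "\<exists>\<K>. countable \<K> \<and> (\<forall>C\<in>\<K>. conditional_atom C) \<and> ae_subset (space M) (\<Union>\<K>)"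
proof -
  let ?\<C> = "{space M - \<Union>\<K> | \<K>. countable \<K> \<and> (\<forall>C\<in>\<K>. conditional_atom C)}"
  have atom_sets: "conditional_atom C \<Longrightarrow> C \<in> sets M" for C by (simp add: conditional_atom_def)
  have sets: "\<Union>\<K> \<in> sets M" if "countable \<K>" "\<forall>C\<in>\<K>. conditional_atom C" for \<K>
    using that atom_sets by (intro sets.countable_Union) auto
  have "\<exists>R\<in>?\<C>. \<forall>D\<in>?\<C>. D \<subseteq> R \<longrightarrow> measure M D = measure M R"
  proof (rule ex_minimal_set)
    show "?\<C> \<subseteq> sets M" using sets by auto
    show "?\<C> \<noteq> {}" by (auto intro: exI[of _ "{}"])
    fix R assume "\<And>n::nat. R n \<in> ?\<C>"
    then have "\<forall>n. \<exists>\<K>. R n = space M - \<Union>\<K> \<and> countable \<K> \<and> (\<forall>C\<in>\<K>. conditional_atom C)" by blast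
    then obtain \<K> where K: "\<And>n. R n = space M - \<Union>(\<K> n)" "\<And>n. countable (\<K> n)"
      "\<And>n. \<forall>C\<in>\<K> n. conditional_atom C" by metis
    have "(\<Inter>n. R n) = space M - \<Union>(\<Union>n. \<K> n)" using K(1) by auto
    moreover have "countable (\<Union>n. \<K> n)" using K(2) by auto
    ultimately show "(\<Inter>n. R n) \<in> ?\<C>" using K(3) by blast
  qed
  then obtain R where R: "R \<in> ?\<C>" and minR: "\<forall>D\<in>?\<C>. D \<subseteq> R \<longrightarrow> measure M D = measure M R" ..
  from R obtain \<K> where K: "countable \<K>" "\<forall>C\<in>\<K>. conditional_atom C" and R_eq: "R = space M - \<Union>\<K>"
    by blast
  have min: "\<And>\<L>. countable \<L> \<Longrightarrow> \<forall>C\<in>\<L>. conditional_atom C \<Longrightarrow> space M - \<Union>\<L> \<subseteq> space M - \<Union>\<K>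
      \<Longrightarrow> measure M (space M - \<Union>\<L>) = measure M (space M - \<Union>\<K>)"
    using minR unfolding R_eq by blast
  let ?R = "space M - \<Union>\<K>"
  have R: "?R \<in> sets M" using sets[OF K] by auto
  obtain C where C: "C \<subseteq> ?R" "conditional_atom C" "ae_subset ?R (envelope C)"
    using ex_conditional_atom[OF small R] by blast
  have "measure M (space M - \<Union>(insert C \<K>)) = measure M ?R"
    using K C by (intro min) auto
  moreover have "space M - \<Union>(insert C \<K>) = ?R - C" by auto
  moreover have "measure M (?R - C) = measure M ?R - measure M C"
    using R C atom_sets by (intro finite_measure_Diff) auto
  ultimately have "measure M C = 0" by simp
  then have "C \<in> null_sets M" using atom_sets[OF C(2)] by (auto simp: null_sets_def emeasure_eq_measure)
  then have "ae_subset C {}" by (simp add: ae_subset_def)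
  then have "ae_subset (envelope C) {}" by (intro envelope_least atom_sets[OF C(2)]) auto
  then have "ae_subset ?R {}" by (rule ae_subset_trans[OF C(3)]) (use R in auto)
  then show ?thesis using K by (auto simp: ae_subset_def)
qed

end

text \<open>
  Terms for the elements of the algebra of sets generated by a sequence; as there are countably many
  terms, that algebra is countable.
\<close>

datatype set_term = Gen nat | Compl set_term | Join set_term set_term

instance set_term :: countable
  by countable_datatype

text \<open>
  The set denoted by a term.
\<close>

primrec interp :: "'a set \<Rightarrow> (nat \<Rightarrow> 'a set) \<Rightarrow> set_term \<Rightarrow> 'a set" where
  "interp \<Omega> g (Gen n) = g n"
| "interp \<Omega> g (Compl s) = \<Omega> - interp \<Omega> g s"
| "interp \<Omega> g (Join s t) = interp \<Omega> g s \<union> interp \<Omega> g t"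

lemma (in finite_measure) approximation_by_generated_algebra:
  assumes g: "range g \<subseteq> sets M" and A: "A \<in> sigma_sets (space M) (range g)" and e: "e > 0"
  shows "\<exists>s. measure M (sym_diff A (interp (space M) g s)) < e"
proof -
  let ?I = "interp (space M) g"
  have I: "?I s \<in> sets M" for s by (induction s) (use g in auto)
  have AM: "A \<in> sets M" if "A \<in> sigma_sets (space M) (range g)" for A
    using that g by (rule sets.sigma_sets_subset[THEN subsetD, rotated])
  show ?thesis using A e
  proof (induction A arbitrary: e rule: sigma_sets.induct)
    case (Basic a)
    then obtain n where "a = g n" by auto
    then show ?case using Basic by (intro exI[of _ "Gen n"]) simp
  next
    case Empty
    have "sym_diff {} (?I (Compl (Join (Gen 0) (Compl (Gen 0))))) = {}"
      using I[of "Gen 0"] sets.sets_into_space by auto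
    then show ?case using Empty by (metis measure_empty)
  next
    case (Compl a)
    then obtain s where s: "measure M (sym_diff a (?I s)) < e" by blast
    have "sym_diff (space M - a) (?I (Compl s)) = sym_diff a (?I s)"
      using sets.sets_into_space[OF I[of s]] sets.sets_into_space[OF AM[OF Compl(1)]] by auto
    then show ?case using s by metis
  next
    case (Union a)
    have aM: "a n \<in> sets M" for n using AM[OF Union(1)] .
    have UM: "(\<Union>n. a n) \<in> sets M" using aM by auto
    have fin: "\<exists>s. measure M (sym_diff (\<Union>i\<le>n. a i) (?I s)) < e" if "e > 0" for n :: nat and e :: real
      using that
    proof (induction n arbitrary: e)
      case 0
      then show ?case using Union(2)[of e 0] by simp
    next
      case (Suc n)
      obtain s where s: "measure M (sym_diff (\<Union>i\<le>n. a i) (?I s)) < e / 2" using Suc(1)[of "e / 2"] Suc(2) by auto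
      obtain t where t: "measure M (sym_diff (a (Suc n)) (?I t)) < e / 2" using Union(2)[of "e / 2" "Suc n"] Suc(2) by auto
      have S: "(\<Union>i\<le>k. a i) \<in> sets M" for k using aM by auto
      have "measure M (sym_diff (\<Union>i\<le>Suc n. a i) (?I (Join s t)))
          \<le> measure M (sym_diff (\<Union>i\<le>n. a i) (?I s) \<union> sym_diff (a (Suc n)) (?I t))"
        using S I aM by (intro finite_measure_mono) (auto simp: atMost_Suc)
      also have "\<dots> \<le> measure M (sym_diff (\<Union>i\<le>n. a i) (?I s)) + measure M (sym_diff (a (Suc n)) (?I t))"
        using S I aM by (intro measure_Un_le) auto
      also have "\<dots> < e" using s t by simp
      finally show ?case by blast
    qed
    have "(\<lambda>n. measure M (\<Union>i\<le>n. a i)) \<longlonglongrightarrow> measure M (\<Union>n. \<Union>i\<le>n. a i)"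
      using aM by (intro finite_Lim_measure_incseq) (auto simp: incseq_def intro: order_trans)
    moreover have "(\<Union>n. \<Union>i\<le>n. a i) = (\<Union>n. a n)" by auto
    ultimately have "(\<lambda>n. measure M (\<Union>i\<le>n. a i)) \<longlonglongrightarrow> measure M (\<Union>n. a n)" by simp
    then have "\<forall>\<^sub>F n in sequentially. measure M (\<Union>n. a n) - e / 2 < measure M (\<Union>i\<le>n. a i)"
      using Union(3) by (intro order_tendstoD(1)) auto
    then obtain n where n: "measure M (\<Union>n. a n) - e / 2 < measure M (\<Union>i\<le>n. a i)"
      by (auto simp: eventually_sequentially)
    obtain s where s: "measure M (sym_diff (\<Union>i\<le>n. a i) (?I s)) < e / 2" using fin[of "e / 2"] Union(3) by auto
    have SM: "(\<Union>i\<le>n. a i) \<in> sets M" using aM by auto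
    have "measure M (sym_diff (\<Union>n. a n) (?I s))
        \<le> measure M (sym_diff (\<Union>i\<le>n. a i) (?I s) \<union> ((\<Union>n. a n) - (\<Union>i\<le>n. a i)))"
      using SM UM I by (intro finite_measure_mono) auto
    also have "\<dots> \<le> measure M (sym_diff (\<Union>i\<le>n. a i) (?I s)) + measure M ((\<Union>n. a n) - (\<Union>i\<le>n. a i))"
      using SM UM I by (intro measure_Un_le) auto
    also have "measure M ((\<Union>n. a n) - (\<Union>i\<le>n. a i)) = measure M (\<Union>n. a n) - measure M (\<Union>i\<le>n. a i)"
      using SM UM by (intro finite_measure_Diff) auto
    also have "measure M (sym_diff (\<Union>i\<le>n. a i) (?I s)) + \<dots> < e" using s n by simp
    finally show ?case by blast
  qed
qed

text \<open>
  Off a null set \<open>A\<close> is the union of its traces \<open>C \<inter> S C\<close> on the conditional atoms, and that union lies in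
  the \<open>\<sigma>\<close>-algebra generated by \<open>G\<close> and the atoms.
\<close>

lemma (in finite_measure_subalgebra) countable_approximation:
  assumes small: "\<And>e. e > 0 \<Longrightarrow> \<exists>\<delta>>0. \<forall>A\<in>sets M. measure M A < \<delta> \<longrightarrow> measure M (envelope A) < e"
    and G: "countable G" "sets F = sigma_sets (space M) G"
  shows "\<exists>\<D>\<subseteq>sets M. countable \<D> \<and> (\<forall>A\<in>sets M. \<forall>e>0. \<exists>D\<in>\<D>. measure M (sym_diff A D) < e)"
proof -
  obtain \<K> where K: "countable \<K>" "\<And>C. C \<in> \<K> \<Longrightarrow> conditional_atom C" "ae_subset (space M) (\<Union>\<K>)"
    using ex_conditional_atom_cover[OF small] by blast
  let ?G = "insert {} (G \<union> \<K>)"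
  define g where "g = from_nat_into ?G"
  have rg: "range g = ?G" using G(1) K(1) by (simp add: g_def range_from_nat_into)
  have KM: "C \<in> sets M" if "C \<in> \<K>" for C using K(2)[OF that] by (simp add: conditional_atom_def)
  have "G \<subseteq> sets F" using G(2) by auto
  then have gM: "range g \<subseteq> sets M" unfolding rg using KM F_sets by auto
  let ?D = "range (interp (space M) g)"
  have I: "interp (space M) g s \<in> sets M" for s by (induction s) (use gM in auto)
  have "\<exists>D\<in>?D. measure M (sym_diff A D) < e" if A: "A \<in> sets M" and e: "e > 0" for A e
  proof -
    have "\<forall>C\<in>\<K>. \<exists>S\<in>sets F. ae_subset (A \<inter> C) (C \<inter> S) \<and> ae_subset (C \<inter> S) (A \<inter> C)"
      using K(2) A KM unfolding conditional_atom_def by (metis Int_lower2 sets.Int)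
    then obtain S where S: "\<And>C. C \<in> \<K> \<Longrightarrow> S C \<in> sets F"
      "\<And>C. C \<in> \<K> \<Longrightarrow> ae_subset (A \<inter> C) (C \<inter> S C)" "\<And>C. C \<in> \<K> \<Longrightarrow> ae_subset (C \<inter> S C) (A \<inter> C)"
      by metis
    let ?A = "\<Union>C\<in>\<K>. C \<inter> S C"
    let ?N = "(\<Union>C\<in>\<K>. (A \<inter> C - C \<inter> S C) \<union> (C \<inter> S C - A \<inter> C)) \<union> (space M - \<Union>\<K>)"
    have N: "?N \<in> null_sets M"
      using S(2,3) K(1,3) unfolding ae_subset_def
      by (intro null_sets.Un null_sets_UN') auto
    have "G \<subseteq> sigma_sets (space M) (range g)" unfolding rg by auto
    then have FG: "sets F \<subseteq> sigma_sets (space M) (range g)" unfolding G(2) by (rule sigma_sets_mono)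
    have KG: "\<K> \<subseteq> sigma_sets (space M) (range g)" unfolding rg by auto
    interpret S: sigma_algebra "space M" "sigma_sets (space M) (range g)"
      using gM sets.sets_into_space by (intro sigma_algebra_sigma_sets) auto
    have A': "?A \<in> sigma_sets (space M) (range g)"
      using K(1) S(1) FG KG by (intro S.countable_UN' image_subsetI S.Int) auto
    then obtain s where s: "measure M (sym_diff ?A (interp (space M) g s)) < e"
      using approximation_by_generated_algebra[OF gM A' e] by blast
    have A'M: "?A \<in> sets M" using A' gM by (rule sets.sigma_sets_subset[THEN subsetD, rotated])
    have "sym_diff A (interp (space M) g s) \<subseteq> sym_diff ?A (interp (space M) g s) \<union> ?N"
      using sets.sets_into_space[OF A] by blast
    then have "measure M (sym_diff A (interp (space M) g s)) \<le> measure M (sym_diff ?A (interp (space M) g s) \<union> ?N)"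
      using A'M I N A by (intro finite_measure_mono) (auto simp: null_sets_def)
    also have "\<dots> \<le> measure M (sym_diff ?A (interp (space M) g s)) + measure M ?N"
      using A'M I N by (intro measure_Un_le) (auto simp: null_sets_def)
    also have "\<dots> < e" using s N by (simp add: measure_eq_0_null_sets)
    finally show ?thesis by blast
  qed
  then show ?thesis using I by (intro exI[of _ ?D]) auto
qed

section \<open>A control measure and uniform integrability of the unit ball\<close>

text \<open>
  Borel-Cantelli, as a statement on the unions of tails.
\<close>

lemma (in finite_measure) limsup_of_small_sets:
  assumes A: "\<And>k::nat. A k \<in> sets M" and small: "\<And>k. measure M (A k) < (1/2) ^ k"
  shows "decseq (\<lambda>k. \<Union>m\<in>{k..}. A m)" "range (\<lambda>k. \<Union>m\<in>{k..}. A m) \<subseteq> sets M"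
    "(\<Inter>k. \<Union>m\<in>{k..}. A m) \<in> null_sets M"
proof -
  show "decseq (\<lambda>k. \<Union>m\<in>{k..}. A m)" by (fastforce simp: decseq_def)
  show "range (\<lambda>k. \<Union>m\<in>{k..}. A m) \<subseteq> sets M" using A by auto
  have "summable (\<lambda>k. measure M (A k))"
    by (rule summable_comparison_test'[OF summable_geometric[of "1/2::real"], of 0])
      (use small in \<open>auto intro: less_imp_le\<close>)
  then have "limsup A \<in> null_sets M"
    using A by (intro borel_cantelli_limsup1) (auto simp: emeasure_eq_measure)
  then show "(\<Inter>k. \<Union>m\<in>{k..}. A m) \<in> null_sets M" by (simp add: limsup_INF_SUP)
qed

text \<open>
  A sequence of functionals of norm at most \<open>1\<close> that is dense in the dual unit ball for pointwise
  convergence is fixed.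
\<close>

locale controlled_vector_measure = separable_vector_measure \<Omega> \<Sigma> \<nu>
  for \<Omega> :: "'a set" and \<Sigma> and \<nu> :: "'a set \<Rightarrow> 'x::banach" +
  fixes xs :: "nat \<Rightarrow> 'x \<Rightarrow>\<^sub>L real"
  assumes xs_norm: "norm (xs n) \<le> 1"
    and xs_dense: "norm (x' :: 'x \<Rightarrow>\<^sub>L real) \<le> 1 \<Longrightarrow> e > 0 \<Longrightarrow>
      \<exists>n. \<bar>blinfun_apply (xs n) u - blinfun_apply x' u\<bar> < e"
begin

text \<open>
  Lower semicontinuity: the norm is the supremum over the sequence \<open>xs\<close> alone.
\<close>

lemma integral_V_le_dense:
  assumes f: "intg f" and le: "\<And>n. (LINT x|V (xs n). \<bar>f x\<bar>) \<le> c" and x': "norm x' \<le> 1"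
  shows "(LINT x|V x'. \<bar>f x\<bar>) \<le> c"
proof (rule ccontr)
  assume neg: "\<not> ?thesis"
  have I: "(LINT x|V x'. indicator \<Omega> x * \<bar>f x\<bar>) = (LINT x|V x'. \<bar>f x\<bar>)" for x'
    by (intro Bochner_Integration.integral_cong) auto
  obtain Q where Q: "Q \<in> \<Sigma>" "Q \<subseteq> \<Omega>"
    and eq: "blinfun_apply x' (vm_integral f Q - vm_integral f (\<Omega> - Q)) = (LINT x|V x'. \<bar>f x\<bar>)"
    using ex_vm_integral_diff_eq[OF f top, of x'] unfolding I by blast
  let ?u = "vm_integral f Q - vm_integral f (\<Omega> - Q)"
  obtain n where n: "\<bar>blinfun_apply (xs n) ?u - blinfun_apply x' ?u\<bar> < (LINT x|V x'. \<bar>f x\<bar>) - c"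
    using xs_dense[OF x', of "(LINT x|V x'. \<bar>f x\<bar>) - c" ?u] neg by auto
  have "\<bar>blinfun_apply (xs n) ?u\<bar> \<le> (LINT x|V (xs n). \<bar>f x\<bar>)"
    using apply_vm_integral_diff_le[OF f top Q, of "xs n"] unfolding I .
  then show False using n le[of n] unfolding eq by linarith
qed

text \<open>
  The coefficients of the control measure; they sum to \<open>1\<close>.
\<close>

definition weight :: "nat \<Rightarrow> ennreal" where
  "weight n = ennreal ((1/2) ^ Suc n)"

lemma suminf_weight: "(\<Sum>n. weight n) = 1"
proof -
  have "(\<Sum>n. ennreal ((1/2) ^ Suc n)) = ennreal 1"
    by (rule suminf_ennreal_eq[OF _ power_half_series]) simp
  then show ?thesis unfolding weight_def by simp
qed

lemma weight_pos: "weight n \<noteq> 0"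
  by (simp add: weight_def)

text \<open>
  The control measure \<open>\<mu> = \<Sum>\<^sub>n weight n * |x\<^sub>n\<nu>|\<close>.
\<close>

definition ctrl :: "'a measure" where
  "ctrl = measure_of \<Omega> \<Sigma> (\<lambda>A. \<Sum>n. weight n * emeasure (V (xs n)) A)"

lemma space_ctrl [simp]: "space ctrl = \<Omega>"
  and sets_ctrl [simp]: "sets ctrl = \<Sigma>"
  by (simp_all add: ctrl_def space_closed)

lemma measurable_ctrl [simp]: "borel_measurable ctrl = borel_measurable (sigma \<Omega> \<Sigma>)"
  by (rule measurable_cong_sets) auto

lemma emeasure_ctrl:
  assumes A: "A \<in> \<Sigma>"
  shows "emeasure ctrl A = (\<Sum>n. weight n * emeasure (V (xs n)) A)"
  unfolding ctrl_def
proof (rule emeasure_measure_of_sigma[OF sigma_algebra_axioms _ _ A])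
  show "positive \<Sigma> (\<lambda>A. \<Sum>n. weight n * emeasure (V (xs n)) A)" by (simp add: positive_def)
  show "countably_additive \<Sigma> (\<lambda>A. \<Sum>n. weight n * emeasure (V (xs n)) A)"
    unfolding countably_additive_def
  proof (intro allI impI)
    fix B :: "nat \<Rightarrow> 'a set" assume B: "range B \<subseteq> \<Sigma>" "disjoint_family B"
    have "(\<Sum>i. \<Sum>n. weight n * emeasure (V (xs n)) (B i))
        = (\<Sum>i. \<integral>\<^sup>+n. weight n * emeasure (V (xs n)) (B i) \<partial>count_space UNIV)"
      by (simp add: nn_integral_count_space_nat)
    also have "\<dots> = (\<integral>\<^sup>+n. (\<Sum>i. weight n * emeasure (V (xs n)) (B i)) \<partial>count_space UNIV)"
      by (rule nn_integral_suminf[symmetric]) simp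
    also have "\<dots> = (\<Sum>n. weight n * emeasure (V (xs n)) (\<Union>i. B i))"
      using B by (simp add: nn_integral_count_space_nat ennreal_suminf_cmult suminf_emeasure)
    finally show "(\<Sum>i. \<Sum>n. weight n * emeasure (V (xs n)) (B i))
        = (\<Sum>n. weight n * emeasure (V (xs n)) (\<Union>(range B)))" .
  qed
qed

lemma null_ctrl_V:
  assumes A: "A \<in> null_sets ctrl" and x': "norm x' \<le> 1"
  shows "measure (V x') A = 0"
proof -
  have AS: "A \<in> \<Sigma>" using A by auto
  have m: "(LINT x|V x'. \<bar>indicat_real A x\<bar>) = measure (V x') A" for x'
  proof -
    have "(LINT x|V x'. \<bar>indicat_real A x\<bar>) = (LINT x|V x'. indicat_real A x)"
      by (intro Bochner_Integration.integral_cong) auto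
    also have "\<dots> = measure (V x') A"
      using sets_into_space[OF AS] by (simp add: Int_absorb2)
    finally show ?thesis .
  qed
  have "(\<Sum>n. weight n * emeasure (V (xs n)) A) = 0"
    using A emeasure_ctrl[OF AS] by auto
  then have "weight n * emeasure (V (xs n)) A = 0" for n
    by (subst (asm) suminf_eq_zero_iff) auto
  then have "emeasure (V (xs n)) A = 0" for n using weight_pos by (metis mult_eq_0_iff)
  then have "(LINT x|V (xs n). \<bar>indicat_real A x\<bar>) \<le> 0" for n unfolding m by (simp add: measure_def)
  then have "(LINT x|V x'. \<bar>indicat_real A x\<bar>) \<le> 0"
    by (rule integral_V_le_dense[OF intg_indicator[OF AS] _ x'])
  then show ?thesis unfolding m by (simp add: measure_le_0_iff)
qed

lemma AE_V_imp_AE_ctrl: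
  assumes ae: "\<And>x'. AE x in V x'. R x" and R: "{x \<in> \<Omega>. \<not> R x} \<in> \<Sigma>"
  shows "AE x in ctrl. R x"
proof -
  have "emeasure (V x') {x \<in> \<Omega>. \<not> R x} = 0" for x'
    using AE_iff_measurable[of "{x \<in> \<Omega>. \<not> R x}" "V x'" R] R ae[of x'] by simp
  then have "emeasure ctrl {x \<in> \<Omega>. \<not> R x} = 0" by (simp add: emeasure_ctrl[OF R])
  then show ?thesis using AE_iff_measurable[of "{x \<in> \<Omega>. \<not> R x}" ctrl R] R by simp
qed

text \<open>
  The density of \<open>|x\<^sub>n\<nu>|\<close> with respect to the control measure.
\<close>

definition dens :: "nat \<Rightarrow> 'a \<Rightarrow> ennreal" where
  "dens n = RN_deriv ctrl (V (xs n))"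

lemma finite_ctrl: "finite_measure ctrl"
proof (rule finite_measureI)
  obtain K where K: "\<And>x'. norm x' \<le> 1 \<Longrightarrow> (LINT x|V x'. \<bar>indicat_real \<Omega> x\<bar>) \<le> K"
    using integral_V_bounded[OF intg_indicator[OF top]] by metis
  have "emeasure (V (xs n)) \<Omega> \<le> ennreal K" for n
  proof -
    interpret finite_measure "V (xs n)" by (rule finite_V)
    have "(LINT x|V (xs n). \<bar>indicat_real \<Omega> x\<bar>) = (LINT x|V (xs n). indicat_real \<Omega> x)"
      by (intro Bochner_Integration.integral_cong) auto
    then have "measure (V (xs n)) \<Omega> \<le> K" using K[OF xs_norm[of n]] by simp
    then show ?thesis by (simp add: emeasure_eq_measure ennreal_leI)
  qed
  then have "emeasure ctrl \<Omega> \<le> (\<Sum>n. weight n * ennreal K)"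
    unfolding emeasure_ctrl[OF top] by (intro suminf_le mult_left_mono) auto
  also have "\<dots> = ennreal K" by (simp add: suminf_weight)
  finally show "emeasure ctrl (space ctrl) \<noteq> \<infinity>" by (auto simp: top_unique)
qed

sublocale ctrl: finite_measure ctrl
  by (rule finite_ctrl)

lemma density_dens: "density ctrl (dens n) = V (xs n)"
  unfolding dens_def
proof (rule ctrl.density_RN_deriv)
  show "absolutely_continuous ctrl (V (xs n))"
    unfolding absolutely_continuous_def
  proof
    fix A assume A: "A \<in> null_sets ctrl"
    interpret finite_measure "V (xs n)" by (rule finite_V)
    show "A \<in> null_sets (V (xs n))"
      using null_ctrl_V[OF A xs_norm[of n]] A by (auto simp: null_sets_def emeasure_eq_measure)
  qed
qed simp

lemma dens_measurable [measurable]: "dens n \<in> borel_measurable ctrl"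
  unfolding dens_def by (rule borel_measurable_RN_deriv)

lemma nn_integral_V:
  assumes "f \<in> borel_measurable ctrl"
  shows "(\<integral>\<^sup>+x. f x \<partial>V (xs n)) = (\<integral>\<^sup>+x. dens n x * f x \<partial>ctrl)"
  using nn_integral_density[OF dens_measurable[of n] assms] unfolding density_dens .

text \<open>
  The function \<open>?d = \<Sum>\<^sub>n weight n * dens n\<close> is a density of the control measure with respect to itself.
\<close>

lemma nn_integral_ctrl:
  assumes f[measurable]: "f \<in> borel_measurable ctrl"
  shows "(\<integral>\<^sup>+x. f x \<partial>ctrl) = (\<Sum>n. weight n * (\<integral>\<^sup>+x. f x \<partial>V (xs n)))"
proof -
  let ?d = "\<lambda>x. \<Sum>n. weight n * dens n x"
  have d[measurable]: "?d \<in> borel_measurable ctrl"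
    by measurable
  have *: "(\<integral>\<^sup>+x. ?d x * g x \<partial>ctrl) = (\<Sum>n. weight n * (\<integral>\<^sup>+x. g x \<partial>V (xs n)))"
    if g[measurable]: "g \<in> borel_measurable ctrl" for g
  proof -
    have "(\<integral>\<^sup>+x. ?d x * g x \<partial>ctrl) = (\<integral>\<^sup>+x. (\<Sum>n. weight n * (dens n x * g x)) \<partial>ctrl)"
      by (simp add: ennreal_suminf_multc[symmetric] mult.assoc)
    also have "\<dots> = (\<Sum>n. \<integral>\<^sup>+x. weight n * (dens n x * g x) \<partial>ctrl)"
      by (intro nn_integral_suminf) measurable
    also have "\<dots> = (\<Sum>n. weight n * (\<integral>\<^sup>+x. g x \<partial>V (xs n)))"
    proof (intro suminf_cong)
      fix n
      have "(\<integral>\<^sup>+x. weight n * (dens n x * g x) \<partial>ctrl) = weight n * (\<integral>\<^sup>+x. dens n x * g x \<partial>ctrl)"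
        by (rule nn_integral_cmult) measurable
      then show "(\<integral>\<^sup>+x. weight n * (dens n x * g x) \<partial>ctrl) = weight n * (\<integral>\<^sup>+x. g x \<partial>V (xs n))"
        unfolding nn_integral_V[OF g] .
    qed
    finally show ?thesis .
  qed
  have "density ctrl ?d = ctrl"
  proof (rule measure_eqI)
    fix A assume "A \<in> sets (density ctrl ?d)"
    then have A: "A \<in> \<Sigma>" by simp
    then have "emeasure (density ctrl ?d) A = (\<integral>\<^sup>+x. ?d x * indicator A x \<partial>ctrl)"
      by (intro emeasure_density d) simp
    also have "\<dots> = emeasure ctrl A"
      using A by (subst *) (auto simp: emeasure_ctrl intro!: borel_measurable_indicator)
    finally show "emeasure (density ctrl ?d) A = emeasure ctrl A" .
  qed simp
  then have "(\<integral>\<^sup>+x. f x \<partial>ctrl) = (\<integral>\<^sup>+x. ?d x * f x \<partial>ctrl)"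
    using nn_integral_density[OF d f] by simp
  then show ?thesis using *[OF f] by simp
qed

lemma integrable_ctrl:
  assumes f: "intg f"
  shows "integrable ctrl f" "(LINT x|ctrl. \<bar>f x\<bar>) \<le> L1norm f"
proof -
  have fm: "f \<in> borel_measurable ctrl" using intg_measurable[OF f] by simp
  have "(\<integral>\<^sup>+x. ennreal \<bar>f x\<bar> \<partial>ctrl) = (\<Sum>n. weight n * (\<integral>\<^sup>+x. ennreal \<bar>f x\<bar> \<partial>V (xs n)))"
    using fm by (intro nn_integral_ctrl) measurable
  also have "\<dots> \<le> (\<Sum>n. weight n * ennreal (L1norm f))"
  proof (intro suminf_le mult_left_mono)
    fix n
    have "(\<integral>\<^sup>+x. ennreal \<bar>f x\<bar> \<partial>V (xs n)) = ennreal (LINT x|V (xs n). \<bar>f x\<bar>)"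
      using integrable_V[OF f] by (intro nn_integral_eq_integral) auto
    then show "(\<integral>\<^sup>+x. ennreal \<bar>f x\<bar> \<partial>V (xs n)) \<le> ennreal (L1norm f)"
      using integral_V_le_L1norm[OF f xs_norm[of n]] by (simp add: ennreal_leI)
  qed auto
  also have "\<dots> = ennreal (L1norm f)" by (simp add: suminf_weight)
  finally have le: "(\<integral>\<^sup>+x. ennreal \<bar>f x\<bar> \<partial>ctrl) \<le> ennreal (L1norm f)" .
  then show int: "integrable ctrl f"
    using fm by (intro integrableI_bounded) (auto simp: less_top[symmetric] top_unique)
  have "(\<integral>\<^sup>+x. ennreal \<bar>f x\<bar> \<partial>ctrl) = ennreal (LINT x|ctrl. \<bar>f x\<bar>)"
    using int by (intro nn_integral_eq_integral) auto
  then show "(LINT x|ctrl. \<bar>f x\<bar>) \<le> L1norm f"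
    using le L1norm_nonneg[OF f] by (simp add: ennreal_le_iff)
qed

text \<open>
  This is the only use of the order continuity of the dual: the functionals \<open>f \<mapsto> \<integral> f 1\<^bsub>A\<^sub>k\<^esub> d\<mu>\<close> decrease to \<open>0\<close>.
\<close>

lemma uniformly_integrable_unit_ball:
  assumes oc: "order_continuous (dual_lattice E1)"
    and A: "decseq A" "range A \<subseteq> \<Sigma>" "(\<Inter>k. A k) \<in> null_sets ctrl" and e: "e > 0"
  shows "\<exists>k. \<forall>f. intg f \<longrightarrow> L1norm f \<le> 1 \<longrightarrow> \<bar>LINT x|ctrl. indicator (A k) x * f x\<bar> < e"
proof (rule order_continuous_dual_sequence[OF oc _ _ _ _ e])
  let ?T = "\<lambda>n f. LINT x|ctrl. indicator (A n) x * f x"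
  have AM: "A n \<in> \<Sigma>" for n using A by auto
  have int: "integrable ctrl (\<lambda>x. indicator (A n) x * f x)" if "intg f" for f n
    using integrable_mult_indicator[of "A n" ctrl f] integrable_ctrl(1)[OF that] AM by simp
  have ae: "AE x in ctrl. 0 \<le> f x" if f: "intg f" and nn: "\<And>x'. AE x in V x'. 0 \<le> f x" for f
  proof (rule AE_V_imp_AE_ctrl[OF nn])
    have "{x \<in> space (sigma \<Omega> \<Sigma>). \<not> 0 \<le> f x} \<in> sets (sigma \<Omega> \<Sigma>)"
      using intg_measurable[OF f] by measurable
    then show "{x \<in> \<Omega>. \<not> 0 \<le> f x} \<in> \<Sigma>" by (simp add: space_closed)
  qed
  show "L1_functional (?T n)" for n
    unfolding L1_functional_def
  proof (intro conjI allI impI exI[of _ 1])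
    fix f g assume f: "intg f" and g: "intg g"
    show "?T n (\<lambda>x. f x + g x) = ?T n f + ?T n g"
      using int[OF f] int[OF g] by (simp add: distrib_left)
  next
    fix a f assume f: "intg f"
    have "?T n (\<lambda>x. a * f x) = (LINT x|ctrl. a * (indicator (A n) x * f x))"
      by (simp add: ac_simps)
    then show "?T n (\<lambda>x. a * f x) = a * ?T n f" by simp
  next
    fix f assume f: "intg f"
    have "\<bar>?T n f\<bar> \<le> (LINT x|ctrl. \<bar>indicator (A n) x * f x\<bar>)" by (rule integral_abs_bound)
    also have "\<dots> \<le> (LINT x|ctrl. \<bar>f x\<bar>)"
      using int[OF f] integrable_ctrl(1)[OF f]
      by (intro integral_mono) (auto simp: indicator_def)
    finally show "\<bar>?T n f\<bar> \<le> 1 * L1norm f" using integrable_ctrl(2)[OF f] by simp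
  qed
  fix f assume f: "intg f" and nn: "\<And>x'. AE x in V x'. 0 \<le> f x"
  show "0 \<le> ?T n f" for n
    by (rule integral_nonneg_AE) (use ae[OF f nn] in \<open>auto elim!: eventually_mono\<close>)
  show "?T n f \<le> ?T m f" if "m \<le> n" for m n
  proof (rule integral_mono_AE[OF int[OF f] int[OF f]])
    show "AE x in ctrl. indicator (A n) x * f x \<le> indicator (A m) x * f x"
      using ae[OF f nn] by eventually_elim (use decseqD[OF A(1) that] in \<open>auto simp: indicator_def\<close>)
  qed
  show "(\<lambda>n. ?T n f) \<longlonglongrightarrow> 0"
    using A by (intro integral_decseq_tendsto_0 integrable_ctrl f) auto
qed

lemma uniformly_absolutely_continuous:
  assumes e: "e > 0"
  shows "\<exists>\<delta>>0. \<forall>A\<in>\<Sigma>. measure ctrl A < \<delta> \<longrightarrow> (\<forall>x'. norm x' \<le> 1 \<longrightarrow> measure (V x') A < e)"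
proof (rule ccontr)
  assume neg: "\<not> ?thesis"
  have "\<exists>A\<in>\<Sigma>. measure ctrl A < (1/2) ^ k \<and> (\<exists>x'. norm x' \<le> 1 \<and> e \<le> measure (V x') A)" for k :: nat
  proof -
    have "(1/2::real) ^ k > 0" by simp
    then show ?thesis using neg by (meson not_less)
  qed
  then obtain A y where A: "\<And>k. A k \<in> \<Sigma>" "\<And>k::nat. measure ctrl (A k) < (1/2) ^ k"
    "\<And>k. norm (y k) \<le> 1" "\<And>k. e \<le> measure (V (y k)) (A k)" by metis
  let ?B = "\<lambda>k. \<Union>m\<in>{k..}. A m"
  have As: "A k \<in> sets ctrl" for k using A(1) by simp
  note B = ctrl.limsup_of_small_sets[of A, OF As A(2)]
  obtain k where k: "\<And>x'. norm x' \<le> 1 \<Longrightarrow> (LINT x|V x'. indicator (?B k) x * \<bar>indicat_real \<Omega> x\<bar>) < e"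
    using uniform_integral_decseq[OF intg_indicator[OF top] B(1) _ _ e] B(2) null_ctrl_V[OF B(3)]
    by auto
  interpret finite_measure "V (y k)" by (rule finite_V)
  have BM: "?B k \<in> \<Sigma>" using B(2) by auto
  have "(LINT x|V (y k). indicator (?B k) x * \<bar>indicat_real \<Omega> x\<bar>) = (LINT x|V (y k). indicat_real (?B k) x)"
    by (intro Bochner_Integration.integral_cong) (auto simp: indicator_def)
  also have "\<dots> = measure (V (y k)) (?B k)" using sets_into_space[OF BM] by (simp add: Int_absorb2)
  finally have "measure (V (y k)) (?B k) < e" using k[OF A(3)[of k]] by simp
  moreover have "measure (V (y k)) (A k) \<le> measure (V (y k)) (?B k)"
    using BM by (intro finite_measure_mono) auto
  ultimately show False using A(4)[of k] by simp
qed

lemma intg_finite_range: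
  assumes f: "f \<in> borel_measurable (sigma \<Omega> \<Sigma>)" and fin: "finite (f ` \<Omega>)"
    and zero: "\<And>x. x \<notin> \<Omega> \<Longrightarrow> f x = 0"
  shows "intg f"
proof -
  let ?E = "\<lambda>y. f -` {y} \<inter> \<Omega>"
  have E: "?E y \<in> \<Sigma>" for y
  proof -
    have "f -` {y} \<inter> space (sigma \<Omega> \<Sigma>) \<in> sets (sigma \<Omega> \<Sigma>)" by (rule measurable_sets[OF f]) simp
    then show ?thesis by (simp add: space_closed)
  qed
  have "f = (\<lambda>x. \<Sum>y\<in>f ` \<Omega>. y * indicator (?E y) x)"
  proof
    fix x
    show "f x = (\<Sum>y\<in>f ` \<Omega>. y * indicator (?E y) x)"
    proof (cases "x \<in> \<Omega>")
      case True
      have "(\<Sum>y\<in>f ` \<Omega>. y * indicator (?E y) x) = (\<Sum>y\<in>f ` \<Omega>. if y = f x then y else 0)"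
        using True by (intro sum.cong) (auto simp: indicator_def)
      then show ?thesis using True fin by simp
    next
      case False
      then show ?thesis using zero by simp
    qed
  qed
  moreover have "intg (\<lambda>x. \<Sum>y\<in>f ` \<Omega>. y * indicator (?E y) x)"
    by (intro intg_sum fin intg_scale intg_indicator E)
  ultimately show ?thesis by simp
qed

text \<open>
  \<open>F\<close> is generated by the preimages of a countable basis of the topology of \<open>ennreal\<close> under the densities.
\<close>

lemma ex_subalgebra:
  shows "\<exists>F G. finite_measure_subalgebra ctrl F \<and> (\<forall>n. dens n \<in> borel_measurable F) \<and>
    countable G \<and> sets F = sigma_sets \<Omega> G"
proof -
  obtain B :: "ennreal set set" where B: "countable B" "topological_basis B"
    by (metis ex_countable_basis)
  let ?G = "\<Union>n. (\<lambda>b. dens n -` b \<inter> \<Omega>) ` B"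
  let ?F = "sigma \<Omega> ?G"
  have G: "?G \<subseteq> \<Sigma>"
  proof safe
    fix n b assume "b \<in> B"
    then have "b \<in> sets borel" using B(2) by (auto intro: borel_open topological_basis_open)
    from measurable_sets[OF dens_measurable this, of n] show "dens n -` b \<inter> \<Omega> \<in> \<Sigma>" by simp
  qed
  then have GP: "?G \<subseteq> Pow \<Omega>" using space_closed by blast
  have sF: "sets ?F = sigma_sets \<Omega> ?G" "space ?F = \<Omega>"
    using GP by (simp_all add: sets_measure_of space_measure_of)
  have "finite_measure_subalgebra ctrl ?F"
  proof (unfold_locales)
    show "subalgebra ctrl ?F"
      unfolding subalgebra_def sF using sigma_sets_subset[OF G] by simp
  qed
  moreover have "dens n \<in> borel_measurable ?F" for n
  proof -
    have "dens n \<in> measurable ?F (sigma UNIV B)"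
    proof (rule measurable_measure_of)
      fix b assume "b \<in> B"
      then show "dens n -` b \<inter> space ?F \<in> sets ?F" unfolding sF by (auto intro!: sigma_sets.Basic)
    qed auto
    then show ?thesis using borel_eq_countable_basis[OF B] by simp
  qed
  moreover have "countable ?G" using B(1) by auto
  ultimately show ?thesis using sF(1) by blast
qed

text \<open>
  As each density is \<open>F\<close>-measurable, \<open>\<integral> 1\<^sub>A w d|x\<^sub>n\<nu>| = \<integral> p w d|x\<^sub>n\<nu>|\<close> with \<open>p = E(1\<^sub>A | F)\<close>, and \<open>p w \<le> 1\<close>.
\<close>

lemma weighted_indicator:
  assumes F: "finite_measure_subalgebra ctrl F" and dF: "\<And>n. dens n \<in> borel_measurable F"
    and A: "A \<in> \<Sigma>" and w: "simple_function F w" "\<And>x. w x < top"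
    "\<And>x. w x * nn_cond_exp ctrl F (indicator A) x \<le> 1"
  defines "f \<equiv> \<lambda>x. enn2real (w x * indicator A x)"
  shows "intg f" "L1norm f \<le> L1norm (indicator \<Omega>)"
proof -
  interpret finite_measure_subalgebra ctrl F by (rule F)
  have wF[measurable]: "w \<in> borel_measurable F" using w(1) by (rule borel_measurable_simple_function)
  have wM: "w \<in> borel_measurable ctrl" by (rule measurable_from_subalg[OF subalg wF])
  have wA: "(\<lambda>x. w x * indicator A x) \<in> borel_measurable ctrl"
    using wM A by (intro borel_measurable_times_ennreal borel_measurable_indicator) auto
  have ef: "ennreal (f x) = w x * indicator A x" for x
    using w(2)[of x] unfolding f_def by (auto simp: indicator_def)
  have f0: "\<bar>f x\<bar> = f x" for x by (simp add: f_def)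
  show f: "intg f"
  proof (rule intg_finite_range)
    show "f \<in> borel_measurable (sigma \<Omega> \<Sigma>)"
      using borel_measurable_enn2real[OF wA] unfolding f_def by simp
    have "f ` \<Omega> \<subseteq> insert 0 (enn2real ` (w ` \<Omega>))" by (auto simp: f_def indicator_def)
    moreover have "finite (w ` \<Omega>)" using w(1) by (simp add: simple_function_def space_F)
    ultimately show "finite (f ` \<Omega>)" by (meson finite_imageI finite_insert finite_subset)
    show "f x = 0" if "x \<notin> \<Omega>" for x using that sets_into_space[OF A] by (auto simp: f_def indicator_def)
  qed
  have bound: "(LINT x|V (xs n). \<bar>f x\<bar>) \<le> L1norm (indicator \<Omega>)" for n
  proof -
    let ?p = "nn_cond_exp ctrl F (indicator A)"
    have "ennreal (LINT x|V (xs n). \<bar>f x\<bar>) = (\<integral>\<^sup>+x. ennreal \<bar>f x\<bar> \<partial>V (xs n))"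
      using integrable_V[OF f] by (intro nn_integral_eq_integral[symmetric]) auto
    also have "\<dots> = (\<integral>\<^sup>+x. w x * indicator A x \<partial>V (xs n))"
      by (intro nn_integral_cong) (simp add: ef[symmetric] f0)
    also have "\<dots> = (\<integral>\<^sup>+x. dens n x * (w x * indicator A x) \<partial>ctrl)" by (rule nn_integral_V[OF wA])
    also have "\<dots> = (\<integral>\<^sup>+x. (dens n x * w x) * indicator A x \<partial>ctrl)" by (simp add: mult.assoc)
    also have "\<dots> = (\<integral>\<^sup>+x. (dens n x * w x) * ?p x \<partial>ctrl)"
      using A by (intro nn_cond_exp_intg[symmetric] borel_measurable_times_ennreal dF wF borel_measurable_indicator) simp
    also have "\<dots> \<le> (\<integral>\<^sup>+x. dens n x * 1 \<partial>ctrl)"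
      unfolding mult.assoc by (intro nn_integral_mono mult_left_mono w(3)) simp
    also have "\<dots> = (\<integral>\<^sup>+x. 1 \<partial>V (xs n))" by (rule nn_integral_V[symmetric]) simp
    also have "\<dots> = (\<integral>\<^sup>+x. ennreal \<bar>indicat_real \<Omega> x\<bar> \<partial>V (xs n))"
      by (intro nn_integral_cong) auto
    also have "\<dots> = ennreal (LINT x|V (xs n). \<bar>indicat_real \<Omega> x\<bar>)"
      using integrable_V[OF intg_indicator[OF top]] by (intro nn_integral_eq_integral) auto
    also have "\<dots> \<le> ennreal (L1norm (indicator \<Omega>))"
      by (intro ennreal_leI integral_V_le_L1norm intg_indicator top xs_norm)
    finally show ?thesis
      using L1norm_nonneg[OF intg_indicator[OF top]] by (simp add: ennreal_le_iff)
  qed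
  show "L1norm f \<le> L1norm (indicator \<Omega>)"
    by (rule L1norm_le) (rule integral_V_le_dense[OF f bound])
qed

text \<open>
  If the measures of \<open>A k\<close> are summable but their envelopes stay large, then the unions \<open>?B k\<close> of tails decrease
  to a null set, while the weighted indicators of \<open>A k\<close> are bounded in \<open>L\<^sub>1(\<nu>)\<close>, vanish off \<open>?B k\<close>, and have
  large integrals.
\<close>

lemma small_envelope:
  assumes oc: "order_continuous (dual_lattice E1)"
    and F: "finite_measure_subalgebra ctrl F" and dF: "\<And>n. dens n \<in> borel_measurable F"
    and e: "e > 0"
  shows "\<exists>\<delta>>0. \<forall>A\<in>\<Sigma>. measure ctrl A < \<delta> \<longrightarrow> measure ctrl (finite_measure_subalgebra.envelope ctrl F A) < e"
proof (rule ccontr)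
  interpret finite_measure_subalgebra ctrl F by (rule F)
  assume neg: "\<not> ?thesis"
  have "\<exists>A\<in>\<Sigma>. measure ctrl A < (1/2) ^ k \<and> e \<le> measure ctrl (envelope A)" for k :: nat
  proof -
    have "(1/2::real) ^ k > 0" by simp
    then show ?thesis using neg by (meson not_less)
  qed
  then obtain A where A: "\<And>k. A k \<in> \<Sigma>" "\<And>k::nat. measure ctrl (A k) < (1/2) ^ k"
    "\<And>k. e \<le> measure ctrl (envelope (A k))" by metis
  let ?B = "\<lambda>k. \<Union>m\<in>{k..}. A m"
  have As: "A k \<in> sets ctrl" for k using A(1) by simp
  note B = ctrl.limsup_of_small_sets[of A, OF As A(2)]
  \<comment> \<open>The summand \<open>1\<close> keeps the normalising constant positive even if \<open>\<nu> = 0\<close>.\<close>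
  define K where "K = L1norm (indicator \<Omega>) + 1"
  have K: "K > 0" using L1norm_nonneg[OF intg_indicator[OF top]] by (simp add: K_def)
  have "\<exists>k. \<forall>f. intg f \<longrightarrow> L1norm f \<le> 1 \<longrightarrow> \<bar>LINT x|ctrl. indicator (?B k) x * f x\<bar> < e / (2 * K)"
    using B e K by (intro uniformly_integrable_unit_ball[OF oc]) auto
  then obtain k where k: "\<And>f. intg f \<Longrightarrow> L1norm f \<le> 1 \<Longrightarrow> \<bar>LINT x|ctrl. indicator (?B k) x * f x\<bar> < e / (2 * K)"
    by blast
  have "ennreal (e / 2) < emeasure ctrl (envelope (A k))"
    using A(3)[of k] e by (simp add: ctrl.emeasure_eq_measure ennreal_lessI)
  from ex_simple_weight[OF As this] obtain w where w: "simple_function F w" "\<And>x. w x < top"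
    "\<And>x. w x * nn_cond_exp ctrl F (indicator (A k)) x \<le> 1"
    "ennreal (e / 2) < (\<integral>\<^sup>+x. w x * indicator (A k) x \<partial>ctrl)" by blast
  define f where "f = (\<lambda>x. enn2real (w x * indicator (A k) x))"
  have f: "intg f" "L1norm f \<le> L1norm (indicator \<Omega>)"
    unfolding f_def by (rule weighted_indicator[OF F dF A(1) w(1-3)])+
  have ef: "ennreal (f x) = w x * indicator (A k) x" for x
    using w(2)[of x] unfolding f_def by (auto simp: indicator_def)
  have f0: "0 \<le> f x" for x by (simp add: f_def)
  have g: "intg (\<lambda>x. (1 / K) * f x)" by (rule intg_scale[OF f(1)])
  have "L1norm (\<lambda>x. (1 / K) * f x) \<le> 1"
  proof (rule L1norm_le)
    fix x' :: "'x \<Rightarrow>\<^sub>L real" assume x': "norm x' \<le> 1"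
    have "(LINT x|V x'. \<bar>f x\<bar>) \<le> K"
      using integral_V_le_L1norm[OF f(1) x'] f(2) by (simp add: K_def)
    then show "(LINT x|V x'. \<bar>(1 / K) * f x\<bar>) \<le> 1" using K by (simp add: abs_mult)
  qed
  from k[OF g this] have "\<bar>LINT x|ctrl. indicator (?B k) x * ((1 / K) * f x)\<bar> < e / (2 * K)" .
  also have "(LINT x|ctrl. indicator (?B k) x * ((1 / K) * f x)) = (LINT x|ctrl. (1 / K) * f x)"
    by (intro Bochner_Integration.integral_cong) (auto simp: f_def indicator_def)
  also have "\<dots> = (1 / K) * (LINT x|ctrl. f x)" by simp
  finally have "(LINT x|ctrl. f x) < e / 2" using K by (auto simp: field_simps abs_mult)
  moreover have "ennreal (LINT x|ctrl. f x) = (\<integral>\<^sup>+x. w x * indicator (A k) x \<partial>ctrl)"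
    using integrable_ctrl(1)[OF f(1)] f0 by (subst nn_integral_eq_integral[symmetric]) (auto simp: ef)
  ultimately show False using w(4) e by (metis ennreal_leI less_le_not_le order_less_imp_le)
qed

end

section \<open>Density of step functions and separability\<close>

context controlled_vector_measure
begin

text \<open>
  The step function with values \<open>q\<close> on sets \<open>d\<close>, for the pairs \<open>(q, d)\<close> in a list; where the sets overlap the
  values add up.
\<close>

definition step_fun :: "(real \<times> 'a set) list \<Rightarrow> 'a \<Rightarrow> real" where
  "step_fun l x = (\<Sum>(q, d)\<leftarrow>l. q * indicator d x)"

lemma step_fun_append: "step_fun (l @ l') x = step_fun l x + step_fun l' x"
  by (simp add: step_fun_def)

lemma intg_step_fun:
  assumes "set l \<subseteq> UNIV \<times> \<Sigma>"
  shows "intg (step_fun l)"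
  using assms
proof (induction l)
  case Nil
  have "step_fun [] = (\<lambda>x. 0 * indicator {} x)" by (auto simp: step_fun_def)
  then show ?case using intg_scale[OF intg_indicator[of "{}"], of 0] by simp
next
  case (Cons p l)
  obtain q d where p: "p = (q, d)" by (cases p)
  have "step_fun (p # l) = (\<lambda>x. q * indicator d x + step_fun l x)" by (auto simp: step_fun_def p)
  moreover have "intg (\<lambda>x. q * indicator d x + step_fun l x)"
    using Cons p by (intro intg_add intg_scale intg_indicator) auto
  ultimately show ?case by simp
qed

text \<open>
  \<open>f\<close> belongs to the closure in \<open>L\<^sub>1(\<nu>)\<close> of the rational step functions over \<open>\<D>\<close>.
\<close>

definition approximable :: "'a set set \<Rightarrow> ('a \<Rightarrow> real) \<Rightarrow> bool" where
  "approximable \<D> f \<longleftrightarrow> intg f \<and>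
    (\<forall>e>0. \<exists>l\<in>lists (\<rat> \<times> \<D>). \<forall>x'. norm x' \<le> 1 \<longrightarrow> (LINT x|V x'. \<bar>f x - step_fun l x\<bar>) < e)"

text \<open>
  From here on \<open>\<D>\<close> is a family of measurable sets that is dense for the distance \<open>\<mu>(A \<triangle> D)\<close>.
\<close>

context
  fixes \<D> :: "'a set set"
  assumes \<D>: "\<D> \<subseteq> \<Sigma>"
    and dense: "\<And>A e. A \<in> \<Sigma> \<Longrightarrow> e > 0 \<Longrightarrow> \<exists>D\<in>\<D>. measure ctrl (sym_diff A D) < e"
begin

lemma intg_step_fun_lists: "l \<in> lists (\<rat> \<times> \<D>) \<Longrightarrow> intg (step_fun l)"
  using \<D> by (intro intg_step_fun) auto

lemma approximable_indicator:
  assumes E: "E \<in> \<Sigma>" and q: "q \<in> \<rat>"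
  shows "approximable \<D> (\<lambda>x. q * indicator E x)"
  unfolding approximable_def
proof (intro conjI allI impI)
  show "intg (\<lambda>x. q * indicator E x)" by (intro intg_scale intg_indicator E)
  fix e :: real assume e: "e > 0"
  let ?c = "\<bar>q\<bar> + 1"
  have "e / ?c > 0" using e by simp
  then obtain \<delta> where \<delta>: "\<delta> > 0"
    "\<And>A x'. A \<in> \<Sigma> \<Longrightarrow> measure ctrl A < \<delta> \<Longrightarrow> norm x' \<le> 1 \<Longrightarrow> measure (V x') A < e / ?c"
    using uniformly_absolutely_continuous[of "e / ?c"] by metis
  obtain D where D: "D \<in> \<D>" "measure ctrl (sym_diff E D) < \<delta>" using dense[OF E \<delta>(1)] by blast
  have DS: "sym_diff E D \<in> \<Sigma>" using D E \<D> by auto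
  show "\<exists>l\<in>lists (\<rat> \<times> \<D>). \<forall>x'. norm x' \<le> 1 \<longrightarrow> (LINT x|V x'. \<bar>q * indicator E x - step_fun l x\<bar>) < e"
  proof (intro bexI[of _ "[(q, D)]"] allI impI)
    fix x' :: "'x \<Rightarrow>\<^sub>L real" assume x': "norm x' \<le> 1"
    have "(LINT x|V x'. \<bar>q * indicator E x - step_fun [(q, D)] x\<bar>)
        = (LINT x|V x'. \<bar>q\<bar> * indicat_real (sym_diff E D) x)"
      by (intro Bochner_Integration.integral_cong) (auto simp: step_fun_def indicator_def)
    also have "\<dots> = \<bar>q\<bar> * measure (V x') (sym_diff E D)"
      using sets_into_space[OF DS] by (simp add: Int_absorb2)
    also have "\<dots> \<le> ?c * measure (V x') (sym_diff E D)" by (intro mult_right_mono) auto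
    also have "\<dots> < ?c * (e / ?c)"
      using \<delta>(2)[OF DS D(2) x'] by (intro mult_strict_left_mono) auto
    also have "\<dots> = e" by simp
    finally show "(LINT x|V x'. \<bar>q * indicator E x - step_fun [(q, D)] x\<bar>) < e" .
  qed (use q D in auto)
qed

lemma approximable_add:
  assumes f: "approximable \<D> f" and g: "approximable \<D> g"
  shows "approximable \<D> (\<lambda>x. f x + g x)"
  unfolding approximable_def
proof (intro conjI allI impI)
  have fi: "intg f" "intg g" using f g by (auto simp: approximable_def)
  then show "intg (\<lambda>x. f x + g x)" by (intro intg_add)
  fix e :: real assume "e > 0"
  then have e2: "e / 2 > 0" by simp
  obtain l where l: "l \<in> lists (\<rat> \<times> \<D>)" "\<And>x'. norm x' \<le> 1 \<Longrightarrow> (LINT x|V x'. \<bar>f x - step_fun l x\<bar>) < e / 2"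
    using f e2 unfolding approximable_def by metis
  obtain m where m: "m \<in> lists (\<rat> \<times> \<D>)" "\<And>x'. norm x' \<le> 1 \<Longrightarrow> (LINT x|V x'. \<bar>g x - step_fun m x\<bar>) < e / 2"
    using g e2 unfolding approximable_def by metis
  show "\<exists>l\<in>lists (\<rat> \<times> \<D>). \<forall>x'. norm x' \<le> 1 \<longrightarrow> (LINT x|V x'. \<bar>f x + g x - step_fun l x\<bar>) < e"
  proof (intro bexI[of _ "l @ m"] allI impI)
    fix x' :: "'x \<Rightarrow>\<^sub>L real" assume x': "norm x' \<le> 1"
    have i: "integrable (V x') (\<lambda>x. f x - step_fun l x)" "integrable (V x') (\<lambda>x. g x - step_fun m x)"
      by (intro integrable_V intg_diff fi intg_step_fun_lists l(1) m(1))+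
    have "(LINT x|V x'. \<bar>f x + g x - step_fun (l @ m) x\<bar>)
        \<le> (LINT x|V x'. \<bar>f x - step_fun l x\<bar> + \<bar>g x - step_fun m x\<bar>)"
    proof (rule integral_mono)
      have "integrable (V x') (\<lambda>x. (f x - step_fun l x) + (g x - step_fun m x))"
        by (rule Bochner_Integration.integrable_add[OF i])
      then show "integrable (V x') (\<lambda>x. \<bar>f x + g x - step_fun (l @ m) x\<bar>)"
        by (intro integrable_abs) (simp add: step_fun_append algebra_simps)
    qed (use i in \<open>auto simp: step_fun_append\<close>)
    also have "\<dots> = (LINT x|V x'. \<bar>f x - step_fun l x\<bar>) + (LINT x|V x'. \<bar>g x - step_fun m x\<bar>)"
      using i by simp
    also have "\<dots> < e" using l(2)[OF x'] m(2)[OF x'] by simp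
    finally show "(LINT x|V x'. \<bar>f x + g x - step_fun (l @ m) x\<bar>) < e" .
  qed (use l(1) m(1) in auto)
qed

lemma approximable_sum:
  assumes "finite I" "\<And>i. i \<in> I \<Longrightarrow> approximable \<D> (f i)"
  shows "approximable \<D> (\<lambda>x. \<Sum>i\<in>I. f i x)"
  using assms
proof (induction I rule: finite_induct)
  case empty
  then show ?case using approximable_indicator[of \<Omega> 0] by simp
next
  case (insert i I)
  then show ?case by (simp add: approximable_add)
qed

text \<open>
  \<open>f\<close> is first replaced by the function \<open>s\<close> that rounds it down to a multiple of \<open>1 / N\<close> and is \<open>0\<close> where the
  rounded value exceeds \<open>n\<close> in modulus.
\<close>

lemma approximable_intg:
  assumes f: "intg f"
  shows "approximable \<D> f"
  unfolding approximable_def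
proof (intro conjI allI impI f)
  fix e :: real assume e: "e > 0"
  have fm[measurable]: "f \<in> borel_measurable (sigma \<Omega> \<Sigma>)" by (rule intg_measurable[OF f])
  define T where "T = (\<lambda>n::nat. {x \<in> \<Omega>. real n < \<bar>f x\<bar>})"
  have TS: "T n \<in> \<Sigma>" for n
  proof -
    have "{x \<in> space (sigma \<Omega> \<Sigma>). real n < \<bar>f x\<bar>} \<in> sets (sigma \<Omega> \<Sigma>)" by measurable
    then show ?thesis by (simp add: T_def space_closed)
  qed
  have T0: "(\<Inter>n. T n) = {}"
  proof -
    have "\<exists>n. x \<notin> T n" for x
    proof -
      obtain n where "\<bar>f x\<bar> < real n" using reals_Archimedean2 by blast
      then show ?thesis by (intro exI[of _ n]) (simp add: T_def)
    qed
    then show ?thesis by blast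
  qed
  have "decseq T" by (force simp: decseq_def T_def)
  then have "\<exists>n. \<forall>x'. norm x' \<le> 1 \<longrightarrow> (LINT x|V x'. indicator (T n) x * \<bar>f x\<bar>) < e / 4"
    using TS e by (intro uniform_integral_decseq[OF f]) (auto simp: T0)
  then obtain n where n: "\<And>x'. norm x' \<le> 1 \<Longrightarrow> (LINT x|V x'. indicator (T n) x * \<bar>f x\<bar>) < e / 4"
    by blast
  obtain K where K: "\<And>x'. norm x' \<le> 1 \<Longrightarrow> (LINT x|V x'. \<bar>indicat_real \<Omega> x\<bar>) \<le> K"
    using integral_V_bounded[OF intg_indicator[OF top]] by metis
  obtain N :: nat where N: "N > 0" "K / real N < e / 4"
  proof -
    obtain N :: nat where "max 0 K / (e / 4) < real N" using reals_Archimedean2 by blast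
    moreover have "0 \<le> max 0 K / (e / 4)" using e by simp
    ultimately have "0 < real N" by linarith
    moreover have "max 0 K < real N * (e / 4)"
      using \<open>max 0 K / (e / 4) < real N\<close> e by (simp add: pos_divide_less_eq)
    ultimately have "K / real N < e / 4" by (simp add: pos_divide_less_eq mult.commute)
    then show ?thesis using that \<open>0 < real N\<close> by simp
  qed
  define E where "E = (\<lambda>k::int. {x \<in> \<Omega>. \<lfloor>real N * f x\<rfloor> = k})"
  have ES: "E k \<in> \<Sigma>" for k
  proof -
    have "{x \<in> space (sigma \<Omega> \<Sigma>). \<lfloor>real N * f x\<rfloor> = k} \<in> sets (sigma \<Omega> \<Sigma>)" by measurable
    then show ?thesis by (simp add: E_def space_closed)
  qed
  let ?I = "{- int (N * n)..int (N * n)}"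
  define s where "s = (\<lambda>x. \<Sum>k\<in>?I. (of_int k / real N) * indicator (E k) x)"
  have s: "approximable \<D> s"
    unfolding s_def by (intro approximable_sum approximable_indicator ES) auto
  then have si: "intg s" by (simp add: approximable_def)
  have s_val: "s x = (if \<lfloor>real N * f x\<rfloor> \<in> ?I then of_int \<lfloor>real N * f x\<rfloor> / real N else 0)" if "x \<in> \<Omega>" for x
  proof -
    have "s x = (\<Sum>k\<in>?I. if k = \<lfloor>real N * f x\<rfloor> then of_int k / real N else 0)"
      unfolding s_def using that by (intro sum.cong) (auto simp: E_def indicator_def)
    then show ?thesis by simp
  qed
  have close: "\<bar>f x - s x\<bar> \<le> (1 / real N) * \<bar>indicator \<Omega> x\<bar> + indicator (T n) x * \<bar>f x\<bar>" if x: "x \<in> \<Omega>" for x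
  proof (cases "\<lfloor>real N * f x\<rfloor> \<in> ?I")
    case True
    have "f x - of_int \<lfloor>real N * f x\<rfloor> / real N = (real N * f x - of_int \<lfloor>real N * f x\<rfloor>) / real N"
      using N(1) by (simp add: field_simps)
    moreover have "\<bar>real N * f x - of_int \<lfloor>real N * f x\<rfloor>\<bar> \<le> 1" by linarith
    ultimately have "\<bar>f x - of_int \<lfloor>real N * f x\<rfloor> / real N\<bar> \<le> 1 / real N"
      by (simp add: divide_right_mono)
    moreover have "0 \<le> indicator (T n) x * \<bar>f x\<bar>" by simp
    ultimately have "\<bar>f x - of_int \<lfloor>real N * f x\<rfloor> / real N\<bar> \<le> 1 / real N + indicator (T n) x * \<bar>f x\<bar>"
      by (rule add_increasing2[rotated])
    then show ?thesis using x True by (simp add: s_val)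
  next
    case False
    have "x \<in> T n"
    proof (rule ccontr)
      assume "x \<notin> T n"
      then have "\<bar>f x\<bar> \<le> real n" using x by (simp add: T_def)
      then have "\<bar>real N * f x\<bar> \<le> real N * real n" by (simp add: abs_mult mult_left_mono)
      then have "- (real N * real n) \<le> real N * f x" "real N * f x \<le> real N * real n" by linarith+
      then have "- int (N * n) \<le> \<lfloor>real N * f x\<rfloor>" "\<lfloor>real N * f x\<rfloor> \<le> int (N * n)"
        by (simp_all add: le_floor_iff floor_le_iff)
      then show False using False by simp
    qed
    moreover have "s x = 0" using s_val[OF x] False by (simp only: if_False)
    ultimately show ?thesis by simp
  qed
  have fs: "(LINT x|V x'. \<bar>f x - s x\<bar>) < e / 2" if x': "norm x' \<le> 1" for x'
  proof -
    have i: "integrable (V x') (\<lambda>x. (1 / real N) * \<bar>indicat_real \<Omega> x\<bar>)"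
      "integrable (V x') (\<lambda>x. indicator (T n) x * \<bar>f x\<bar>)"
      using integrable_V[OF intg_indicator[OF top]] integrable_V[OF f] TS
      by (auto intro!: integrable_V_indicator)
    have "(LINT x|V x'. \<bar>f x - s x\<bar>) \<le> (LINT x|V x'. (1 / real N) * \<bar>indicator \<Omega> x\<bar> + indicator (T n) x * \<bar>f x\<bar>)"
      using i integrable_V[OF intg_diff[OF f si]] close
      by (intro integral_mono Bochner_Integration.integrable_add) auto
    also have "\<dots> = (1 / real N) * (LINT x|V x'. \<bar>indicat_real \<Omega> x\<bar>) + (LINT x|V x'. indicator (T n) x * \<bar>f x\<bar>)"
      unfolding Bochner_Integration.integral_add[OF i] by simp
    also have "(1 / real N) * (LINT x|V x'. \<bar>indicat_real \<Omega> x\<bar>) \<le> (1 / real N) * K"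
      using K[OF x'] by (intro mult_left_mono) auto
    finally have "(LINT x|V x'. \<bar>f x - s x\<bar>)
        \<le> K / real N + (LINT x|V x'. indicator (T n) x * \<bar>f x\<bar>)" by simp
    then show ?thesis using N(2) n[OF x'] by linarith
  qed
  have "e / 2 > 0" using e by simp
  then obtain l where l: "l \<in> lists (\<rat> \<times> \<D>)" "\<And>x'. norm x' \<le> 1 \<Longrightarrow> (LINT x|V x'. \<bar>s x - step_fun l x\<bar>) < e / 2"
    using s unfolding approximable_def by metis
  show "\<exists>l\<in>lists (\<rat> \<times> \<D>). \<forall>x'. norm x' \<le> 1 \<longrightarrow> (LINT x|V x'. \<bar>f x - step_fun l x\<bar>) < e"
  proof (intro bexI[of _ l] allI impI l(1))
    fix x' :: "'x \<Rightarrow>\<^sub>L real" assume x': "norm x' \<le> 1"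
    note i = integrable_V[OF intg_diff[OF f si], of x'] integrable_V[OF intg_diff[OF si intg_step_fun_lists[OF l(1)]], of x']
    have "(LINT x|V x'. \<bar>f x - step_fun l x\<bar>) \<le> (LINT x|V x'. \<bar>f x - s x\<bar> + \<bar>s x - step_fun l x\<bar>)"
      using i integrable_V[OF intg_diff[OF f intg_step_fun_lists[OF l(1)]], of x']
      by (intro integral_mono) auto
    also have "\<dots> = (LINT x|V x'. \<bar>f x - s x\<bar>) + (LINT x|V x'. \<bar>s x - step_fun l x\<bar>)" using i by simp
    also have "\<dots> < e" using fs[OF x'] l(2)[OF x'] by linarith
    finally show "(LINT x|V x'. \<bar>f x - step_fun l x\<bar>) < e" .
  qed
qed

lemma norm_separable_L1:
  assumes "countable \<D>"
  shows "norm_separable E1"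
  unfolding norm_separable_def
proof (intro exI[of _ "(\<lambda>l. cls (step_fun l)) ` lists (\<rat> \<times> \<D>)"] conjI ballI allI impI)
  show "countable ((\<lambda>l. cls (step_fun l)) ` lists (\<rat> \<times> \<D>))"
    using assms by (intro countable_image countable_lists countable_SIGMA countable_rat)
  show "(\<lambda>l. cls (step_fun l)) ` lists (\<rat> \<times> \<D>) \<subseteq> vcarrier E1"
    unfolding carrier_E1 using intg_step_fun_lists by auto
  fix F and e :: real assume F: "F \<in> vcarrier E1" and e: "e > 0"
  then obtain f where f: "intg f" "F = cls f" by (auto simp: carrier_E1)
  have "e / 2 > 0" using e by simp
  then obtain l where l: "l \<in> lists (\<rat> \<times> \<D>)" "\<And>x'. norm x' \<le> 1 \<Longrightarrow> (LINT x|V x'. \<bar>f x - step_fun l x\<bar>) < e / 2"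
    using approximable_intg[OF f(1)] unfolding approximable_def by metis
  have s: "intg (step_fun l)" by (rule intg_step_fun_lists[OF l(1)])
  have eq: "(\<lambda>x. f x + -1 * step_fun l x) = (\<lambda>x. f x - step_fun l x)" by simp
  have "vnorm E1 (vadd E1 F (vscale E1 (-1) (cls (step_fun l)))) = L1norm (\<lambda>x. f x - step_fun l x)"
    unfolding f(2) vscale_cls[OF s] vadd_cls[OF f(1) intg_scale[OF s]] eq vnorm_cls[OF intg_diff[OF f(1) s]] ..
  also have "\<dots> \<le> e / 2" by (rule L1norm_le) (use l(2) in \<open>auto intro: less_imp_le\<close>)
  also have "\<dots> < e" using e by simp
  finally show "\<exists>y\<in>(\<lambda>l. cls (step_fun l)) ` lists (\<rat> \<times> \<D>). vnorm E1 (vadd E1 F (vscale E1 (-1) y)) < e"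
    using l(1) by blast
qed

end

lemma order_continuous_dual_imp_separable:
  assumes oc: "order_continuous (dual_lattice E1)"
  shows "norm_separable E1"
proof -
  obtain F G where F: "finite_measure_subalgebra ctrl F" "\<And>n. dens n \<in> borel_measurable F"
    and G: "countable G" "sets F = sigma_sets \<Omega> G"
    using ex_subalgebra by metis
  interpret finite_measure_subalgebra ctrl F by (rule F(1))
  have small: "\<exists>\<delta>>0. \<forall>A\<in>sets ctrl. measure ctrl A < \<delta> \<longrightarrow> measure ctrl (envelope A) < e" if "e > 0" for e
    using small_envelope[OF oc F that] by simp
  have "sets F = sigma_sets (space ctrl) G" using G(2) by simp
  from countable_approximation[OF small G(1) this]
  obtain \<D> where D: "\<D> \<subseteq> sets ctrl" "countable \<D>"
    "\<forall>A\<in>sets ctrl. \<forall>e>0. \<exists>D\<in>\<D>. measure ctrl (sym_diff A D) < e" by blast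
  show ?thesis
    by (rule norm_separable_L1[of \<D>]) (use D in auto)
qed

end

theorem theorem4p3:
  fixes \<Omega> :: "'a set" and \<Sigma> :: "'a set set" and \<nu> :: "'a set \<Rightarrow> 'x::banach"
  assumes "sigma_algebra \<Omega> \<Sigma>"
    and "separable_space (euclidean :: 'x topology)"
    and "\<nu> \<in> ca \<Sigma>"
    and "order_continuous (dual_lattice (L1 \<Omega> \<Sigma> \<nu>))"
  shows "norm_separable (L1 \<Omega> \<Sigma> \<nu>)"
proof -
  obtain xs :: "nat \<Rightarrow> 'x \<Rightarrow>\<^sub>L real" where xs: "\<forall>n. norm (xs n) \<le> 1"
    "\<forall>x' u e. norm x' \<le> 1 \<longrightarrow> e > 0 \<longrightarrow> (\<exists>n. \<bar>blinfun_apply (xs n) u - blinfun_apply x' u\<bar> < e)"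
    using dual_ball_pointwise_separable[OF assms(2)] by blast
  interpret sigma_algebra \<Omega> \<Sigma> by (rule assms(1))
  interpret controlled_vector_measure \<Omega> \<Sigma> \<nu> xs
    by unfold_locales (use assms xs in auto)
  show ?thesis using assms(4) by (rule order_continuous_dual_imp_separable)
qed

end
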